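(* Let $n\geq 2$ be an integer, let $\mathbf{k}$ be an algebraically closed field containing a primitive $n$-th root of unity $q$, and let $H_n(q)$ be the Taft algebra over $\mathbf{k}$, with indecomposable modules $M(l,r)$ ($1\leq l\leq n$, $r\in\mathbb{Z}_n$). Then $$\gamma_{\operatorname{max}}([M(l,r)])=\frac{\sin\left(\frac{l\pi}{n}\right)}{\sin\left(\frac{\pi}{n}\right)}$$ for all $1\leq l\leq n$ and $r\in\mathbb{Z}_n$.
   Context: The Taft algebra $H_n(q)$ is the $n^2$-dimensional Hopf algebra generated by $g,h$ with relations $g^n=1$, $h^n=0$, $hg=q\,gh$, with $\Delta(g)=g\otimes g$, $\Delta(h)=1\otimes h+h\otimes g$, $\varepsilon(g)=1$, $\varepsilon(h)=0$, $S(g)=g^{-1}$, $S(h)=-hg^{-1}$. For $1\leq l\leq n$ and $r\in\mathbb{Z}_n$, $M(l,r)$ is the $l$-dimensional module with basis $v_1,\dots,v_l$ and action $hv_i=v_{i+1}$ for $i<l$, $hv_l=0$, $gv_i=q^{r-i+1}v_i$. These $n^2$ modules are, up to isomorphism, all the indecomposable modules; the projective ones are exactly those with $l=n$. All modules are finite-dimensional left modules. For a finite-dimensional Hopf algebra $H$, the Green ring $R=r(H)$ is the abelian group generated by isomorphism classes $[V]$ with relations $[U\oplus V]=[U]+[V]$ and product $[U][V]=[U\otimes V]$; it has $\mathbb{Z}$-basis $\{x_i\}_{i\in\mathfrak{I}}$, the isomorphism classes of indecomposable modules. $R_{\geq0}$ is the set of elements with all coefficients non-negative. The duality operator $*$ is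 the additive map with $[V]^*=[V^*]$, $V^*=\operatorname{Hom}_{\mathbf{k}}(V,\mathbf{k})$ with $(hf)(v)=f(S(h)v)$. A representation ideal is a two-sided ideal $I_{\mathfrak{X}}$ that is the $\mathbb{Z}$-span of $\{x_i\}_{i\in\mathfrak{X}}$ for some proper subset $\mathfrak{X}\subsetneq\mathfrak{I}$ and is closed under $*$; $I_{\operatorname{max}}=I_{\mathfrak{X}_{\operatorname{max}}}$ is the maximal (largest) one. For $x=\sum_i a_ix_i\in R_{\geq0}$ put $\operatorname{core}_{\operatorname{max}}(x)=\sum_{i\in\mathfrak{I}\setminus\mathfrak{X}_{\operatorname{max}}}a_ix_i$, extend $\dim_{\mathbf{k}}$ linearly to $R$, and define $\gamma_{\operatorname{max}}(x)=\limsup_{m\to\infty}\sqrt[m]{\dim_{\mathbf{k}}\operatorname{core}_{\operatorname{max}}(x^m)}$. *)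

theory Defs
  imports
    "HOL-Analysis.Analysis"
    "HOL-Algebra.QuotRing"
    "HOL-Algebra.Generated_Groups"
    "HOL-Computational_Algebra.Polynomial"
    "HOL-Library.Poly_Mapping"
    "Jordan_Normal_Form.Matrix"
begin

section \<open>Finite-dimensional algebras and Hopf algebras\<close>

text \<open>
  A finite-dimensional algebra is given by a finite set \<open>B\<close> labelling a basis
  \<open>(e b)\<close> for \<open>b \<in> B\<close>; its elements are the functions \<open>x\<close> vanishing outside \<open>B\<close>,
  standing for the sum of all \<open>x b e b\<close>. Thus \<open>alg_mul A a b c\<close> is the coefficient of
  \<open>e c\<close> in \<open>e a e b\<close>.
\<close>

record ('b, 'k) alg =
  alg_basis :: "'b set"
  alg_mul :: "'b \<Rightarrow> 'b \<Rightarrow> 'b \<Rightarrow> 'k"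
  alg_unit :: "'b \<Rightarrow> 'k"

definition bvec :: "'b \<Rightarrow> 'b \<Rightarrow> 'k::field" where
  "bvec b = (\<lambda>c. if c = b then 1 else 0)"

definition amul :: "('b, 'k::field, 'z) alg_scheme \<Rightarrow> ('b \<Rightarrow> 'k) \<Rightarrow> ('b \<Rightarrow> 'k) \<Rightarrow> 'b \<Rightarrow> 'k" where
  "amul A x y = (\<lambda>c. if c \<in> alg_basis A
     then \<Sum>a\<in>alg_basis A. \<Sum>b\<in>alg_basis A. x a * y b * alg_mul A a b c else 0)"

primrec apow :: "('b, 'k::field, 'z) alg_scheme \<Rightarrow> ('b \<Rightarrow> 'k) \<Rightarrow> nat \<Rightarrow> 'b \<Rightarrow> 'k" where
  "apow A x 0 = alg_unit A"
| "apow A x (Suc m) = amul A (apow A x m) x"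

text \<open>\<open>tens x y\<close> is the pure tensor of \<open>x\<close> and \<open>y\<close>; the tensor product of two algebras has the
  basis of all \<open>e b \<otimes> e c\<close> and the componentwise multiplication.\<close>

definition tens :: "('b \<Rightarrow> 'k::field) \<Rightarrow> ('c \<Rightarrow> 'k) \<Rightarrow> 'b \<times> 'c \<Rightarrow> 'k" where
  "tens x y = (\<lambda>(b, c). x b * y c)"

definition tensor_alg ::
    "('b, 'k::field, 'z) alg_scheme \<Rightarrow> ('c, 'k, 'w) alg_scheme \<Rightarrow> ('b \<times> 'c, 'k) alg" where
  "tensor_alg A C = \<lparr>
     alg_basis = alg_basis A \<times> alg_basis C,
     alg_mul = (\<lambda>(a, a') (b, b') (c, c'). alg_mul A a b c * alg_mul C a' b' c'),
     alg_unit = tens (alg_unit A) (alg_unit C)\<rparr>"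

text \<open>The structure maps of a Hopf algebra are given by their values on the basis.\<close>

record ('b, 'k) hopf = "('b, 'k) alg" +
  hopf_comul :: "'b \<Rightarrow> 'b \<times> 'b \<Rightarrow> 'k"
  hopf_counit :: "'b \<Rightarrow> 'k"
  hopf_antipode :: "'b \<Rightarrow> 'b \<Rightarrow> 'k"


section \<open>Finite-dimensional modules\<close>

text \<open>
  A finite-dimensional left module is taken on some column space \<open>k^d\<close>, which every such module
  is up to isomorphism: it is the dimension \<open>d\<close> together with the matrix by which each basis
  element of the algebra acts.  Values of \<open>rep_act\<close> outside the basis are irrelevant.
\<close>

record ('b, 'k) rep =
  rep_dim :: nat
  rep_act :: "'b \<Rightarrow> 'k mat"

definition act_elem :: "('b, 'k::field, 'z) alg_scheme \<Rightarrow> ('b, 'k) rep \<Rightarrow> ('b \<Rightarrow> 'k) \<Rightarrow> 'k mat" where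
  "act_elem A V x = mat (rep_dim V) (rep_dim V)
     (\<lambda>(i, j). \<Sum>b\<in>alg_basis A. x b * rep_act V b $$ (i, j))"

definition is_module :: "('b, 'k::field, 'z) alg_scheme \<Rightarrow> ('b, 'k) rep \<Rightarrow> bool" where
  "is_module A V \<longleftrightarrow>
     (\<forall>b\<in>alg_basis A. rep_act V b \<in> carrier_mat (rep_dim V) (rep_dim V)) \<and>
     act_elem A V (alg_unit A) = 1\<^sub>m (rep_dim V) \<and>
     (\<forall>a\<in>alg_basis A. \<forall>b\<in>alg_basis A.
        act_elem A V (alg_mul A a b) = rep_act V a * rep_act V b)"

definition module_iso :: "('b, 'k::field, 'z) alg_scheme \<Rightarrow> ('b, 'k) rep \<Rightarrow> ('b, 'k) rep \<Rightarrow> bool" where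
  "module_iso A U V \<longleftrightarrow> rep_dim U = rep_dim V \<and>
     (\<exists>P\<in>carrier_mat (rep_dim V) (rep_dim U). invertible_mat P \<and>
        (\<forall>b\<in>alg_basis A. P * rep_act U b = rep_act V b * P))"

definition direct_sum :: "('b, 'k::field) rep \<Rightarrow> ('b, 'k) rep \<Rightarrow> ('b, 'k) rep" where
  "direct_sum U V = \<lparr>
     rep_dim = rep_dim U + rep_dim V,
     rep_act = (\<lambda>b. four_block_mat
        (rep_act U b) (0\<^sub>m (rep_dim U) (rep_dim V))
        (0\<^sub>m (rep_dim V) (rep_dim U)) (rep_act V b))\<rparr>"

definition indecomposable :: "('b, 'k::field, 'z) alg_scheme \<Rightarrow> ('b, 'k) rep \<Rightarrow> bool" where
  "indecomposable A V \<longleftrightarrow> is_module A V \<and> rep_dim V \<noteq> 0 \<and>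
     (\<forall>U W. is_module A U \<and> is_module A W \<and> module_iso A V (direct_sum U W) \<longrightarrow>
        rep_dim U = 0 \<or> rep_dim W = 0)"

definition kronecker :: "'k::field mat \<Rightarrow> 'k mat \<Rightarrow> 'k mat" where
  "kronecker A B = mat (dim_row A * dim_row B) (dim_col A * dim_col B)
     (\<lambda>(i, j). A $$ (i div dim_row B, j div dim_col B) * B $$ (i mod dim_row B, j mod dim_col B))"

definition tensor_module ::
    "('b, 'k::field, 'z) hopf_scheme \<Rightarrow> ('b, 'k) rep \<Rightarrow> ('b, 'k) rep \<Rightarrow> ('b, 'k) rep" where
  "tensor_module H U V = \<lparr>
     rep_dim = rep_dim U * rep_dim V,
     rep_act = (\<lambda>b. mat (rep_dim U * rep_dim V) (rep_dim U * rep_dim V)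
        (\<lambda>(i, j). \<Sum>c\<in>alg_basis H. \<Sum>d\<in>alg_basis H.
           hopf_comul H b (c, d) * kronecker (rep_act U c) (rep_act V d) $$ (i, j)))\<rparr>"

definition trivial_module :: "('b, 'k::field, 'z) hopf_scheme \<Rightarrow> ('b, 'k) rep" where
  "trivial_module H = \<lparr> rep_dim = 1, rep_act = (\<lambda>b. mat 1 1 (\<lambda>_. hopf_counit H b))\<rparr>"

text \<open>The dual module with \<open>(b f)(v) = f (S(b) v)\<close>, written in the dual basis.\<close>

definition dual_module :: "('b, 'k::field, 'z) hopf_scheme \<Rightarrow> ('b, 'k) rep \<Rightarrow> ('b, 'k) rep" where
  "dual_module H V = \<lparr>
     rep_dim = rep_dim V,
     rep_act = (\<lambda>b. transpose_mat (act_elem H V (hopf_antipode H b)))\<rparr>"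


section \<open>The Green ring\<close>

type_synonym ('b, 'k) iso_cls = "('b, 'k) rep set"

definition iso_class :: "('b, 'k::field, 'z) alg_scheme \<Rightarrow> ('b, 'k) rep \<Rightarrow> ('b, 'k) iso_cls" where
  "iso_class A V = {W. is_module A W \<and> module_iso A V W}"

definition iso_classes :: "('b, 'k::field, 'z) alg_scheme \<Rightarrow> ('b, 'k) iso_cls set" where
  "iso_classes A = iso_class A ` {V. is_module A V}"

definition indec_classes :: "('b, 'k::field, 'z) alg_scheme \<Rightarrow> ('b, 'k) iso_cls set" where
  "indec_classes A = iso_class A ` {V. indecomposable A V}"

definition rep_of :: "('b, 'k) iso_cls \<Rightarrow> ('b, 'k) rep" where
  "rep_of C = (SOME V. V \<in> C)"

text \<open>The free abelian group on all isomorphism classes, with the bilinear extension of the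
  tensor product of classes.\<close>

definition class_tensor ::
    "('b, 'k::field, 'z) hopf_scheme \<Rightarrow> ('b, 'k) iso_cls \<Rightarrow> ('b, 'k) iso_cls \<Rightarrow> ('b, 'k) iso_cls" where
  "class_tensor H C D = iso_class H (tensor_module H (rep_of C) (rep_of D))"

definition free_green_ring ::
    "('b, 'k::field, 'z) hopf_scheme \<Rightarrow> (('b, 'k) iso_cls \<Rightarrow>\<^sub>0 int) ring" where
  "free_green_ring H = \<lparr>
     carrier = {x. Poly_Mapping.keys x \<subseteq> iso_classes H},
     mult = (\<lambda>x y. frag_extend (\<lambda>C. frag_extend (\<lambda>D. frag_of (class_tensor H C D)) y) x),
     one = frag_of (iso_class H (trivial_module H)),
     zero = 0,
     add = (+)\<rparr>"

definition green_relations ::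
    "('b, 'k::field, 'z) hopf_scheme \<Rightarrow> (('b, 'k) iso_cls \<Rightarrow>\<^sub>0 int) set" where
  "green_relations H = generate (add_monoid (free_green_ring H))
     {frag_of (iso_class H (direct_sum U V)) - (frag_of (iso_class H U) + frag_of (iso_class H V))
      | U V. is_module H U \<and> is_module H V}"

type_synonym ('b, 'k) green = "(('b, 'k) iso_cls \<Rightarrow>\<^sub>0 int) set"

definition green_ring :: "('b, 'k::field, 'z) hopf_scheme \<Rightarrow> ('b, 'k) green ring" where
  "green_ring H = free_green_ring H Quot green_relations H"

definition green_coset ::
    "('b, 'k::field, 'z) hopf_scheme \<Rightarrow> (('b, 'k) iso_cls \<Rightarrow>\<^sub>0 int) \<Rightarrow> ('b, 'k) green" where
  "green_coset H x = green_relations H +>\<^bsub>free_green_ring H\<^esub> x"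

definition green_class :: "('b, 'k::field, 'z) hopf_scheme \<Rightarrow> ('b, 'k) rep \<Rightarrow> ('b, 'k) green" where
  "green_class H V = green_coset H (frag_of (iso_class H V))"

text \<open>The additive map with \<open>[V]\<close> mapped to \<open>[V*]\<close>. As in the definition of \<^const>\<open>rcoset_mult\<close>,
  the union runs over all representatives of \<open>x\<close>, which all give the same coset.\<close>

definition green_dual :: "('b, 'k::field, 'z) hopf_scheme \<Rightarrow> ('b, 'k) green \<Rightarrow> ('b, 'k) green" where
  "green_dual H x = (\<Union>a\<in>x. green_coset H
     (frag_extend (\<lambda>C. frag_of (iso_class H (dual_module H (rep_of C)))) a))"

text \<open>The classes of the indecomposable modules are a basis of the Green ring (Krull-Schmidt).
  An integral combination of them is a finitely supported function supported in
  \<^const>\<open>indec_classes\<close>; \<open>green_coeffs H x\<close> is the one whose value is \<open>x\<close>.\<close>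

definition green_coeffs ::
    "('b, 'k::field, 'z) hopf_scheme \<Rightarrow> ('b, 'k) green \<Rightarrow> (('b, 'k) iso_cls \<Rightarrow>\<^sub>0 int)" where
  "green_coeffs H x =
     (THE a. Poly_Mapping.keys a \<subseteq> indec_classes H \<and> green_coset H a = x)"

definition green_dim :: "('b, 'k::field, 'z) hopf_scheme \<Rightarrow> ('b, 'k) green \<Rightarrow> int" where
  "green_dim H x = (\<Sum>C\<in>Poly_Mapping.keys (green_coeffs H x).
     Poly_Mapping.lookup (green_coeffs H x) C * int (rep_dim (rep_of C)))"


section \<open>Representation ideals and the invariant gamma\<close>

definition green_span ::
    "('b, 'k::field, 'z) hopf_scheme \<Rightarrow> ('b, 'k) iso_cls set \<Rightarrow> ('b, 'k) green set" where
  "green_span H X = generate (add_monoid (green_ring H)) ((\<lambda>C. green_coset H (frag_of C)) ` X)"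

definition rep_ideal_index :: "('b, 'k::field, 'z) hopf_scheme \<Rightarrow> ('b, 'k) iso_cls set \<Rightarrow> bool" where
  "rep_ideal_index H X \<longleftrightarrow> X \<subset> indec_classes H \<and> ideal (green_span H X) (green_ring H) \<and>
     (\<forall>x\<in>green_span H X. green_dual H x \<in> green_span H X)"

definition max_index :: "('b, 'k::field, 'z) hopf_scheme \<Rightarrow> ('b, 'k) iso_cls set" where
  "max_index H = (THE X. rep_ideal_index H X \<and>
     (\<forall>Y. rep_ideal_index H Y \<longrightarrow> green_span H Y \<subseteq> green_span H X))"

definition core_max :: "('b, 'k::field, 'z) hopf_scheme \<Rightarrow> ('b, 'k) green \<Rightarrow> ('b, 'k) green" where
  "core_max H x = green_coset H
     (frag_extend (\<lambda>C. if C \<in> max_index H then 0 else frag_of C) (green_coeffs H x))"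

definition gamma_max :: "('b, 'k::field, 'z) hopf_scheme \<Rightarrow> ('b, 'k) green \<Rightarrow> ereal" where
  "gamma_max H x = limsup (\<lambda>m.
     ereal (root m (real_of_int (green_dim H (core_max H (x [^]\<^bsub>green_ring H\<^esub> m))))))"


section \<open>The Taft algebra\<close>

text \<open>
  The label \<open>(i, j)\<close> with \<open>i, j < n\<close> stands for the basis element \<open>g^i h^j\<close>. The relations give
  \<open>h^j g^k = q^(j k) g^k h^j\<close>, whence the multiplication.
\<close>

definition taft_alg :: "nat \<Rightarrow> 'k::field \<Rightarrow> (nat \<times> nat, 'k) alg" where
  "taft_alg n q = \<lparr>
     alg_basis = {..<n} \<times> {..<n},
     alg_mul = (\<lambda>(i, j) (k, l) c.
        if j + l < n then q ^ (j * k) * bvec ((i + k) mod n, j + l) c else 0),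
     alg_unit = bvec (0, 0)\<rparr>"

abbreviation (input) taft_g :: "nat \<times> nat \<Rightarrow> 'k::field" where "taft_g \<equiv> bvec (1, 0)"
abbreviation (input) taft_h :: "nat \<times> nat \<Rightarrow> 'k::field" where "taft_h \<equiv> bvec (0, 1)"

text \<open>The comultiplication is extended multiplicatively, and the antipode antimultiplicatively,
  from their values on \<open>g\<close> and \<open>h\<close>; note that \<open>g^(-1) = g^(n-1)\<close>.\<close>

definition taft_comul_g :: "nat \<Rightarrow> 'k::field \<Rightarrow> (nat \<times> nat) \<times> (nat \<times> nat) \<Rightarrow> 'k" where
  "taft_comul_g n q = tens taft_g taft_g"

definition taft_comul_h :: "nat \<Rightarrow> 'k::field \<Rightarrow> (nat \<times> nat) \<times> (nat \<times> nat) \<Rightarrow> 'k" where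
  "taft_comul_h n q = (\<lambda>p. tens (alg_unit (taft_alg n q)) taft_h p + tens taft_h taft_g p)"

definition taft_antipode_g :: "nat \<Rightarrow> 'k::field \<Rightarrow> nat \<times> nat \<Rightarrow> 'k" where
  "taft_antipode_g n q = bvec (n - 1, 0)"

definition taft_antipode_h :: "nat \<Rightarrow> 'k::field \<Rightarrow> nat \<times> nat \<Rightarrow> 'k" where
  "taft_antipode_h n q = (\<lambda>c. - amul (taft_alg n q) taft_h (bvec (n - 1, 0)) c)"

definition taft :: "nat \<Rightarrow> 'k::field \<Rightarrow> (nat \<times> nat, 'k) hopf" where
  "taft n q = alg.extend (taft_alg n q) \<lparr>
     hopf_comul = (\<lambda>(i, j). let T = tensor_alg (taft_alg n q) (taft_alg n q) in
        amul T (apow T (taft_comul_g n q) i) (apow T (taft_comul_h n q) j)),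
     hopf_counit = (\<lambda>(i, j). if j = 0 then 1 else 0),
     hopf_antipode = (\<lambda>(i, j). let A = taft_alg n q in
        amul A (apow A (taft_antipode_h n q) j) (apow A (taft_antipode_g n q) i))\<rparr>"

text \<open>The multiplication and structure maps satisfy the defining relations of the Taft algebra,
  and the basis element labelled \<open>(i, j)\<close> is \<open>g^i h^j\<close>.\<close>

lemma amul_bvec:
  assumes "finite (alg_basis A)" "a \<in> alg_basis A" "b \<in> alg_basis A"
  shows "amul A (\<lambda>z. s * bvec a z) (bvec b) c =
    (if c \<in> alg_basis A then s * alg_mul A a b c else 0)"
proof -
  have "(\<Sum>a'\<in>alg_basis A. \<Sum>b'\<in>alg_basis A. s * bvec a a' * bvec b b' * alg_mul A a' b' c)
      = (\<Sum>a'\<in>alg_basis A. if a' = a then s * alg_mul A a b c else 0)"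
  proof (rule sum.cong[OF refl])
    fix a'
    have "(\<Sum>b'\<in>alg_basis A. s * bvec a a' * bvec b b' * alg_mul A a' b' c)
       = (\<Sum>b'\<in>alg_basis A. if b' = b then s * bvec a a' * alg_mul A a' b c else 0)"
      by (rule sum.cong) (auto simp: bvec_def)
    then show "(\<Sum>b'\<in>alg_basis A. s * bvec a a' * bvec b b' * alg_mul A a' b' c)
       = (if a' = a then s * alg_mul A a b c else 0)"
      using assms by (simp add: bvec_def)
  qed
  then show ?thesis using assms by (simp add: amul_def)
qed

lemma amul_bvec_1:
  assumes "finite (alg_basis A)" "a \<in> alg_basis A" "b \<in> alg_basis A"
  shows "amul A (bvec a) (bvec b) = (\<lambda>c. if c \<in> alg_basis A then alg_mul A a b c else 0)"
  using amul_bvec[OF assms, of 1] by (simp add: fun_eq_iff)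

lemma taft_mul_basis:
  assumes "i < n" "j < n" "k < n" "l < n"
  shows "amul (taft_alg n q) (bvec (i, j)) (bvec (k, l)) =
    (\<lambda>c. if j + l < n then q ^ (j * k) * bvec ((i + k) mod n, j + l) c else 0)"
proof -
  have "amul (taft_alg n q) (bvec (i, j)) (bvec (k, l)) =
      (\<lambda>c. if c \<in> {..<n} \<times> {..<n} then alg_mul (taft_alg n q) (i, j) (k, l) c else 0)"
    using assms amul_bvec_1[of "taft_alg n q" "(i, j)" "(k, l)"] by (simp add: taft_alg_def)
  also have "\<dots> = (\<lambda>c. if j + l < n then q ^ (j * k) * bvec ((i + k) mod n, j + l) c else 0)"
    using assms by (intro ext) (auto simp: taft_alg_def bvec_def)
  finally show ?thesis .
qed

lemma taft_g_power:
  assumes "2 \<le> n"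
  shows "apow (taft_alg n q) taft_g i = bvec (i mod n, 0)"
proof (induction i)
  case 0
  then show ?case by (simp add: taft_alg_def)
next
  case (Suc i)
  have "apow (taft_alg n q) taft_g (Suc i) = amul (taft_alg n q) (bvec (i mod n, 0)) taft_g"
    by (simp add: Suc[simplified])
  also have "\<dots> = bvec (Suc i mod n, 0)"
    using assms by (subst taft_mul_basis) (auto simp: mod_Suc_eq)
  finally show ?case .
qed

lemma taft_h_power:
  assumes "2 \<le> n"
  shows "apow (taft_alg n q) taft_h j = (if j < n then bvec (0, j) else (\<lambda>_. 0))"
proof (induction j)
  case 0
  then show ?case using assms by (simp add: taft_alg_def)
next
  case (Suc j)
  have "apow (taft_alg n q) taft_h (Suc j) =
      amul (taft_alg n q) (if j < n then bvec (0, j) else (\<lambda>_. 0)) taft_h"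
    by (simp add: Suc[simplified])
  also have "\<dots> = (if Suc j < n then bvec (0, Suc j) else (\<lambda>_. 0))"
  proof (cases "j < n")
    case True
    then have "amul (taft_alg n q) (bvec (0, j)) taft_h =
        (\<lambda>c. if j + 1 < n then q ^ (j * 0) * bvec ((0 + 0) mod n, j + 1) c else 0)"
      using assms by (intro taft_mul_basis) auto
    with True show ?thesis by auto
  next
    case False
    then show ?thesis by (simp add: amul_def fun_eq_iff)
  qed
  finally show ?case .
qed

lemma taft_relations:
  fixes q :: "'k::field"
  assumes "2 \<le> n"
  shows "apow (taft_alg n q) taft_g n = alg_unit (taft_alg n q)"
    and "apow (taft_alg n q) taft_h n = (\<lambda>_. 0)"
    and "amul (taft_alg n q) taft_h taft_g = (\<lambda>c. q * amul (taft_alg n q) taft_g taft_h c)"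
    and "i < n \<Longrightarrow> j < n \<Longrightarrow>
      amul (taft_alg n q) (apow (taft_alg n q) taft_g i) (apow (taft_alg n q) taft_h j) = bvec (i, j)"
    and "amul (taft_alg n q) taft_g (bvec (n - 1, 0)) = alg_unit (taft_alg n q)"
proof -
  show "apow (taft_alg n q) taft_g n = alg_unit (taft_alg n q)"
    by (subst taft_g_power[OF assms]) (simp add: taft_alg_def)
  show "apow (taft_alg n q) taft_h n = (\<lambda>_. 0)"
    by (subst taft_h_power[OF assms]) simp
  show "amul (taft_alg n q) taft_h taft_g = (\<lambda>c. q * amul (taft_alg n q) taft_g taft_h c)"
  proof -
    have "amul (taft_alg n q) taft_h taft_g =
        (\<lambda>c. if 1 + 0 < n then q ^ (1 * 1) * bvec ((0 + 1) mod n, 1 + 0) c else 0)"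
      using assms by (intro taft_mul_basis) auto
    moreover have "amul (taft_alg n q) taft_g taft_h =
        (\<lambda>c. if 0 + 1 < n then q ^ (0 * 0) * bvec ((1 + 0) mod n, 0 + 1) c else 0)"
      using assms by (intro taft_mul_basis) auto
    ultimately show ?thesis using assms by simp
  qed
  show "amul (taft_alg n q) (apow (taft_alg n q) taft_g i) (apow (taft_alg n q) taft_h j) = bvec (i, j)"
    if "i < n" "j < n"
  proof -
    have "amul (taft_alg n q) (bvec (i, 0)) (bvec (0, j)) =
        (\<lambda>c. if 0 + j < n then q ^ (0 * 0) * bvec ((i + 0) mod n, 0 + j) c else 0)"
      using that by (intro taft_mul_basis) auto
    then show ?thesis using that unfolding taft_g_power[OF assms] taft_h_power[OF assms] by simp
  qed
  show "amul (taft_alg n q) taft_g (bvec (n - 1, 0)) = alg_unit (taft_alg n q)"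
  proof -
    have "amul (taft_alg n q) taft_g (bvec (n - 1, 0)) =
        (\<lambda>c. if 0 + 0 < n then q ^ (0 * (n - 1)) * bvec ((1 + (n - 1)) mod n, 0 + 0) c else 0)"
      using assms by (intro taft_mul_basis) auto
    then show ?thesis using assms by (simp add: taft_alg_def)
  qed
qed

lemma amul_unit_left:
  assumes "finite (alg_basis A)" "e \<in> alg_basis A"
    and "\<And>b c. b \<in> alg_basis A \<Longrightarrow> c \<in> alg_basis A \<Longrightarrow> alg_mul A e b c = bvec b c"
    and "\<And>c. c \<notin> alg_basis A \<Longrightarrow> x c = 0"
  shows "amul A (bvec e) x = x"
proof
  fix c
  show "amul A (bvec e) x c = x c"
  proof (cases "c \<in> alg_basis A")
    case True
    have "amul A (bvec e) x c =
        (\<Sum>a\<in>alg_basis A. if a = e then (\<Sum>b\<in>alg_basis A. x b * alg_mul A e b c) else 0)"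
      unfolding amul_def using True by (simp add: bvec_def cong: sum.cong)
        (rule sum.cong, auto)
    also have "\<dots> = (\<Sum>b\<in>alg_basis A. x b * alg_mul A e b c)"
      using assms(1,2) by simp
    also have "\<dots> = (\<Sum>b\<in>alg_basis A. if b = c then x b else 0)"
      using True assms(3) by (intro sum.cong) (auto simp: bvec_def)
    also have "\<dots> = x c" using assms(1) True by simp
    finally show ?thesis .
  qed (simp add: amul_def assms(4))
qed

lemma amul_unit_right:
  assumes "finite (alg_basis A)" "e \<in> alg_basis A"
    and "\<And>b c. b \<in> alg_basis A \<Longrightarrow> c \<in> alg_basis A \<Longrightarrow> alg_mul A b e c = bvec b c"
    and "\<And>c. c \<notin> alg_basis A \<Longrightarrow> x c = 0"
  shows "amul A x (bvec e) = x"
proof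
  fix c
  show "amul A x (bvec e) c = x c"
  proof (cases "c \<in> alg_basis A")
    case True
    have "amul A x (bvec e) c =
        (\<Sum>a\<in>alg_basis A. \<Sum>b\<in>alg_basis A. if b = e then x a * alg_mul A a e c else 0)"
      unfolding amul_def using True by (simp add: bvec_def cong: sum.cong)
        (intro sum.cong, auto)
    also have "\<dots> = (\<Sum>a\<in>alg_basis A. x a * alg_mul A a e c)"
      using assms(1,2) by simp
    also have "\<dots> = (\<Sum>a\<in>alg_basis A. if a = c then x a else 0)"
      using True assms(3) by (intro sum.cong) (auto simp: bvec_def)
    also have "\<dots> = x c" using assms(1) True by simp
    finally show ?thesis .
  qed (simp add: amul_def assms(4))
qed

lemma taft_unit:
  fixes q :: "'k::field"
  assumes "0 < n" and "\<And>c. c \<notin> alg_basis (taft_alg n q) \<Longrightarrow> x c = 0"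
  shows "amul (taft_alg n q) (alg_unit (taft_alg n q)) x = x"
    and "amul (taft_alg n q) x (alg_unit (taft_alg n q)) = x"
proof -
  have *: "alg_unit (taft_alg n q) = bvec (0, 0)" by (simp add: taft_alg_def)
  show "amul (taft_alg n q) (alg_unit (taft_alg n q)) x = x"
    unfolding * by (rule amul_unit_left) (use assms in \<open>auto simp: taft_alg_def\<close>)
  show "amul (taft_alg n q) x (alg_unit (taft_alg n q)) = x"
    unfolding * by (rule amul_unit_right) (use assms in \<open>auto simp: taft_alg_def\<close>)
qed

lemma taft_tensor_unit:
  fixes n :: nat and q :: "'k::field"
  defines "T \<equiv> tensor_alg (taft_alg n q) (taft_alg n q)"
  assumes "0 < n" and "\<And>c. c \<notin> alg_basis T \<Longrightarrow> x c = 0"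
  shows "amul T (alg_unit T) x = x" and "amul T x (alg_unit T) = x"
proof -
  have *: "alg_unit T = bvec ((0, 0), (0, 0))"
    by (auto simp: T_def tensor_alg_def taft_alg_def tens_def bvec_def fun_eq_iff)
  have B: "alg_basis T = ({..<n} \<times> {..<n}) \<times> ({..<n} \<times> {..<n})"
    by (simp add: T_def tensor_alg_def taft_alg_def)
  have fin: "finite (alg_basis T)" and mem: "((0, 0), (0, 0)) \<in> alg_basis T"
    using assms(2) by (simp_all add: B)
  have L: "alg_mul T ((0, 0), (0, 0)) b c = bvec b c"
    and R: "alg_mul T b ((0, 0), (0, 0)) c = bvec b c" if "b \<in> alg_basis T" for b c
  proof -
    obtain b1 b2 b3 b4 c1 c2 where bc: "b = ((b1, b2), (b3, b4))" "c = (c1, c2)"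
      by (metis surj_pair)
    have lt: "b1 < n" "b2 < n" "b3 < n" "b4 < n"
      using that by (auto simp: B bc)
    show "alg_mul T ((0, 0), (0, 0)) b c = bvec b c" "alg_mul T b ((0, 0), (0, 0)) c = bvec b c"
      unfolding bc using lt by (simp_all add: T_def tensor_alg_def taft_alg_def bvec_def)
  qed
  show "amul T (alg_unit T) x = x"
    unfolding * by (rule amul_unit_left[OF fin mem L assms(3)])
  show "amul T x (alg_unit T) = x"
    unfolding * by (rule amul_unit_right[OF fin mem R assms(3)])
qed

lemma taft_structure_maps:
  fixes q :: "'k::field"
  assumes "2 \<le> n"
  shows "hopf_comul (taft n q) (1, 0) = tens taft_g taft_g"
    and "hopf_comul (taft n q) (0, 1) =
      (\<lambda>p. tens (alg_unit (taft_alg n q)) taft_h p + tens taft_h taft_g p)"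
    and "hopf_counit (taft n q) (1, 0) = 1"
    and "hopf_counit (taft n q) (0, 1) = 0"
    and "hopf_antipode (taft n q) (1, 0) = bvec (n - 1, 0)"
    and "hopf_antipode (taft n q) (0, 1) =
      (\<lambda>c. - amul (taft_alg n q) taft_h (bvec (n - 1, 0)) c)"
proof -
  define A where "A = taft_alg n q"
  define T where "T = tensor_alg A A"
  have g: "taft_comul_g n q c = 0" and h: "taft_comul_h n q c = 0" if "c \<notin> alg_basis T" for c
    using that assms by (auto simp: T_def A_def tensor_alg_def taft_alg_def taft_comul_g_def
        taft_comul_h_def tens_def bvec_def split: prod.splits)
  have Sg: "taft_antipode_g n q c = 0" if "c \<notin> alg_basis A" for c
    using that assms by (auto simp: A_def taft_alg_def taft_antipode_g_def bvec_def)
  have Sh: "taft_antipode_h n q c = 0" if "c \<notin> alg_basis A" for c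
    using that assms by (auto simp: A_def taft_antipode_h_def amul_def)
  have n: "0 < n" using assms by simp
  note TU = taft_tensor_unit[where n = n and q = q, folded A_def, folded T_def, OF n]
  note AU = taft_unit[where n = n and q = q, folded A_def, OF n]
  show "hopf_comul (taft n q) (1, 0) = tens taft_g taft_g"
    by (simp add: taft_def alg.defs Let_def A_def[symmetric] T_def[symmetric] TU[OF g])
       (simp add: taft_comul_g_def)
  show "hopf_comul (taft n q) (0, 1) =
      (\<lambda>p. tens (alg_unit (taft_alg n q)) taft_h p + tens taft_h taft_g p)"
    by (simp add: taft_def alg.defs Let_def A_def[symmetric] T_def[symmetric] TU[OF h])
       (simp add: taft_comul_h_def A_def)
  show "hopf_counit (taft n q) (1, 0) = 1" "hopf_counit (taft n q) (0, 1) = 0"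
    by (simp_all add: taft_def alg.defs)
  show "hopf_antipode (taft n q) (1, 0) = bvec (n - 1, 0)"
    by (simp add: taft_def alg.defs Let_def A_def[symmetric] AU[OF Sg])
       (simp add: taft_antipode_g_def)
  show "hopf_antipode (taft n q) (0, 1) =
      (\<lambda>c. - amul (taft_alg n q) taft_h (bvec (n - 1, 0)) c)"
    by (simp add: taft_def alg.defs Let_def A_def[symmetric] AU[OF Sh])
       (simp add: taft_antipode_h_def A_def)
qed

text \<open>The module \<open>M(l, r)\<close>. The integer \<open>r\<close> represents its class modulo \<open>n\<close>. Matrix indices
  start at 0, so the basis vector \<open>v_i\<close> has index \<open>i - 1\<close> and \<open>q^(r - i + 1)\<close>
  becomes \<open>q^(r - a)\<close>.\<close>

definition taft_g_mat :: "'k::field \<Rightarrow> nat \<Rightarrow> int \<Rightarrow> 'k mat" where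
  "taft_g_mat q l r = mat l l (\<lambda>(a, b). if a = b then q powi (r - int a) else 0)"

definition taft_h_mat :: "nat \<Rightarrow> 'k::field mat" where
  "taft_h_mat l = mat l l (\<lambda>(a, b). if a = b + 1 then 1 else 0)"

definition taft_module :: "'k::field \<Rightarrow> nat \<Rightarrow> int \<Rightarrow> (nat \<times> nat, 'k) rep" where
  "taft_module q l r = \<lparr>
     rep_dim = l,
     rep_act = (\<lambda>(i, j). (taft_g_mat q l r ^\<^sub>m i) * (taft_h_mat l ^\<^sub>m j))\<rparr>"

end

theory Submission
  imports Defs "Jordan_Normal_Form.Determinant"
begin

text \<open>
  A module is determined by the matrices of \<open>g\<close> and \<open>h\<close>. A vector of weight \<open>q^r\<close> on which \<open>h\<close> has
  maximal height, together with a covector of matching weight detecting its last iterate, splits off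
  a copy of \<open>M(l, r)\<close>; hence every module is a direct sum of these. The multiplicities are recovered
  from the ranks of \<open>h^j\<close> on the weight spaces, so they are additive invariants and the classes
  \<open>[M(l, r)]\<close> form a basis of the Green ring. From \<open>M(2, 0) \<otimes> M(l, r) = M(l + 1, r) \<oplus> M(l - 1, r - 1)\<close>
  for \<open>l < n\<close> and \<open>M(2, 0) \<otimes> M(n, r) = M(n, r) \<oplus> M(n, r - 1)\<close> the additive function \<open>\<psi>\<close> with
  \<open>\<psi>(M(l, r)) = sin(l\<pi>/n) / sin(\<pi>/n)\<close> is multiplicative. It vanishes exactly on the projective modules,
  which therefore span a representation ideal; it is the largest one, because tensoring any
  other \<open>M(l, r)\<close> with \<open>M(2, 0)\<close> repeatedly leads to an invertible class. Finally the dimension of the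
  core of \<open>x^m\<close> lies between constant multiples of \<open>\<psi>(x^m) = \<psi>(x)^m\<close>.
\<close>

section \<open>Matrices\<close>

text \<open>The sine quotient is forced. A multiplicative function that depends only on the length
  satisfies s(l+1) + s(l-1) = a s(l) with s(0) = 0 and s(1) = 1, and the product M(2, 0) with M(n,
  r), having two summands of length n, gives 2 s(n) = a s(n). Either a = 2, which is the dimension,
  or s(n) = 0, so that s(l) = sin(l t) / sin t with t a multiple of pi/n; positivity for 0 < l < n
  selects t = pi/n.

  Three obstacles shape the proof. Coefficients in the Green ring make sense only once the
  indecomposable classes are independent modulo the relations. This is obtained from additive
  functions on modules, one of them with values in the free group itself, and such functions are
  compared on the M(l, r) alone. That a tensor product is a module at all requires the n-th power of
  the comultiplication of h to act as zero, which rests on the vanishing of the middle Gaussian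
  binomials at q. Finally, \<psi> detects summands only where multiplicities are nonnegative, so
  questions about ring elements are always reduced to genuine modules.\<close>

text \<open>Side conditions are phrased by dimensions rather than carriers, so that these
  rules can be used for rewriting.\<close>

lemma mult_mat_assoc:
  fixes A B C :: "'a::semiring_0 mat"
  shows "dim_col A = dim_row B \<Longrightarrow> dim_col B = dim_row C \<Longrightarrow> A * B * C = A * (B * C)"
  by (rule assoc_mult_mat) auto

lemma mult_mat_add_right:
  fixes A B C :: "'a::semiring_0 mat"
  shows "dim_col A = dim_row B \<Longrightarrow> dim_row B = dim_row C \<Longrightarrow> dim_col B = dim_col C
    \<Longrightarrow> A * (B + C) = A * B + A * C"
  by (rule mult_add_distrib_mat) auto

lemma mult_mat_add_left:
  fixes A B C :: "'a::semiring_0 mat"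
  shows "dim_col A = dim_row C \<Longrightarrow> dim_row B = dim_row A \<Longrightarrow> dim_col B = dim_col A
    \<Longrightarrow> (A + B) * C = A * C + B * C"
  by (rule add_mult_distrib_mat) auto

lemma mult_mat_minus_right:
  fixes A B C :: "'a::ring mat"
  shows "dim_col A = dim_row B \<Longrightarrow> dim_row B = dim_row C \<Longrightarrow> dim_col B = dim_col C
    \<Longrightarrow> A * (B - C) = A * B - A * C"
  by (rule mult_minus_distrib_mat) auto

lemma mult_mat_minus_left:
  fixes A B C :: "'a::ring mat"
  shows "dim_col A = dim_row C \<Longrightarrow> dim_row B = dim_row A \<Longrightarrow> dim_col B = dim_col A
    \<Longrightarrow> (A - B) * C = A * C - B * C"
  by (rule minus_mult_distrib_mat) auto

lemma mult_mat_one_left: "dim_row A = n \<Longrightarrow> 1\<^sub>m n * A = A" for A :: "'a::semiring_1 mat"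
  by auto

lemma mult_mat_one_right: "dim_col A = n \<Longrightarrow> A * 1\<^sub>m n = A" for A :: "'a::semiring_1 mat"
  by auto

lemma mult_mat_zero_left: "dim_row A = n \<Longrightarrow> 0\<^sub>m m n * A = 0\<^sub>m m (dim_col A)"
  for A :: "'a::semiring_0 mat"
  by (rule left_mult_zero_mat) auto

lemma mult_mat_zero_right: "dim_col A = m \<Longrightarrow> A * 0\<^sub>m m n = 0\<^sub>m (dim_row A) n"
  for A :: "'a::semiring_0 mat"
  by (rule right_mult_zero_mat) auto

lemma mult_mat_smult_left: "dim_col A = dim_row B \<Longrightarrow> (c \<cdot>\<^sub>m A) * B = c \<cdot>\<^sub>m (A * B)"
  for A :: "'a::comm_semiring_1 mat"
  by (rule mult_smult_assoc_mat) auto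

lemma mult_mat_smult_right: "dim_col A = dim_row B \<Longrightarrow> A * (c \<cdot>\<^sub>m B) = c \<cdot>\<^sub>m (A * B)"
  for A :: "'a::comm_semiring_1 mat"
  by (rule mult_smult_distrib) auto

lemmas mat_simps = mult_mat_assoc mult_mat_one_left mult_mat_one_right
  mult_mat_zero_left mult_mat_zero_right

lemma mat_cancel_left:
  fixes A B C :: "'a::semiring_1 mat"
  shows "B * A = 1\<^sub>m (dim_row B) \<Longrightarrow> dim_col B = dim_row A \<Longrightarrow> dim_col A = dim_row B
    \<Longrightarrow> dim_row C = dim_row B \<Longrightarrow> B * (A * C) = C"
  by (simp flip: mult_mat_assoc)

lemma pow_mat_dim [simp]:
  fixes A :: "'a::semiring_1 mat"
  shows "dim_row (A ^\<^sub>m k) = dim_row A" "dim_col A = dim_row A \<Longrightarrow> dim_col (A ^\<^sub>m k) = dim_row A"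
  by (induction k) auto

lemma pow_mat_Suc_left:
  fixes A :: "'a::semiring_1 mat"
  assumes "dim_col A = dim_row A" shows "A ^\<^sub>m Suc k = A * A ^\<^sub>m k"
proof (induction k)
  case (Suc k)
  have "A ^\<^sub>m Suc (Suc k) = A * A ^\<^sub>m k * A" using Suc by simp
  also have "\<dots> = A * A ^\<^sub>m Suc k" using assms by (simp add: mult_mat_assoc)
  finally show ?case .
qed (use assms in \<open>simp add: mat_simps\<close>)

lemma pow_mat_add:
  fixes A :: "'a::semiring_1 mat"
  assumes "dim_col A = dim_row A" shows "A ^\<^sub>m (i + j) = A ^\<^sub>m i * A ^\<^sub>m j"
  by (induction j) (use assms in \<open>simp_all add: mult_mat_one_right mult_mat_assoc\<close>)

lemma pow_mat_zero_mono:
  fixes A :: "'a::semiring_1 mat"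
  assumes "dim_col A = dim_row A" "A ^\<^sub>m i = 0\<^sub>m (dim_row A) (dim_row A)" "i \<le> j"
  shows "A ^\<^sub>m j = 0\<^sub>m (dim_row A) (dim_row A)"
  using assms pow_mat_add[of A i "j - i"] by (simp add: mat_simps)

lemma pow_mat_intertwine:
  fixes A :: "'a::semiring_1 mat"
  assumes "dim_col A = dim_row A" "dim_col B = dim_row B" "dim_row P = dim_row B" "dim_col P = dim_row A"
    and "P * A = B * P"
  shows "P * A ^\<^sub>m k = B ^\<^sub>m k * P"
proof (induction k)
  case (Suc k)
  have "P * A ^\<^sub>m Suc k = B ^\<^sub>m k * P * A" using assms Suc by (simp flip: mult_mat_assoc)
  also have "\<dots> = B ^\<^sub>m Suc k * P" using assms by (simp add: mult_mat_assoc)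
  finally show ?case .
qed (use assms in \<open>simp add: mat_simps\<close>)

lemma transpose_pow_mat:
  fixes A :: "'a::comm_semiring_1 mat"
  assumes "dim_col A = dim_row A" shows "transpose_mat (A ^\<^sub>m k) = transpose_mat A ^\<^sub>m k"
proof (induction k)
  case (Suc k)
  have "transpose_mat (A ^\<^sub>m Suc k) = transpose_mat (A ^\<^sub>m k * A)" by simp
  also have "\<dots> = transpose_mat A * transpose_mat (A ^\<^sub>m k)"
    using assms by (intro transpose_mult) auto
  finally show ?case using assms by (simp add: Suc flip: pow_mat_Suc_left)
qed (use assms in simp)

lemma transpose_mult_dim:
  fixes A :: "'a::comm_semiring_0 mat"
  shows "dim_col A = dim_row B \<Longrightarrow> transpose_mat (A * B) = transpose_mat B * transpose_mat A"
  by (rule transpose_mult) auto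

lemma smult_mat_smult: "a \<cdot>\<^sub>m (b \<cdot>\<^sub>m A) = (a * b) \<cdot>\<^sub>m A" for A :: "'a::semigroup_mult mat"
  by (rule eq_matI) (auto simp: mult.assoc)

lemma smult_mat_one: "1 \<cdot>\<^sub>m A = A" for A :: "'a::monoid_mult mat"
  by (rule eq_matI) auto

lemma four_block_diag_mult:
  fixes A B C D :: "'a::semiring_1 mat"
  assumes "dim_col A = dim_row C" "dim_col B = dim_row D"
    and "p = dim_row A" "p' = dim_col B" "r = dim_row B" "r' = dim_col A"
      "s = dim_row C" "s' = dim_col D" "t = dim_row D" "t' = dim_col C"
  shows "four_block_mat A (0\<^sub>m p p') (0\<^sub>m r r') B * four_block_mat C (0\<^sub>m s s') (0\<^sub>m t t') D
    = four_block_mat (A * C) (0\<^sub>m (dim_row A) (dim_col D)) (0\<^sub>m (dim_row B) (dim_col C)) (B * D)"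
  using assms by (subst mult_four_block_mat) (auto simp: mat_simps)

lemma four_block_diag_pow:
  fixes A B :: "'a::semiring_1 mat"
  assumes "A \<in> carrier_mat p p" "B \<in> carrier_mat r r"
  shows "four_block_mat A (0\<^sub>m p r) (0\<^sub>m r p) B ^\<^sub>m k
    = four_block_mat (A ^\<^sub>m k) (0\<^sub>m p r) (0\<^sub>m r p) (B ^\<^sub>m k)"
  by (induction k) (use assms in \<open>simp_all add: four_block_diag_mult\<close>)

section \<open>Block matrices built by concatenation\<close>

definition hcat :: "'a mat \<Rightarrow> 'a mat \<Rightarrow> 'a mat" where
  "hcat A B = mat (dim_row A) (dim_col A + dim_col B)
     (\<lambda>(i, j). if j < dim_col A then A $$ (i, j) else B $$ (i, j - dim_col A))"

definition vcat :: "'a mat \<Rightarrow> 'a mat \<Rightarrow> 'a mat" where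
  "vcat A B = mat (dim_row A + dim_row B) (dim_col A)
     (\<lambda>(i, j). if i < dim_row A then A $$ (i, j) else B $$ (i - dim_row A, j))"

lemma dim_hcat [simp]: "dim_row (hcat A B) = dim_row A" "dim_col (hcat A B) = dim_col A + dim_col B"
  and dim_vcat [simp]: "dim_row (vcat A B) = dim_row A + dim_row B" "dim_col (vcat A B) = dim_col A"
  by (simp_all add: hcat_def vcat_def)

lemma mult_mat_entry:
  fixes A B :: "'a::semiring_0 mat"
  assumes "i < dim_row A" "j < dim_col B" "dim_col A = dim_row B"
  shows "(A * B) $$ (i, j) = (\<Sum>k<dim_row B. A $$ (i, k) * B $$ (k, j))"
  using assms by (auto simp: scalar_prod_def lessThan_atLeast0 intro!: sum.cong)

lemma sum_lessThan_add:
  fixes f :: "nat \<Rightarrow> 'a::comm_monoid_add"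
  shows "sum f {..<a + b} = sum f {..<a} + (\<Sum>k<b. f (a + k))"
  by (induction b) (auto simp: add.assoc)

lemma sum_delta_right:
  fixes f :: "nat \<Rightarrow> 'a::semiring_0"
  shows "(\<Sum>k<n. f k * (if k = j then a else 0)) = (if j < n then f j * a else 0)"
    and "(\<Sum>k<n. (if k = j then a else 0) * f k) = (if j < n then a * f j else 0)"
proof -
  have *: "(\<Sum>k<n. f k * (if k = j then a else 0)) = (\<Sum>k<n. if k = j then f k * a else 0)"
    "(\<Sum>k<n. (if k = j then a else 0) * f k) = (\<Sum>k<n. if k = j then a * f k else 0)"
    by (rule sum.cong; simp)+
  show "(\<Sum>k<n. f k * (if k = j then a else 0)) = (if j < n then f j * a else 0)"
    and "(\<Sum>k<n. (if k = j then a else 0) * f k) = (if j < n then a * f j else 0)"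
    by (simp_all only: * sum.delta finite_lessThan lessThan_iff)
qed

lemma mult_hcat:
  fixes A B C :: "'a::semiring_0 mat"
  assumes "dim_col A = dim_row B" "dim_row C = dim_row B"
  shows "A * hcat B C = hcat (A * B) (A * C)"
  by (rule eq_matI) (use assms in \<open>auto simp: mult_mat_entry hcat_def simp del: index_mult_mat(1)\<close>)

lemma vcat_mult:
  fixes A B C :: "'a::semiring_0 mat"
  assumes "dim_col A = dim_row C" "dim_col B = dim_col A"
  shows "vcat A B * C = vcat (A * C) (B * C)"
  by (rule eq_matI) (use assms in \<open>auto simp: mult_mat_entry vcat_def simp del: index_mult_mat(1)\<close>)

lemma hcat_mult_vcat:
  fixes A B C D :: "'a::semiring_0 mat"
  assumes "dim_row A = dim_row B" "dim_col C = dim_col D" "dim_col A = dim_row C" "dim_col B = dim_row D"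
  shows "hcat A B * vcat C D = A * C + B * D"
proof (rule eq_matI)
  fix i j assume "i < dim_row (A * C + B * D)" "j < dim_col (A * C + B * D)"
  then have ij: "i < dim_row A" "j < dim_col C" using assms by auto
  have "(hcat A B * vcat C D) $$ (i, j)
      = (\<Sum>k<dim_row C + dim_row D. hcat A B $$ (i, k) * vcat C D $$ (k, j))"
    using ij assms by (subst mult_mat_entry) auto
  also have "\<dots> = (\<Sum>k<dim_row C. A $$ (i, k) * C $$ (k, j)) + (\<Sum>k<dim_row D. B $$ (i, k) * D $$ (k, j))"
    unfolding sum_lessThan_add using ij assms
    by (intro arg_cong2[of _ _ _ _ plus] sum.cong) (auto simp: hcat_def vcat_def)
  also have "\<dots> = (A * C + B * D) $$ (i, j)"
    using ij assms by (simp add: mult_mat_entry del: index_mult_mat(1))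
  finally show "(hcat A B * vcat C D) $$ (i, j) = (A * C + B * D) $$ (i, j)" .
qed (use assms in auto)

lemma hcat_vcat:
  assumes "dim_row A = dim_row B" "dim_row C = dim_row D" "dim_col A = dim_col C" "dim_col B = dim_col D"
  shows "hcat (vcat A C) (vcat B D) = four_block_mat A B C D"
  by (rule eq_matI) (use assms in \<open>auto simp: hcat_def vcat_def\<close>)

lemma vcat_mult_hcat:
  fixes A B C D :: "'a::semiring_0 mat"
  assumes "dim_col A = dim_row C" "dim_col B = dim_col A" "dim_row D = dim_row C"
  shows "vcat A B * hcat C D = four_block_mat (A * C) (A * D) (B * C) (B * D)"
  using assms by (simp add: vcat_mult mult_hcat hcat_vcat)

text \<open>If \<open>d < r\<close>, zero rows added to \<open>A\<close> and zero columns added to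
  \<open>B\<close> give square matrices with \<open>B' * A' = 1\<close>, hence also
  \<open>A' * B' = 1\<close>, although the last row of \<open>A'\<close> vanishes.\<close>

lemma left_inverse_dim_le:
  fixes A B :: "'a::field mat"
  assumes A: "A \<in> carrier_mat d r" and B: "B \<in> carrier_mat r d" and BA: "B * A = 1\<^sub>m r"
  shows "r \<le> d"
proof (rule ccontr)
  assume "\<not> r \<le> d"
  then have d: "d < r" by simp
  define A' where "A' = vcat A (0\<^sub>m (r - d) r)"
  define B' where "B' = hcat B (0\<^sub>m r (r - d))"
  have A': "A' \<in> carrier_mat r r" and B': "B' \<in> carrier_mat r r"
    using A B d by (auto simp: A'_def B'_def)
  have "B' * A' = 1\<^sub>m r"
    using A B BA d by (simp add: A'_def B'_def hcat_mult_vcat mat_simps)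
  then have AB: "A' * B' = 1\<^sub>m r" by (rule mat_mult_left_right_inverse[OF B' A'])
  have "(A' * B') $$ (r - 1, r - 1) = (\<Sum>k<r. A' $$ (r - 1, k) * B' $$ (k, r - 1))"
    using A' B' d by (subst mult_mat_entry) auto
  also have "\<dots> = 0" using A d by (intro sum.neutral) (auto simp: A'_def vcat_def)
  finally have "1\<^sub>m r $$ (r - 1, r - 1) = (0::'a)" unfolding AB .
  then show False using d by simp
qed

subsection \<open>Rank\<close>

text \<open>A description of rank without row reduction: the first equation bounds the rank below by
  \<open>r\<close>; the second, saying that \<open>C * B\<close> is a generalized inverse of
  \<open>A\<close>, bounds it above. Both survive block sums and changes of basis.\<close>

definition rank_fact :: "nat \<Rightarrow> 'a::field mat \<Rightarrow> 'a mat \<Rightarrow> 'a mat \<Rightarrow> bool" where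
  "rank_fact r A B C \<longleftrightarrow> dim_row B = r \<and> dim_col B = dim_row A \<and> dim_row C = dim_col A \<and> dim_col C = r \<and>
     B * (A * C) = 1\<^sub>m r \<and> A * (C * (B * A)) = A"

text \<open>Choosing \<open>r\<close> maximal with \<open>B A C = 1\<close> of size \<open>r\<close>: a nonzero entry of \<open>A - A C B A\<close> would
  allow \<open>B\<close> and \<open>C\<close> to be enlarged.\<close>

lemma rank_fact_exists:
  fixes A :: "'a::field mat"
  obtains r B C where "rank_fact r A B C"
proof -
  define m n where "m = dim_row A" and "n = dim_col A"
  then have dA: "dim_row A = m" "dim_col A = n" by simp_all
  define S where "S = {r. \<exists>B\<in>carrier_mat r m. \<exists>C\<in>carrier_mat n r. B * (A * C) = 1\<^sub>m r}"
  have bound: "r \<le> m" if "r \<in> S" for r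
  proof -
    from that obtain B C where "B \<in> carrier_mat r m" "C \<in> carrier_mat n r" "B * (A * C) = 1\<^sub>m r"
      unfolding S_def by blast
    moreover have "A * C \<in> carrier_mat m r"
      using dA carrier_matD[OF \<open>C \<in> carrier_mat n r\<close>] by (intro carrier_matI) simp_all
    ultimately show ?thesis by (metis left_inverse_dim_le)
  qed
  have "(0\<^sub>m 0 m :: 'a mat) * (A * 0\<^sub>m n 0) = 1\<^sub>m 0" by (rule eq_matI) simp_all
  moreover have "(0\<^sub>m 0 m :: 'a mat) \<in> carrier_mat 0 m" "(0\<^sub>m n 0 :: 'a mat) \<in> carrier_mat n 0"
    by simp_all
  ultimately have "0 \<in> S" unfolding S_def mem_Collect_eq by (intro bexI)
  moreover have "S \<subseteq> {..m}" using bound by blast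
  then have fin: "finite S" by (rule finite_subset) simp
  define r where "r = Max S"
  ultimately have "r \<in> S" using fin by (metis Max_in empty_iff)
  then obtain B C where B: "B \<in> carrier_mat r m" and C: "C \<in> carrier_mat n r" and BAC: "B * (A * C) = 1\<^sub>m r"
    unfolding S_def by blast
  define E where "E = A - A * (C * (B * A))"
  have dims: "dim_row E = m" "dim_col E = n" "dim_row A = m" "dim_col A = n"
    "dim_row B = r" "dim_col B = m" "dim_row C = n" "dim_col C = r"
    using dA carrier_matD[OF B] carrier_matD[OF C] by (simp_all add: E_def)
  have "E = 0\<^sub>m m n"
  proof (rule ccontr)
    assume "E \<noteq> 0\<^sub>m m n"
    moreover have "E = 0\<^sub>m m n" if "\<forall>i<m. \<forall>j<n. E $$ (i, j) = 0"
      using that dims by (intro eq_matI) simp_all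
    ultimately obtain i j where ij: "i < m" "j < n" "E $$ (i, j) \<noteq> 0"
      by blast
    have BE: "B * E = 0\<^sub>m r n"
    proof -
      have "B * E = B * A - B * (A * C) * (B * A)"
        using dims by (simp add: E_def mult_mat_minus_right mult_mat_assoc)
      then show ?thesis using dims by (auto simp: BAC mat_simps)
    qed
    have EC: "E * C = 0\<^sub>m m r"
    proof -
      have "E * C = A * C - A * (C * (B * (A * C)))"
        using dims by (simp add: E_def mult_mat_minus_left mult_mat_assoc)
      then show ?thesis using dims by (auto simp: BAC mat_simps)
    qed
    define u where "u = mat 1 m (\<lambda>(a, b). if b = i then 1 / E $$ (i, j) else 0)"
    define v where "v = mat n 1 (\<lambda>(a, b). if a = j then 1 else (0::'a))"
    \<comment> \<open>The subtracted terms make \<open>b\<close> and \<open>c\<close> orthogonal to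
      \<open>C\<close> and \<open>B\<close> for the pairing given by \<open>A\<close>, while
      \<open>b * A = u * E\<close> and \<open>A * c = E * v\<close> keep the value 1 that
      \<open>u\<close> and \<open>v\<close> extract from the entry of \<open>E\<close>.\<close>
    define b where "b = u - u * (A * (C * B))"
    define c where "c = v - C * (B * (A * v))"
    have duv: "dim_row u = 1" "dim_col u = m" "dim_row v = n" "dim_col v = 1"
      by (auto simp: u_def v_def)
    have dbc: "dim_row b = 1" "dim_col b = m" "dim_row c = n" "dim_col c = 1"
      using dims duv by (auto simp: b_def c_def)
    have bA: "b * A = u * E"
      using dims duv by (simp add: b_def E_def mult_mat_minus_left mult_mat_minus_right mult_mat_assoc)
    have Ac: "A * c = E * v"
      using dims duv by (simp add: c_def E_def mult_mat_minus_left mult_mat_minus_right mult_mat_assoc)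
    have bAC: "b * (A * C) = 0\<^sub>m 1 r"
    proof -
      have "b * (A * C) = u * (E * C)" using dims duv dbc by (simp add: bA flip: mult_mat_assoc)
      then show ?thesis using dims duv by (simp add: EC mat_simps)
    qed
    have BAc: "B * (A * c) = 0\<^sub>m r 1"
      using dims duv by (simp add: Ac BE mult_mat_zero_left flip: mult_mat_assoc)
    have bAc: "b * (A * c) = 1\<^sub>m 1"
    proof -
      have "b * (A * c) = u * (E * c)" using dims duv dbc by (simp add: bA flip: mult_mat_assoc)
      also have "E * c = E * v - E * C * (B * (A * v))"
        using dims duv by (simp add: c_def mult_mat_minus_right mult_mat_assoc)
      also have "\<dots> = E * v" using dims duv by (auto simp: EC mat_simps)
      also have "u * (E * v) = 1\<^sub>m 1"
      proof (rule eq_matI)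
        fix a b assume "a < dim_row (1\<^sub>m 1 :: 'a mat)" "b < dim_col (1\<^sub>m 1 :: 'a mat)"
        then have ab: "a = 0" "b = 0" by auto
        have Ev: "(E * v) $$ (k, 0) = E $$ (k, j)" if "k < m" for k
        proof -
          have "(E * v) $$ (k, 0) = (\<Sum>t<n. E $$ (k, t) * (if t = j then 1 else 0))"
            using dims duv that by (subst mult_mat_entry) (auto simp: v_def intro!: sum.cong)
          then show ?thesis using ij by (simp add: sum_delta_right)
        qed
        have "(u * (E * v)) $$ (0, 0) = (\<Sum>k<m. (if k = i then 1 / E $$ (i, j) else 0) * E $$ (k, j))"
          using dims duv ij by (subst mult_mat_entry)
            (auto simp: Ev u_def intro!: sum.cong simp del: index_mult_mat(1))
        then have "(u * (E * v)) $$ (0, 0) = 1" using ij by (simp add: sum_delta_right)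
        then show "(u * (E * v)) $$ (a, b) = 1\<^sub>m 1 $$ (a, b)" using ij ab by simp
      qed (use dims duv in auto)
      finally show ?thesis .
    qed
    have "vcat B b * (A * hcat C c) = four_block_mat (1\<^sub>m r) (0\<^sub>m r 1) (0\<^sub>m 1 r) (1\<^sub>m 1)"
      using dims dbc by (simp add: mult_hcat[of A] vcat_mult_hcat BAC bAC BAc bAc)
    then have "vcat B b * (A * hcat C c) = 1\<^sub>m (Suc r)" by simp
    moreover have "vcat B b \<in> carrier_mat (Suc r) m" "hcat C c \<in> carrier_mat n (Suc r)"
      using dims dbc by auto
    ultimately have "Suc r \<in> S" unfolding S_def by blast
    then have "Suc r \<le> r" using fin unfolding r_def by simp
    then show False by simp
  qed
  then have "A * (C * (B * A)) = A"
  proof -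
    have "A $$ (i, j) = (A * (C * (B * A))) $$ (i, j)" if "i < m" "j < n" for i j
    proof -
      have "E $$ (i, j) = 0" using \<open>E = 0\<^sub>m m n\<close> that by simp
      then show ?thesis unfolding E_def using that dims by (simp del: index_mult_mat(1))
    qed
    then show ?thesis by (intro eq_matI) (use dims in auto)
  qed
  then show thesis using that[of r B C] dims BAC by (simp add: rank_fact_def)
qed

text \<open>Inserting \<open>A = A * (C' * (B' * A))\<close> factors the identity of size
  \<open>r\<close> through size \<open>s\<close>. By symmetry the rank is well defined.\<close>

lemma rank_fact_le:
  assumes "rank_fact r A B C" "rank_fact s A B' C'"
  shows "r \<le> s"
proof (rule left_inverse_dim_le[of "B' * (A * C)" s r "B * (A * C')"])
  have dims: "dim_row B = r" "dim_col B = dim_row A" "dim_row C = dim_col A" "dim_col C = r"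
    "dim_row B' = s" "dim_col B' = dim_row A" "dim_row C' = dim_col A" "dim_col C' = s"
    using assms by (auto simp: rank_fact_def)
  show "B' * (A * C) \<in> carrier_mat s r" "B * (A * C') \<in> carrier_mat r s" using dims by auto
  have "B * (A * C') * (B' * (A * C)) = B * ((A * (C' * (B' * A))) * C)"
    using dims by (simp add: mult_mat_assoc)
  then show "B * (A * C') * (B' * (A * C)) = 1\<^sub>m r"
    using assms by (simp add: rank_fact_def)
qed

definition mat_rank :: "'a::field mat \<Rightarrow> nat" where
  "mat_rank A = (THE r. \<exists>B C. rank_fact r A B C)"

lemma mat_rank_eqI: "rank_fact r A B C \<Longrightarrow> mat_rank A = r"
  unfolding mat_rank_def using rank_fact_le by (blast intro: antisym)

text \<open>\<open>B * P'\<close> and \<open>Q' * C\<close> factor the new matrix, because the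
  one-sided inverses cancel \<open>P\<close> and \<open>Q\<close> wherever they meet.\<close>

lemma mat_rank_equivalent:
  fixes A :: "'a::field mat"
  assumes "P' * P = 1\<^sub>m (dim_row A)" "Q * Q' = 1\<^sub>m (dim_col A)"
    and "dim_col P = dim_row A" "dim_row Q = dim_col A" "dim_col P' = dim_row P" "dim_row Q' = dim_col Q"
  shows "mat_rank (P * (A * Q)) = mat_rank A"
proof -
  obtain r B C where rf: "rank_fact r A B C" by (rule rank_fact_exists)
  have dP: "dim_row P' = dim_row A" "dim_col Q' = dim_col A"
    using arg_cong[OF assms(1), of dim_row] arg_cong[OF assms(2), of dim_col] by simp_all
  have dims: "dim_row B = r" "dim_col B = dim_row A" "dim_row C = dim_col A" "dim_col C = r"
    using rf by (auto simp: rank_fact_def)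
  have c1: "P' * (P * X) = X" if "dim_row X = dim_row A" for X
    using assms dP that by (intro mat_cancel_left) auto
  have c2: "Q * (Q' * X) = X" if "dim_row X = dim_col A" for X
    using assms dP that by (intro mat_cancel_left) auto
  have R: "B * (A * C) = 1\<^sub>m r" "A * (C * (B * A)) = A" using rf by (simp_all add: rank_fact_def)
  have "(P * (A * Q)) * ((Q' * C) * ((B * P') * (P * (A * Q)))) = P * ((A * (C * (B * A))) * Q)"
    using dims assms dP by (simp add: mult_mat_assoc c1 c2)
  then have 1: "(P * (A * Q)) * ((Q' * C) * ((B * P') * (P * (A * Q)))) = P * (A * Q)"
    by (simp only: R)
  have "(B * P') * ((P * (A * Q)) * (Q' * C)) = B * (A * C)"
    using dims assms dP by (simp add: mult_mat_assoc c1 c2)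
  then have 2: "(B * P') * ((P * (A * Q)) * (Q' * C)) = 1\<^sub>m r"
    by (simp only: R)
  have "rank_fact r (P * (A * Q)) (B * P') (Q' * C)"
    using 1 2 dims assms dP by (simp add: rank_fact_def)
  then show ?thesis using mat_rank_eqI rf by metis
qed

lemma mat_rank_four_block:
  fixes A D :: "'a::field mat"
  assumes "A \<in> carrier_mat m n" "D \<in> carrier_mat m' n'"
  shows "mat_rank (four_block_mat A (0\<^sub>m m n') (0\<^sub>m m' n) D) = mat_rank A + mat_rank D"
proof -
  obtain r B C where rf: "rank_fact r A B C" by (rule rank_fact_exists)
  obtain s B' C' where rf': "rank_fact s D B' C'" by (rule rank_fact_exists)
  have dims: "dim_row B = r" "dim_col B = m" "dim_row C = n" "dim_col C = r"
    "dim_row B' = s" "dim_col B' = m'" "dim_row C' = n'" "dim_col C' = s"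
    "dim_row A = m" "dim_col A = n" "dim_row D = m'" "dim_col D = n'"
    using assms rf rf' by (auto simp: rank_fact_def)
  have "rank_fact (r + s) (four_block_mat A (0\<^sub>m m n') (0\<^sub>m m' n) D)
    (four_block_mat B (0\<^sub>m r m') (0\<^sub>m s m) B') (four_block_mat C (0\<^sub>m n s) (0\<^sub>m n' r) C')"
    using rf rf' dims by (auto simp: rank_fact_def four_block_diag_mult)
  then show ?thesis using rf rf' by (simp add: mat_rank_eqI)
qed

lemma mat_rank_zero: "mat_rank (0\<^sub>m m n :: 'a::field mat) = 0"
  by (rule mat_rank_eqI[of _ _ "0\<^sub>m 0 m" "0\<^sub>m n 0"]) (auto simp: rank_fact_def)

lemma mat_rank_single_entry:
  fixes c :: "'a::field"
  assumes "a < m" "b < n" "c \<noteq> 0"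
  shows "mat_rank (mat m n (\<lambda>(i, j). if i = a \<and> j = b then c else 0)) = 1"
proof -
  define A where "A = mat m n (\<lambda>(i, j). if i = a \<and> j = b then c else 0)"
  define B where "B = mat 1 m (\<lambda>(i, j). if j = a then 1 / c else 0)"
  define C where "C = mat n 1 (\<lambda>(i, j). if i = b then 1 else (0 :: 'a))"
  have dims: "dim_row A = m" "dim_col A = n" "dim_row B = 1" "dim_col B = m" "dim_row C = n" "dim_col C = 1"
    by (auto simp: A_def B_def C_def)
  have BA: "B * A = mat 1 n (\<lambda>(i, j). if j = b then 1 else 0)"
  proof (rule eq_matI)
    fix i j assume ij: "i < dim_row (mat 1 n (\<lambda>(i, j). if j = b then 1 else 0 :: 'a))"
      "j < dim_col (mat 1 n (\<lambda>(i, j). if j = b then 1 else 0 :: 'a))"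
    then have "(B * A) $$ (i, j) = (\<Sum>k<m. (if k = a then 1 / c else 0) * (if k = a \<and> j = b then c else 0))"
      using dims assms by (subst mult_mat_entry) (auto simp: A_def B_def intro!: sum.cong)
    then show "(B * A) $$ (i, j) = mat 1 n (\<lambda>(i, j). if j = b then 1 else 0) $$ (i, j)"
      using assms ij by (simp add: sum_delta_right)
  qed (use dims in auto)
  have AC: "A * C = mat m 1 (\<lambda>(i, j). if i = a then c else 0)"
  proof (rule eq_matI)
    fix i j assume ij: "i < dim_row (mat m 1 (\<lambda>(i, j). if i = a then c else 0 :: 'a))"
      "j < dim_col (mat m 1 (\<lambda>(i, j). if i = a then c else 0 :: 'a))"
    then have "(A * C) $$ (i, j) = (\<Sum>k<n. (if i = a \<and> k = b then c else 0) * (if k = b then 1 else 0))"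
      using dims assms by (subst mult_mat_entry) (auto simp: A_def C_def intro!: sum.cong)
    then show "(A * C) $$ (i, j) = mat m 1 (\<lambda>(i, j). if i = a then c else 0) $$ (i, j)"
      using assms ij by (simp add: sum_delta_right)
  qed (use dims in auto)
  have "B * (A * C) = 1\<^sub>m 1"
  proof (rule eq_matI)
    fix i j assume ij: "i < dim_row (1\<^sub>m 1 :: 'a mat)" "j < dim_col (1\<^sub>m 1 :: 'a mat)"
    then have "(B * (A * C)) $$ (i, j) = (\<Sum>k<m. (if k = a then 1 / c else 0) * (if k = a then c else 0))"
      unfolding AC using dims assms by (subst mult_mat_entry) (auto simp: B_def intro!: sum.cong)
    then show "(B * (A * C)) $$ (i, j) = 1\<^sub>m 1 $$ (i, j)" using ij assms by (simp add: sum_delta_right)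
  qed (use dims in auto)
  moreover have "A * C * (B * A) = A"
    unfolding BA AC using assms
    by (intro eq_matI) (auto simp: mult_mat_entry A_def lessThan_Suc simp del: index_mult_mat(1))
  ultimately have "rank_fact 1 A B C"
    using dims by (auto simp: rank_fact_def mult_mat_assoc)
  then show ?thesis using mat_rank_eqI by (simp add: A_def)
qed

text \<open>The image of an idempotent in coordinates: a rank factorization of \<open>E\<close>
  supplies the inclusion \<open>E * C\<close> and the projection \<open>B * E\<close>.\<close>

lemma idempotent_split:
  fixes E :: "'a::field mat"
  assumes E: "E \<in> carrier_mat d d" "E * E = E"
  obtains r A B where "A \<in> carrier_mat d r" "B \<in> carrier_mat r d" "A * B = E" "B * A = 1\<^sub>m r"
proof -
  obtain r B C where rf: "rank_fact r E B C" by (rule rank_fact_exists)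
  have dims: "dim_row B = r" "dim_col B = d" "dim_row C = d" "dim_col C = r" "dim_row E = d" "dim_col E = d"
    using rf E by (auto simp: rank_fact_def)
  have EX: "E * (E * X) = E * X" if "dim_row X = d" for X
    using E dims that by (simp flip: mult_mat_assoc)
  show thesis
  proof (rule that[of "E * C" r "B * E"])
    show "E * C * (B * E) = E" using rf dims by (simp add: rank_fact_def mult_mat_assoc)
    show "B * E * (E * C) = 1\<^sub>m r" using rf dims by (simp add: rank_fact_def mult_mat_assoc EX)
  qed (use dims in auto)
qed

subsection \<open>Kronecker products\<close>

lemma dim_kronecker [simp]:
  "dim_row (kronecker A B) = dim_row A * dim_row B" "dim_col (kronecker A B) = dim_col A * dim_col B"
  by (simp_all add: kronecker_def)

lemma sum_div_mod:
  fixes g :: "nat \<Rightarrow> nat \<Rightarrow> 'a::comm_monoid_add"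
  shows "(\<Sum>k<p * r. g (k div r) (k mod r)) = (\<Sum>a<p. \<Sum>b<r. g a b)"
proof (induction p)
  case (Suc p)
  have "(\<Sum>k<Suc p * r. g (k div r) (k mod r)) = (\<Sum>k<p * r + r. g (k div r) (k mod r))"
    by (simp add: add.commute)
  also have "\<dots> = (\<Sum>k<p * r. g (k div r) (k mod r)) + (\<Sum>k<r. g p k)"
    by (subst sum_lessThan_add) (auto intro!: arg_cong2[of _ _ _ _ plus] sum.cong)
  finally show ?case using Suc by simp
qed simp

lemma div_less_mult: "i < a * b \<Longrightarrow> i div b < (a::nat)" "i < a * b \<Longrightarrow> i mod b < (b::nat)"
  by (metis less_mult_imp_div_less, metis less_nat_zero_code mod_less_divisor mult_0_right neq0_conv)

lemma kronecker_mult: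
  assumes "dim_col A = dim_row C" "dim_col B = dim_row D"
  shows "kronecker A B * kronecker C D = kronecker (A * C) (B * D)"
proof (rule eq_matI)
  fix i j assume ij: "i < dim_row (kronecker (A * C) (B * D))" "j < dim_col (kronecker (A * C) (B * D))"
  let ?r = "dim_row D"
  have lt: "i div dim_row B < dim_row A" "i mod dim_row B < dim_row B"
    "j div dim_col D < dim_col C" "j mod dim_col D < dim_col D"
    using ij by (simp_all add: div_less_mult)
  have "(kronecker A B * kronecker C D) $$ (i, j)
    = (\<Sum>k<dim_row C * ?r. (A $$ (i div dim_row B, k div ?r) * B $$ (i mod dim_row B, k mod ?r))
         * (C $$ (k div ?r, j div dim_col D) * D $$ (k mod ?r, j mod dim_col D)))"
    using ij assms by (subst mult_mat_entry) (auto simp: kronecker_def intro!: sum.cong)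
  also have "\<dots> = (\<Sum>a<dim_row C. \<Sum>b<?r. (A $$ (i div dim_row B, a) * B $$ (i mod dim_row B, b))
         * (C $$ (a, j div dim_col D) * D $$ (b, j mod dim_col D)))"
    by (rule sum_div_mod)
  also have "\<dots> = (\<Sum>a<dim_row C. A $$ (i div dim_row B, a) * C $$ (a, j div dim_col D))
      * (\<Sum>b<?r. B $$ (i mod dim_row B, b) * D $$ (b, j mod dim_col D))"
    by (simp add: sum_product mult_ac)
  also have "\<dots> = kronecker (A * C) (B * D) $$ (i, j)"
    using ij assms lt by (simp add: kronecker_def[of "A * C"] mult_mat_entry del: index_mult_mat(1))
  finally show "(kronecker A B * kronecker C D) $$ (i, j) = kronecker (A * C) (B * D) $$ (i, j)" .
qed simp_all

lemma kronecker_one: "kronecker (1\<^sub>m a) (1\<^sub>m b) = (1\<^sub>m (a * b) :: 'a::field mat)"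
proof (rule eq_matI)
  fix i j assume "i < dim_row (1\<^sub>m (a * b) :: 'a mat)" "j < dim_col (1\<^sub>m (a * b) :: 'a mat)"
  then show "kronecker (1\<^sub>m a) (1\<^sub>m b) $$ (i, j) = (1\<^sub>m (a * b) :: 'a mat) $$ (i, j)"
    using div_less_mult[of i a b] div_less_mult[of j a b]
    by (simp add: kronecker_def) (metis div_mult_mod_eq)
qed simp_all

lemma kronecker_add_left:
  "dim_row A = dim_row B \<Longrightarrow> dim_col A = dim_col B \<Longrightarrow> kronecker (A + B) C = kronecker A C + kronecker B C"
  by (rule eq_matI) (auto simp: kronecker_def div_less_mult distrib_right)

lemma kronecker_add_right:
  "dim_row A = dim_row B \<Longrightarrow> dim_col A = dim_col B \<Longrightarrow> kronecker C (A + B) = kronecker C A + kronecker C B"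
  by (rule eq_matI) (auto simp: kronecker_def div_less_mult distrib_left)

lemma kronecker_smult_left: "kronecker (c \<cdot>\<^sub>m A) B = c \<cdot>\<^sub>m kronecker A B"
  by (rule eq_matI) (auto simp: kronecker_def div_less_mult)

lemma kronecker_smult_right: "kronecker A (c \<cdot>\<^sub>m B) = c \<cdot>\<^sub>m kronecker A B"
  by (rule eq_matI) (auto simp: kronecker_def div_less_mult)

lemma kronecker_zero_left: "kronecker (0\<^sub>m a b) B = 0\<^sub>m (a * dim_row B) (b * dim_col B)"
  by (rule eq_matI) (auto simp: kronecker_def div_less_mult)

lemma kronecker_zero_right: "kronecker A (0\<^sub>m a b) = 0\<^sub>m (dim_row A * a) (dim_col A * b)"
  by (rule eq_matI) (auto simp: kronecker_def div_less_mult)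

lemma kronecker_assoc: "kronecker (kronecker A B) C = kronecker A (kronecker B C)"
proof (rule eq_matI)
  fix i j assume ij: "i < dim_row (kronecker A (kronecker B C))" "j < dim_col (kronecker A (kronecker B C))"
  have split: "(i div c) div b = i div (b * c)" "(i div c) mod b = (i mod (b * c)) div c"
    "i mod c = (i mod (b * c)) mod c" for i b c :: nat
  proof -
    show "(i div c) div b = i div (b * c)" by (simp add: div_mult2_eq[of i c b] mult.commute[of b c])
    have "i mod (b * c) = c * (i div c mod b) + i mod c"
      using mod_mult2_eq[of i c b] by (simp add: mult.commute[of b c])
    then show "(i div c) mod b = (i mod (b * c)) div c" by (cases "c = 0") simp_all
    show "i mod c = (i mod (b * c)) mod c" by (simp add: mod_mod_cancel)
  qed
  have lt: "i div dim_row C < dim_row A * dim_row B" "j div dim_col C < dim_col A * dim_col B"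
    "i mod (dim_row B * dim_row C) < dim_row B * dim_row C"
    "j mod (dim_col B * dim_col C) < dim_col B * dim_col C"
    using ij by (simp_all add: mult.assoc div_less_mult less_mult_imp_div_less)
  show "kronecker (kronecker A B) C $$ (i, j) = kronecker A (kronecker B C) $$ (i, j)"
    using ij lt split[of i "dim_row C" "dim_row B"] split[of j "dim_col C" "dim_col B"]
    by (simp add: kronecker_def mult.assoc)
qed (auto simp: mult.assoc)

lemma kronecker_one_left: "kronecker (1\<^sub>m 1) B = (B :: 'a::field mat)"
  by (rule eq_matI) (auto simp: kronecker_def)

lemma kronecker_one_right: "kronecker A (1\<^sub>m 1) = (A :: 'a::field mat)"
  by (rule eq_matI) (auto simp: kronecker_def)

lemma kronecker_pow:
  assumes "dim_col A = dim_row A" "dim_col B = dim_row B"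
  shows "kronecker A B ^\<^sub>m k = kronecker (A ^\<^sub>m k) (B ^\<^sub>m k)"
  by (induction k) (use assms in \<open>simp_all add: kronecker_one kronecker_mult\<close>)

\<comment> \<open>As a rewrite rule it replaces dimensions by the free sizes of a carrier assumption.\<close>
declare carrier_matD [simp del]

lemma mat_add_zero:
  fixes A :: "'a::monoid_add mat"
  shows "dim_row A = m \<Longrightarrow> dim_col A = n \<Longrightarrow> A + 0\<^sub>m m n = A"
    "dim_row A = m \<Longrightarrow> dim_col A = n \<Longrightarrow> 0\<^sub>m m n + A = A"
  by (rule eq_matI; simp)+

section \<open>Modules over a finite-dimensional algebra\<close>

text \<open>The shape half of \<open>is_module\<close>. Tensor and dual modules have it by
  construction, before any Hopf axiom is checked.\<close>

definition rep_wf :: "('b, 'k::field, 'z) alg_scheme \<Rightarrow> ('b, 'k) rep \<Rightarrow> bool" where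
  "rep_wf A V \<longleftrightarrow> (\<forall>b\<in>alg_basis A. dim_row (rep_act V b) = rep_dim V \<and> dim_col (rep_act V b) = rep_dim V)"

definition hom_mat :: "('b, 'k::field, 'z) alg_scheme \<Rightarrow> ('b, 'k) rep \<Rightarrow> ('b, 'k) rep \<Rightarrow> 'k mat \<Rightarrow> bool" where
  "hom_mat A U V P \<longleftrightarrow> dim_row P = rep_dim V \<and> dim_col P = rep_dim U \<and>
     (\<forall>b\<in>alg_basis A. P * rep_act U b = rep_act V b * P)"

text \<open>Direct sums in terms of inclusions and projections: these equations are preserved by
  Kronecker products with an identity and by transposition, whereas the block form of
  \<open>direct_sum\<close> is not.\<close>

definition biproduct :: "('b, 'k::field, 'z) alg_scheme \<Rightarrow> ('b, 'k) rep \<Rightarrow> ('b, 'k) rep \<Rightarrow> ('b, 'k) rep \<Rightarrow> bool" where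
  "biproduct A X U V \<longleftrightarrow> (\<exists>i1 i2 p1 p2. hom_mat A U X i1 \<and> hom_mat A V X i2 \<and>
     hom_mat A X U p1 \<and> hom_mat A X V p2 \<and>
     p1 * i1 = 1\<^sub>m (rep_dim U) \<and> p2 * i2 = 1\<^sub>m (rep_dim V) \<and>
     p1 * i2 = 0\<^sub>m (rep_dim U) (rep_dim V) \<and> p2 * i1 = 0\<^sub>m (rep_dim V) (rep_dim U) \<and>
     i1 * p1 + i2 * p2 = 1\<^sub>m (rep_dim X))"

lemma is_module_wf: "is_module A V \<Longrightarrow> rep_wf A V"
  by (auto simp: is_module_def rep_wf_def)

lemma rep_wfD:
  "rep_wf A V \<Longrightarrow> b \<in> alg_basis A \<Longrightarrow> dim_row (rep_act V b) = rep_dim V"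
  "rep_wf A V \<Longrightarrow> b \<in> alg_basis A \<Longrightarrow> dim_col (rep_act V b) = rep_dim V"
  by (auto simp: rep_wf_def)

lemma hom_matD:
  assumes "hom_mat A U V P"
  shows "dim_row P = rep_dim V" "dim_col P = rep_dim U"
    "b \<in> alg_basis A \<Longrightarrow> P * rep_act U b = rep_act V b * P"
  using assms by (auto simp: hom_mat_def)

lemma hom_mat_one: "rep_wf A V \<Longrightarrow> hom_mat A V V (1\<^sub>m (rep_dim V))"
  by (simp add: hom_mat_def rep_wfD mat_simps)

lemma hom_mat_mult:
  assumes "rep_wf A U" "rep_wf A V" "rep_wf A W" "hom_mat A U V P" "hom_mat A V W Q"
  shows "hom_mat A U W (Q * P)"
  unfolding hom_mat_def
proof (intro conjI ballI)
  fix b assume b: "b \<in> alg_basis A"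
  note d = rep_wfD[OF assms(1) b] rep_wfD[OF assms(2) b] rep_wfD[OF assms(3) b]
    hom_matD(1,2)[OF assms(4)] hom_matD(1,2)[OF assms(5)]
  have "Q * P * rep_act U b = Q * rep_act V b * P"
    using d by (simp add: mult_mat_assoc hom_matD(3)[OF assms(4) b])
  also have "\<dots> = rep_act W b * (Q * P)"
    using d by (simp add: mult_mat_assoc hom_matD(3)[OF assms(5) b])
  finally show "Q * P * rep_act U b = rep_act W b * (Q * P)" .
qed (use hom_matD[OF assms(4)] hom_matD[OF assms(5)] in simp_all)

lemma inverse_dims_eq:
  fixes P Q :: "'a::field mat"
  assumes "dim_row P = m" "dim_col P = n" "dim_row Q = n" "dim_col Q = m" "P * Q = 1\<^sub>m m" "Q * P = 1\<^sub>m n"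
  shows "m = n"
proof (rule antisym)
  have P: "P \<in> carrier_mat m n" and Q: "Q \<in> carrier_mat n m" using assms by (simp_all add: carrier_mat_def)
  show "m \<le> n" by (rule left_inverse_dim_le[OF Q P assms(5)])
  show "n \<le> m" by (rule left_inverse_dim_le[OF P Q assms(6)])
qed

lemma hom_mat_inverse:
  assumes "rep_wf A U" "rep_wf A V" "hom_mat A U V P"
    and Q: "dim_row Q = rep_dim U" "dim_col Q = rep_dim V" "P * Q = 1\<^sub>m (rep_dim V)" "Q * P = 1\<^sub>m (rep_dim U)"
  shows "hom_mat A V U Q"
  unfolding hom_mat_def
proof (intro conjI ballI)
  fix b assume b: "b \<in> alg_basis A"
  note d = rep_wfD[OF assms(1) b] rep_wfD[OF assms(2) b] hom_matD(1,2)[OF assms(3)] Q(1,2)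
  have "Q * rep_act V b = Q * (rep_act V b * (P * Q))" using d by (simp add: Q(3) mat_simps)
  also have "\<dots> = Q * ((rep_act V b * P) * Q)" using d by (simp add: mult_mat_assoc)
  also have "\<dots> = Q * ((P * rep_act U b) * Q)" by (simp only: hom_matD(3)[OF assms(3) b])
  also have "\<dots> = (Q * P) * (rep_act U b * Q)" using d by (simp add: mult_mat_assoc)
  also have "\<dots> = rep_act U b * Q" using d by (simp add: Q(4) mat_simps)
  finally show "Q * rep_act V b = rep_act U b * Q" .
qed (use Q in simp_all)

lemma module_isoI:
  assumes "hom_mat A U V P" "dim_row Q = rep_dim U" "dim_col Q = rep_dim V"
    "P * Q = 1\<^sub>m (rep_dim V)" "Q * P = 1\<^sub>m (rep_dim U)"
  shows "module_iso A U V"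
proof -
  have eq: "rep_dim V = rep_dim U"
    using inverse_dims_eq[of P "rep_dim V" "rep_dim U" Q] assms hom_matD[OF assms(1)] by simp
  have "invertible_mat P" unfolding invertible_mat_def inverts_mat_def
    using assms hom_matD(1,2)[OF assms(1)] eq by (auto intro!: exI[of _ Q])
  moreover have "P \<in> carrier_mat (rep_dim V) (rep_dim U)"
    using hom_matD(1,2)[OF assms(1)] by (simp add: carrier_mat_def)
  ultimately show ?thesis using eq hom_matD(3)[OF assms(1)] by (auto simp: module_iso_def)
qed

lemma module_isoE:
  assumes "module_iso A U V" "rep_wf A U" "rep_wf A V"
  obtains P Q where "hom_mat A U V P" "hom_mat A V U Q"
    "P * Q = 1\<^sub>m (rep_dim V)" "Q * P = 1\<^sub>m (rep_dim U)"
proof -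
  from assms(1) obtain P where P: "P \<in> carrier_mat (rep_dim V) (rep_dim U)" "invertible_mat P"
    "\<And>b. b \<in> alg_basis A \<Longrightarrow> P * rep_act U b = rep_act V b * P"
    by (auto simp: module_iso_def)
  then obtain Q where Q: "P * Q = 1\<^sub>m (dim_row P)" "Q * P = 1\<^sub>m (dim_row Q)"
    by (auto simp: invertible_mat_def inverts_mat_def)
  have dP: "dim_row P = rep_dim V" "dim_col P = rep_dim U" using P(1) by (simp_all add: carrier_mat_def)
  have dQ: "dim_col Q = rep_dim V" "dim_row Q = rep_dim U"
    using arg_cong[OF Q(1), of dim_col] arg_cong[OF Q(2), of dim_col] dP by simp_all
  have hP: "hom_mat A U V P" using P(3) dP by (simp add: hom_mat_def)
  show thesis
    using that[OF hP hom_mat_inverse[OF assms(2,3) hP dQ(2,1)]] Q dP dQ by simp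
qed

lemma module_iso_dim: "module_iso A U V \<Longrightarrow> rep_dim U = rep_dim V"
  by (simp add: module_iso_def)

lemma module_iso_refl: "rep_wf A V \<Longrightarrow> module_iso A V V"
  by (rule module_isoI[OF hom_mat_one, of A V "1\<^sub>m (rep_dim V)"]) auto

lemma module_iso_sym:
  assumes "module_iso A U V" "rep_wf A U" "rep_wf A V"
  shows "module_iso A V U"
  using assms by (elim module_isoE) (auto intro!: module_isoI dest: hom_matD)

lemma module_iso_trans:
  assumes "module_iso A U V" "module_iso A V W" "rep_wf A U" "rep_wf A V" "rep_wf A W"
  shows "module_iso A U W"
proof -
  obtain P Q where P: "hom_mat A U V P" "hom_mat A V U Q" "P * Q = 1\<^sub>m (rep_dim V)" "Q * P = 1\<^sub>m (rep_dim U)"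
    using module_isoE[OF assms(1,3,4)] .
  obtain P' Q' where P': "hom_mat A V W P'" "hom_mat A W V Q'" "P' * Q' = 1\<^sub>m (rep_dim W)" "Q' * P' = 1\<^sub>m (rep_dim V)"
    using module_isoE[OF assms(2,4,5)] .
  note d = hom_matD(1,2)[OF P(1)] hom_matD(1,2)[OF P(2)] hom_matD(1,2)[OF P'(1)] hom_matD(1,2)[OF P'(2)]
  show ?thesis
  proof (rule module_isoI[OF hom_mat_mult[OF assms(3,4,5) P(1) P'(1)], of "Q * Q'"])
    have "P' * P * (Q * Q') = P' * ((P * Q) * Q')" using d by (simp add: mult_mat_assoc)
    then show "P' * P * (Q * Q') = 1\<^sub>m (rep_dim W)" using d by (simp add: P P' mat_simps)
    have "Q * Q' * (P' * P) = Q * ((Q' * P') * P)" using d by (simp add: mult_mat_assoc)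
    then show "Q * Q' * (P' * P) = 1\<^sub>m (rep_dim U)" using d by (simp add: P P' mat_simps)
  qed (use d in simp_all)
qed

lemma direct_sum_dim [simp]: "rep_dim (direct_sum U V) = rep_dim U + rep_dim V"
  by (simp add: direct_sum_def)

lemma rep_wf_direct_sum: "rep_wf A U \<Longrightarrow> rep_wf A V \<Longrightarrow> rep_wf A (direct_sum U V)"
  by (simp add: rep_wf_def direct_sum_def)

lemma four_block_mult_vcat:
  fixes A B C D :: "'a::semiring_1 mat"
  assumes "dim_row A = m" "dim_row B = m'" "dim_col A = n" "dim_col B = n'" "dim_row C = n" "dim_row D = n'"
    "dim_col C = dim_col D"
  shows "four_block_mat A (0\<^sub>m m n') (0\<^sub>m m' n) B * vcat C D = vcat (A * C) (B * D)"
proof -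
  have "four_block_mat A (0\<^sub>m m n') (0\<^sub>m m' n) B = vcat (hcat A (0\<^sub>m m n')) (hcat (0\<^sub>m m' n) B)"
    by (rule eq_matI) (use assms in \<open>auto simp: hcat_def vcat_def\<close>)
  then show ?thesis using assms by (simp add: vcat_mult hcat_mult_vcat mat_simps mat_add_zero)
qed

lemma hcat_mult_four_block:
  fixes A B C D :: "'a::semiring_1 mat"
  assumes "dim_row A = m" "dim_row B = m'" "dim_col A = n" "dim_col B = n'" "dim_col C = m" "dim_col D = m'"
    "dim_row C = dim_row D"
  shows "hcat C D * four_block_mat A (0\<^sub>m m n') (0\<^sub>m m' n) B = hcat (C * A) (D * B)"
proof -
  have "four_block_mat A (0\<^sub>m m n') (0\<^sub>m m' n) B = hcat (vcat A (0\<^sub>m m' n)) (vcat (0\<^sub>m m n') B)"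
    by (rule eq_matI) (use assms in \<open>auto simp: hcat_def vcat_def\<close>)
  then show ?thesis using assms by (simp add: mult_hcat hcat_mult_vcat mat_simps mat_add_zero)
qed

lemma biproduct_imp_iso:
  assumes bp: "biproduct A X U V" and wf: "rep_wf A X" "rep_wf A U" "rep_wf A V"
  shows "module_iso A X (direct_sum U V)"
proof -
  obtain i1 i2 p1 p2 where h: "hom_mat A U X i1" "hom_mat A V X i2" "hom_mat A X U p1" "hom_mat A X V p2"
    and e: "p1 * i1 = 1\<^sub>m (rep_dim U)" "p2 * i2 = 1\<^sub>m (rep_dim V)"
     "p1 * i2 = 0\<^sub>m (rep_dim U) (rep_dim V)" "p2 * i1 = 0\<^sub>m (rep_dim V) (rep_dim U)"
     "i1 * p1 + i2 * p2 = 1\<^sub>m (rep_dim X)"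
    using bp by (auto simp: biproduct_def)
  note d = hom_matD(1,2)[OF h(1)] hom_matD(1,2)[OF h(2)] hom_matD(1,2)[OF h(3)] hom_matD(1,2)[OF h(4)]
  show ?thesis
  proof (rule module_isoI[of A X _ "vcat p1 p2" "hcat i1 i2"])
    show "hom_mat A X (direct_sum U V) (vcat p1 p2)"
      unfolding hom_mat_def
    proof (intro conjI ballI)
      fix b assume b: "b \<in> alg_basis A"
      note db = rep_wfD[OF wf(1) b] rep_wfD[OF wf(2) b] rep_wfD[OF wf(3) b]
      show "vcat p1 p2 * rep_act X b = rep_act (direct_sum U V) b * vcat p1 p2"
        using d db by (simp add: direct_sum_def four_block_mult_vcat vcat_mult
            hom_matD(3)[OF h(3) b] hom_matD(3)[OF h(4) b])
    qed (use d in simp_all)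
    show "vcat p1 p2 * hcat i1 i2 = 1\<^sub>m (rep_dim (direct_sum U V))"
      using d by (simp add: vcat_mult_hcat e)
    show "hcat i1 i2 * vcat p1 p2 = 1\<^sub>m (rep_dim X)"
      using d by (simp add: hcat_mult_vcat e)
  qed (use d in simp_all)
qed

lemma biproduct_direct_sum:
  assumes wf: "rep_wf A U" "rep_wf A V"
  shows "biproduct A (direct_sum U V) U V"
proof -
  let ?u = "rep_dim U" and ?v = "rep_dim V"
  have "hom_mat A U (direct_sum U V) (vcat (1\<^sub>m ?u) (0\<^sub>m ?v ?u))"
    "hom_mat A V (direct_sum U V) (vcat (0\<^sub>m ?u ?v) (1\<^sub>m ?v))"
    "hom_mat A (direct_sum U V) U (hcat (1\<^sub>m ?u) (0\<^sub>m ?u ?v))"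
    "hom_mat A (direct_sum U V) V (hcat (0\<^sub>m ?v ?u) (1\<^sub>m ?v))"
    using wf by (simp_all add: hom_mat_def direct_sum_def rep_wfD four_block_mult_vcat vcat_mult
        hcat_mult_four_block mult_hcat mat_simps)
  moreover have "vcat (1\<^sub>m ?u) (0\<^sub>m ?v ?u) * hcat (1\<^sub>m ?u) (0\<^sub>m ?u ?v)
      + vcat (0\<^sub>m ?u ?v) (1\<^sub>m ?v) * hcat (0\<^sub>m ?v ?u) (1\<^sub>m ?v) = (1\<^sub>m (?u + ?v) :: 'b mat)"
    by (simp add: vcat_mult_hcat mat_simps) (rule eq_matI, auto)
  ultimately show ?thesis unfolding biproduct_def
    by (intro exI conjI) (auto simp: hcat_mult_vcat mat_simps)
qed

section \<open>Action of arbitrary algebra elements\<close>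

lemma dim_act_elem [simp]: "dim_row (act_elem A V x) = rep_dim V" "dim_col (act_elem A V x) = rep_dim V"
  by (simp_all add: act_elem_def)

lemma act_elem_entry:
  "i < rep_dim V \<Longrightarrow> j < rep_dim V \<Longrightarrow> act_elem A V x $$ (i, j) = (\<Sum>b\<in>alg_basis A. x b * rep_act V b $$ (i, j))"
  by (simp add: act_elem_def)

lemma sum_bvec:
  assumes "finite B" "b \<in> B"
  shows "(\<Sum>c\<in>B. bvec b c * f c) = f b"
proof -
  have "(\<Sum>c\<in>B. bvec b c * f c) = (\<Sum>c\<in>B. if c = b then f c else 0)"
    by (rule sum.cong) (simp_all add: bvec_def)
  then show ?thesis using assms by simp
qed

lemma act_elem_bvec:
  assumes "finite (alg_basis A)" "b \<in> alg_basis A" "rep_wf A V"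
  shows "act_elem A V (bvec b) = rep_act V b"
proof (rule eq_matI)
  fix i j assume "i < dim_row (rep_act V b)" "j < dim_col (rep_act V b)"
  then show "act_elem A V (bvec b) $$ (i, j) = rep_act V b $$ (i, j)"
    using assms by (simp add: act_elem_entry sum_bvec rep_wfD)
qed (use assms in \<open>simp_all add: rep_wfD\<close>)

lemma mult_act_elem:
  assumes "dim_col P = rep_dim V" "rep_wf A V"
  shows "P * act_elem A V x = mat (dim_row P) (rep_dim V) (\<lambda>(i, j). \<Sum>b\<in>alg_basis A. x b * (P * rep_act V b) $$ (i, j))"
proof (rule eq_matI)
  fix i j assume "i < dim_row (mat (dim_row P) (rep_dim V) (\<lambda>(i, j). \<Sum>b\<in>alg_basis A. x b * (P * rep_act V b) $$ (i, j)))"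
    "j < dim_col (mat (dim_row P) (rep_dim V) (\<lambda>(i, j). \<Sum>b\<in>alg_basis A. x b * (P * rep_act V b) $$ (i, j)))"
  then have ij: "i < dim_row P" "j < rep_dim V" by simp_all
  have "(P * act_elem A V x) $$ (i, j)
      = (\<Sum>k<rep_dim V. \<Sum>b\<in>alg_basis A. x b * (P $$ (i, k) * rep_act V b $$ (k, j)))"
    using ij assms by (simp add: mult_mat_entry act_elem_def sum_distrib_left mult.left_commute del: index_mult_mat(1))
  also have "\<dots> = (\<Sum>b\<in>alg_basis A. x b * (\<Sum>k<rep_dim V. P $$ (i, k) * rep_act V b $$ (k, j)))"
    by (subst sum.swap) (simp add: sum_distrib_left)
  also have "\<dots> = (\<Sum>b\<in>alg_basis A. x b * (P * rep_act V b) $$ (i, j))"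
    using ij assms by (intro sum.cong) (simp_all add: mult_mat_entry rep_wfD del: index_mult_mat(1))
  finally show "(P * act_elem A V x) $$ (i, j)
      = mat (dim_row P) (rep_dim V) (\<lambda>(i, j). \<Sum>b\<in>alg_basis A. x b * (P * rep_act V b) $$ (i, j)) $$ (i, j)"
    using ij by simp
qed simp_all

lemma act_elem_mult:
  assumes "dim_row P = rep_dim V" "rep_wf A V"
  shows "act_elem A V x * P = mat (rep_dim V) (dim_col P) (\<lambda>(i, j). \<Sum>b\<in>alg_basis A. x b * (rep_act V b * P) $$ (i, j))"
proof (rule eq_matI)
  fix i j assume "i < dim_row (mat (rep_dim V) (dim_col P) (\<lambda>(i, j). \<Sum>b\<in>alg_basis A. x b * (rep_act V b * P) $$ (i, j)))"
    "j < dim_col (mat (rep_dim V) (dim_col P) (\<lambda>(i, j). \<Sum>b\<in>alg_basis A. x b * (rep_act V b * P) $$ (i, j)))"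
  then have ij: "i < rep_dim V" "j < dim_col P" by simp_all
  have "(act_elem A V x * P) $$ (i, j)
      = (\<Sum>k<rep_dim V. \<Sum>b\<in>alg_basis A. x b * (rep_act V b $$ (i, k) * P $$ (k, j)))"
    using ij assms by (simp add: mult_mat_entry act_elem_def sum_distrib_right mult.assoc del: index_mult_mat(1))
  also have "\<dots> = (\<Sum>b\<in>alg_basis A. x b * (\<Sum>k<rep_dim V. rep_act V b $$ (i, k) * P $$ (k, j)))"
    by (subst sum.swap) (simp add: sum_distrib_left)
  also have "\<dots> = (\<Sum>b\<in>alg_basis A. x b * (rep_act V b * P) $$ (i, j))"
    using ij assms by (intro sum.cong) (simp_all add: mult_mat_entry rep_wfD del: index_mult_mat(1))
  finally show "(act_elem A V x * P) $$ (i, j)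
      = mat (rep_dim V) (dim_col P) (\<lambda>(i, j). \<Sum>b\<in>alg_basis A. x b * (rep_act V b * P) $$ (i, j)) $$ (i, j)"
    using ij by simp
qed simp_all

lemma hom_mat_act_elem:
  assumes "hom_mat A U V P" "rep_wf A U" "rep_wf A V"
  shows "P * act_elem A U x = act_elem A V x * P"
  using hom_matD[OF assms(1)] assms(2,3) by (simp add: mult_act_elem act_elem_mult)

lemma act_elem_amul:
  assumes fin: "finite (alg_basis A)" and wf: "rep_wf A V"
    and mult: "\<And>a b. a \<in> alg_basis A \<Longrightarrow> b \<in> alg_basis A \<Longrightarrow>
      act_elem A V (alg_mul A a b) = rep_act V a * rep_act V b"
  shows "act_elem A V (amul A x y) = act_elem A V x * act_elem A V y"
proof (rule eq_matI)
  let ?B = "alg_basis A"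
  fix i j assume "i < dim_row (act_elem A V x * act_elem A V y)" "j < dim_col (act_elem A V x * act_elem A V y)"
  then have ij: "i < rep_dim V" "j < rep_dim V" by simp_all
  have "act_elem A V (amul A x y) $$ (i, j)
      = (\<Sum>c\<in>?B. \<Sum>a\<in>?B. \<Sum>b\<in>?B. x a * y b * (alg_mul A a b c * rep_act V c $$ (i, j)))"
    using ij by (simp add: act_elem_def amul_def sum_distrib_right mult.assoc cong: sum.cong)
  also have "\<dots> = (\<Sum>a\<in>?B. \<Sum>b\<in>?B. \<Sum>c\<in>?B. x a * y b * (alg_mul A a b c * rep_act V c $$ (i, j)))"
    by (subst sum.swap) (intro sum.cong refl sum.swap)
  also have "\<dots> = (\<Sum>a\<in>?B. \<Sum>b\<in>?B. x a * y b * act_elem A V (alg_mul A a b) $$ (i, j))"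
    using ij by (simp add: act_elem_def sum_distrib_left)
  also have "\<dots> = (\<Sum>a\<in>?B. \<Sum>b\<in>?B. x a * y b * (\<Sum>k<rep_dim V. rep_act V a $$ (i, k) * rep_act V b $$ (k, j)))"
    using ij by (intro sum.cong refl)
      (simp add: mult mult_mat_entry rep_wfD[OF wf] del: index_mult_mat(1))
  also have "\<dots> = (\<Sum>a\<in>?B. \<Sum>b\<in>?B. \<Sum>k<rep_dim V. (x a * rep_act V a $$ (i, k)) * (y b * rep_act V b $$ (k, j)))"
    by (simp add: sum_distrib_left mult_ac)
  also have "\<dots> = (\<Sum>a\<in>?B. \<Sum>k<rep_dim V. \<Sum>b\<in>?B. (x a * rep_act V a $$ (i, k)) * (y b * rep_act V b $$ (k, j)))"
    by (intro sum.cong refl sum.swap)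
  also have "\<dots> = (\<Sum>k<rep_dim V. \<Sum>a\<in>?B. \<Sum>b\<in>?B. (x a * rep_act V a $$ (i, k)) * (y b * rep_act V b $$ (k, j)))"
    by (rule sum.swap)
  also have "\<dots> = (\<Sum>k<rep_dim V. act_elem A V x $$ (i, k) * act_elem A V y $$ (k, j))"
    using ij by (intro sum.cong refl) (simp add: act_elem_entry sum_product)
  also have "\<dots> = (act_elem A V x * act_elem A V y) $$ (i, j)"
    using ij by (simp add: mult_mat_entry del: index_mult_mat(1))
  finally show "act_elem A V (amul A x y) $$ (i, j) = (act_elem A V x * act_elem A V y) $$ (i, j)" .
qed simp_all

lemma module_act_amul:
  assumes "is_module A V" "finite (alg_basis A)"
  shows "act_elem A V (amul A x y) = act_elem A V x * act_elem A V y"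
  using assms by (intro act_elem_amul is_module_wf) (simp_all add: is_module_def)

lemma module_act_apow:
  assumes "is_module A V" "finite (alg_basis A)"
  shows "act_elem A V (apow A x k) = act_elem A V x ^\<^sub>m k"
  by (induction k) (use assms in \<open>simp_all add: module_act_amul, simp add: is_module_def\<close>)

lemma act_elem_add: "act_elem A V (\<lambda>b. x b + y b) = act_elem A V x + act_elem A V y"
  by (rule eq_matI) (simp_all add: act_elem_def sum.distrib distrib_right)

lemma act_elem_uminus: "act_elem A V (\<lambda>b. - x b) = - act_elem A V x"
  by (rule eq_matI) (simp_all add: act_elem_def sum_negf)

section \<open>Direct sums, retracts and complements\<close>

lemma act_elem_direct_sum:
  assumes "rep_wf A U" "rep_wf A V"
  shows "act_elem A (direct_sum U V) x = four_block_mat (act_elem A U x) (0\<^sub>m (rep_dim U) (rep_dim V))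
    (0\<^sub>m (rep_dim V) (rep_dim U)) (act_elem A V x)"
  by (rule eq_matI) (use assms in \<open>auto simp: act_elem_def direct_sum_def rep_wfD intro!: sum.cong sum.neutral\<close>)

lemma is_module_direct_sum:
  assumes "is_module A U" "is_module A V"
  shows "is_module A (direct_sum U V)"
proof -
  note wf = is_module_wf[OF assms(1)] is_module_wf[OF assms(2)]
  show ?thesis
    unfolding is_module_def
  proof (intro conjI ballI)
    fix b assume b: "b \<in> alg_basis A"
    then show "rep_act (direct_sum U V) b \<in> carrier_mat (rep_dim (direct_sum U V)) (rep_dim (direct_sum U V))"
      using rep_wfD[OF rep_wf_direct_sum[OF wf] b] by (simp add: carrier_mat_def)
  next
    show "act_elem A (direct_sum U V) (alg_unit A) = 1\<^sub>m (rep_dim (direct_sum U V))"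
      using assms by (simp add: act_elem_direct_sum wf is_module_def)
  next
    fix a b assume ab: "a \<in> alg_basis A" "b \<in> alg_basis A"
    have "act_elem A U (alg_mul A a b) = rep_act U a * rep_act U b"
      "act_elem A V (alg_mul A a b) = rep_act V a * rep_act V b"
      using assms ab by (simp_all add: is_module_def)
    then show "act_elem A (direct_sum U V) (alg_mul A a b) = rep_act (direct_sum U V) a * rep_act (direct_sum U V) b"
      using wf ab by (simp add: act_elem_direct_sum) (simp add: direct_sum_def four_block_diag_mult rep_wfD)
  qed
qed

text \<open>\<open>P * Q\<close> is an idempotent endomorphism, and \<open>W\<close> is its image in
  coordinates. Since it commutes with the action, it can be moved through a product of two action
  matrices and absorbed into \<open>P\<close> or \<open>Q\<close>.\<close>

lemma is_module_retract:
  assumes V: "is_module A V" and dims: "dim_row P = rep_dim V" "dim_col P = r" "dim_row Q = r" "dim_col Q = rep_dim V"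
    and QP: "Q * P = 1\<^sub>m r" and comm: "\<And>b. b \<in> alg_basis A \<Longrightarrow> (P * Q) * rep_act V b = rep_act V b * (P * Q)"
  defines "W \<equiv> \<lparr>rep_dim = r, rep_act = (\<lambda>b. Q * (rep_act V b * P))\<rparr>"
  shows "is_module A W" "hom_mat A W V P" "hom_mat A V W Q"
proof -
  note wf = is_module_wf[OF V]
  have act: "act_elem A W x = Q * (act_elem A V x * P)" for x
  proof -
    have "Q * (act_elem A V x * P) = (Q * act_elem A V x) * P" using dims by (simp add: mult_mat_assoc)
    also have "Q * act_elem A V x = mat r (rep_dim V) (\<lambda>(i, j). \<Sum>b\<in>alg_basis A. x b * (Q * rep_act V b) $$ (i, j))"
      using dims wf by (simp add: mult_act_elem)
    also have "\<dots> * P = act_elem A W x"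
    proof (rule eq_matI)
      fix i j assume "i < dim_row (act_elem A W x)" "j < dim_col (act_elem A W x)"
      then have ij: "i < r" "j < r" by (simp_all add: W_def)
      have "(mat r (rep_dim V) (\<lambda>(i, j). \<Sum>b\<in>alg_basis A. x b * (Q * rep_act V b) $$ (i, j)) * P) $$ (i, j)
        = (\<Sum>k<rep_dim V. \<Sum>b\<in>alg_basis A. x b * ((Q * rep_act V b) $$ (i, k) * P $$ (k, j)))"
        using dims ij by (simp add: mult_mat_entry[of _ "mat _ _ _"] sum_distrib_right mult.assoc del: index_mult_mat(1))
      also have "\<dots> = (\<Sum>b\<in>alg_basis A. x b * (\<Sum>k<rep_dim V. (Q * rep_act V b) $$ (i, k) * P $$ (k, j)))"
        by (subst sum.swap) (simp add: sum_distrib_left)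
      also have "\<dots> = (\<Sum>b\<in>alg_basis A. x b * (Q * (rep_act V b * P)) $$ (i, j))"
      proof (rule sum.cong)
        fix b assume b: "b \<in> alg_basis A"
        have "(\<Sum>k<rep_dim V. (Q * rep_act V b) $$ (i, k) * P $$ (k, j)) = (Q * rep_act V b * P) $$ (i, j)"
          using dims ij rep_wfD[OF wf b] by (subst mult_mat_entry[of i "Q * rep_act V b"]) simp_all
        then show "x b * (\<Sum>k<rep_dim V. (Q * rep_act V b) $$ (i, k) * P $$ (k, j)) = x b * (Q * (rep_act V b * P)) $$ (i, j)"
          using dims rep_wfD[OF wf b] by (simp add: mult_mat_assoc)
      qed simp
      also have "\<dots> = act_elem A W x $$ (i, j)" using ij by (simp add: act_elem_def W_def)
      finally show "(mat r (rep_dim V) (\<lambda>(i, j). \<Sum>b\<in>alg_basis A. x b * (Q * rep_act V b) $$ (i, j)) * P) $$ (i, j)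
        = act_elem A W x $$ (i, j)" .
    qed (use dims in \<open>simp_all add: W_def\<close>)
    finally show ?thesis ..
  qed
  have PQP: "P * (Q * (rep_act V b * Z)) = rep_act V b * (P * (Q * Z))"
    if "b \<in> alg_basis A" "dim_row Z = rep_dim V" for b Z
    using arg_cong[OF comm[OF that(1)], of "\<lambda>M. M * Z"] dims rep_wfD[OF wf that(1)] that(2)
    by (simp add: mult_mat_assoc)
  have QPZ: "Q * (P * Z) = Z" if "dim_row Z = r" for Z
    using dims that QP by (intro mat_cancel_left) simp_all
  show "is_module A W"
    unfolding is_module_def
  proof (intro conjI ballI)
    show "act_elem A W (alg_unit A) = 1\<^sub>m (rep_dim W)"
      using V dims QP unfolding act by (simp add: is_module_def W_def mat_simps)
    fix a b assume a: "a \<in> alg_basis A" and b: "b \<in> alg_basis A"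
    have "rep_act W a * rep_act W b = Q * (rep_act V a * (P * (Q * (rep_act V b * P))))"
      using dims rep_wfD[OF wf a] rep_wfD[OF wf b] by (simp add: W_def mult_mat_assoc)
    also have "\<dots> = Q * (rep_act V a * (rep_act V b * (P * (Q * P))))"
      using dims b by (simp add: PQP)
    also have "\<dots> = Q * (rep_act V a * rep_act V b * P)"
      using dims rep_wfD[OF wf a] rep_wfD[OF wf b] by (simp add: QP mat_simps)
    also have "\<dots> = act_elem A W (alg_mul A a b)"
      using V a b unfolding act by (simp add: is_module_def)
    finally show "act_elem A W (alg_mul A a b) = rep_act W a * rep_act W b" ..
  qed (use dims in \<open>simp add: W_def carrier_mat_def\<close>)
  show "hom_mat A W V P" unfolding hom_mat_def
  proof (intro conjI ballI)
    fix b assume b: "b \<in> alg_basis A"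
    have "P * rep_act W b = rep_act V b * (P * (Q * P))"
      using dims b by (simp add: W_def PQP)
    then show "P * rep_act W b = rep_act V b * P" using dims by (simp add: QP mat_simps)
  qed (use dims in \<open>simp_all add: W_def\<close>)
  show "hom_mat A V W Q" unfolding hom_mat_def
  proof (intro conjI ballI)
    fix b assume b: "b \<in> alg_basis A"
    have "rep_act W b * Q = Q * (rep_act V b * (P * Q))"
      using dims rep_wfD[OF wf b] by (simp add: W_def mult_mat_assoc)
    also have "\<dots> = Q * ((P * Q) * rep_act V b)" by (simp only: comm[OF b])
    also have "\<dots> = Q * rep_act V b" using dims rep_wfD[OF wf b] by (simp add: mult_mat_assoc QPZ)
    finally show "Q * rep_act V b = rep_act W b * Q" ..
  qed (use dims in \<open>simp_all add: W_def\<close>)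
qed

text \<open>The complement is the image of the idempotent \<open>1 - P * Q\<close>, which commutes
  with the action because \<open>P\<close> and \<open>Q\<close> do.\<close>

lemma split_summand:
  assumes V: "is_module A V" and U: "is_module A U"
    and P: "hom_mat A U V P" and Q: "hom_mat A V U Q" and QP: "Q * P = 1\<^sub>m (rep_dim U)"
  obtains W where "is_module A W" "biproduct A V U W" "rep_dim V = rep_dim U + rep_dim W"
proof -
  note wf = is_module_wf[OF V] is_module_wf[OF U]
  note d = hom_matD(1,2)[OF P] hom_matD(1,2)[OF Q]
  let ?d = "rep_dim V"
  define E where "E = 1\<^sub>m ?d - P * Q"
  have dE: "dim_row E = ?d" "dim_col E = ?d" using d by (simp_all add: E_def)
  have QPZ: "Q * (P * Z) = Z" if "dim_row Z = rep_dim U" for Z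
    using d that QP by (intro mat_cancel_left) simp_all
  have minus0: "X - X = 0\<^sub>m (dim_row X) (dim_col X)" for X :: "'b mat" by (rule eq_matI) auto
  have EP: "E * P = 0\<^sub>m ?d (rep_dim U)"
    using d by (simp add: E_def mult_mat_minus_left mat_simps QP minus0)
  have QE: "Q * E = 0\<^sub>m (rep_dim U) ?d"
    using d by (simp add: E_def mult_mat_minus_right mat_simps QPZ minus0)
  have "E * (P * Q) = 0\<^sub>m ?d ?d"
    using d dE EP by (simp add: mult_mat_zero_left flip: mult_mat_assoc)
  moreover have "E * E = E * 1\<^sub>m ?d - E * (P * Q)"
    using d dE by (subst (2) E_def) (simp add: mult_mat_minus_right)
  ultimately have "E * E = E" using dE by (simp add: mat_simps) (rule eq_matI, auto)
  then obtain r I J where IJ: "I \<in> carrier_mat ?d r" "J \<in> carrier_mat r ?d" "I * J = E" "J * I = 1\<^sub>m r"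
    using idempotent_split[of E ?d] dE by (auto simp: carrier_mat_def)
  have dIJ: "dim_row I = ?d" "dim_col I = r" "dim_row J = r" "dim_col J = ?d"
    using IJ by (simp_all add: carrier_mat_def)
  have comm: "(I * J) * rep_act V b = rep_act V b * (I * J)" if b: "b \<in> alg_basis A" for b
  proof -
    have "P * Q * rep_act V b = P * (rep_act U b * Q)"
      using d rep_wfD[OF wf(1) b] by (simp add: mult_mat_assoc hom_matD(3)[OF Q b])
    also have "\<dots> = (P * rep_act U b) * Q"
      using d rep_wfD[OF wf(2) b] by (simp add: mult_mat_assoc)
    also have "\<dots> = rep_act V b * (P * Q)"
      using d rep_wfD[OF wf(1) b] by (simp add: mult_mat_assoc hom_matD(3)[OF P b])
    finally show ?thesis
      using d rep_wfD[OF wf(1) b] by (simp add: IJ E_def mult_mat_minus_left mult_mat_minus_right mat_simps)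
  qed
  define W where "W = \<lparr>rep_dim = r, rep_act = (\<lambda>b. J * (rep_act V b * I))\<rparr>"
  note W = is_module_retract[OF V dIJ IJ(4) comm, folded W_def]
  have JIZ: "J * (I * Z) = Z" if "dim_row Z = r" for Z
    using dIJ that IJ(4) by (intro mat_cancel_left) simp_all
  have EE: "I * (J * Z) = E * Z" if "dim_row Z = ?d" for Z
    using that dIJ by (simp add: IJ(3) flip: mult_mat_assoc)
  have "J * P = J * (I * (J * P))" using dIJ d by (simp add: JIZ)
  also have "\<dots> = 0\<^sub>m r (rep_dim U)" using dIJ d by (simp add: EE EP mat_simps)
  finally have JP: "J * P = 0\<^sub>m r (rep_dim U)" .
  have "Q * I = Q * I * (J * I)" using dIJ d by (simp add: IJ(4) mat_simps)
  also have "\<dots> = Q * E * I" using dIJ d dE by (simp add: mult_mat_assoc flip: IJ(3))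
  also have "\<dots> = 0\<^sub>m (rep_dim U) r" using dIJ by (simp add: QE mat_simps)
  finally have QI: "Q * I = 0\<^sub>m (rep_dim U) r" .
  have sum: "P * Q + I * J = 1\<^sub>m ?d"
    unfolding IJ(3) E_def by (rule eq_matI) (use d in auto)
  have rW: "rep_dim W = r" by (simp add: W_def)
  have bp: "biproduct A V U W" unfolding biproduct_def rW
    using P Q W(2,3) QP IJ(4) JP QI sum by (intro exI[of _ P] exI[of _ I] exI[of _ Q] exI[of _ J]) simp
  moreover have "rep_dim V = rep_dim U + rep_dim W"
    using module_iso_dim[OF biproduct_imp_iso[OF bp wf is_module_wf[OF W(1)]]] by simp
  ultimately show thesis using that W(1) by blast
qed

section \<open>Tensor products and duals\<close>

text \<open>The tensor product as a module over \<open>H \<otimes> H\<close>, before restriction along the comultiplication.\<close>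

definition outer_module :: "('b, 'k::field) rep \<Rightarrow> ('c, 'k) rep \<Rightarrow> ('b \<times> 'c, 'k) rep" where
  "outer_module U V = \<lparr>rep_dim = rep_dim U * rep_dim V,
     rep_act = (\<lambda>(c, d). kronecker (rep_act U c) (rep_act V d))\<rparr>"

lemma outer_dim [simp]: "rep_dim (outer_module U V) = rep_dim U * rep_dim V"
  by (simp add: outer_module_def)

lemma tensor_basis [simp]: "alg_basis (tensor_alg A C) = alg_basis A \<times> alg_basis C"
  by (simp add: tensor_alg_def)

lemma rep_wf_outer: "rep_wf A U \<Longrightarrow> rep_wf C V \<Longrightarrow> rep_wf (tensor_alg A C) (outer_module U V)"
  by (auto simp: rep_wf_def outer_module_def)

lemma act_elem_tens:
  assumes "rep_wf A U" "rep_wf C V"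
  shows "act_elem (tensor_alg A C) (outer_module U V) (tens x y) = kronecker (act_elem A U x) (act_elem C V y)"
proof (rule eq_matI)
  fix i j assume "i < dim_row (kronecker (act_elem A U x) (act_elem C V y))"
    "j < dim_col (kronecker (act_elem A U x) (act_elem C V y))"
  then have ij: "i < rep_dim U * rep_dim V" "j < rep_dim U * rep_dim V" by simp_all
  note lt = div_less_mult[OF ij(1)] div_less_mult[OF ij(2)]
  let ?a = "i div rep_dim V" and ?b = "j div rep_dim V" and ?c = "i mod rep_dim V" and ?d = "j mod rep_dim V"
  have "act_elem (tensor_alg A C) (outer_module U V) (tens x y) $$ (i, j)
      = (\<Sum>p\<in>alg_basis A \<times> alg_basis C. case p of (c, d) \<Rightarrow>
           (x c * rep_act U c $$ (?a, ?b)) * (y d * rep_act V d $$ (?c, ?d)))"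
    unfolding act_elem_def using ij assms
    by (auto simp: tens_def outer_module_def kronecker_def rep_wfD intro!: sum.cong)
  also have "\<dots> = act_elem A U x $$ (?a, ?b) * act_elem C V y $$ (?c, ?d)"
    using lt by (simp add: act_elem_entry sum_product sum.cartesian_product)
  finally show "act_elem (tensor_alg A C) (outer_module U V) (tens x y) $$ (i, j)
      = kronecker (act_elem A U x) (act_elem C V y) $$ (i, j)"
    using ij by (simp add: kronecker_def)
qed simp_all

lemma is_module_outer:
  assumes "is_module A U" "is_module C V"
  shows "is_module (tensor_alg A C) (outer_module U V)"
  unfolding is_module_def
proof (intro conjI ballI)
  note wf = is_module_wf[OF assms(1)] is_module_wf[OF assms(2)]
  fix b assume b: "b \<in> alg_basis (tensor_alg A C)"
  show "rep_act (outer_module U V) b \<in> carrier_mat (rep_dim (outer_module U V)) (rep_dim (outer_module U V))"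
    using rep_wfD[OF rep_wf_outer[OF wf] b] by (simp add: carrier_mat_def)
next
  note wf = is_module_wf[OF assms(1)] is_module_wf[OF assms(2)]
  show "act_elem (tensor_alg A C) (outer_module U V) (alg_unit (tensor_alg A C)) = 1\<^sub>m (rep_dim (outer_module U V))"
    using assms act_elem_tens[OF wf, of "alg_unit A" "alg_unit C"]
    by (simp add: tensor_alg_def is_module_def kronecker_one)
next
  note wf = is_module_wf[OF assms(1)] is_module_wf[OF assms(2)]
  fix p p' assume p: "p \<in> alg_basis (tensor_alg A C)" "p' \<in> alg_basis (tensor_alg A C)"
  obtain a c b d where pp: "p = (a, c)" "p' = (b, d)" by (cases p, cases p')
  have "alg_mul (tensor_alg A C) p p' = tens (alg_mul A a b) (alg_mul C c d)"
    by (simp add: tensor_alg_def tens_def pp fun_eq_iff)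
  moreover have "act_elem A U (alg_mul A a b) = rep_act U a * rep_act U b"
    "act_elem C V (alg_mul C c d) = rep_act V c * rep_act V d"
    using assms p by (simp_all add: is_module_def pp)
  ultimately show "act_elem (tensor_alg A C) (outer_module U V) (alg_mul (tensor_alg A C) p p')
      = rep_act (outer_module U V) p * rep_act (outer_module U V) p'"
    using p wf by (simp add: act_elem_tens) (simp add: outer_module_def pp kronecker_mult rep_wfD)
qed

lemma tensor_dim [simp]: "rep_dim (tensor_module H U V) = rep_dim U * rep_dim V"
  by (simp add: tensor_module_def)

text \<open>Restriction of the outer module along the comultiplication. As the outer module is a
  module over the tensor algebra, a product or power in \<open>hopf_comul\<close> can be evaluated
  as a product of matrices without knowing its coefficients.\<close>

lemma tensor_act:
  "rep_act (tensor_module H U V) b = act_elem (tensor_alg H H) (outer_module U V) (hopf_comul H b)"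
  if "rep_wf H U" "rep_wf H V"
proof (rule eq_matI)
  fix i j assume "i < dim_row (act_elem (tensor_alg H H) (outer_module U V) (hopf_comul H b))"
    "j < dim_col (act_elem (tensor_alg H H) (outer_module U V) (hopf_comul H b))"
  then show "rep_act (tensor_module H U V) b $$ (i, j)
      = act_elem (tensor_alg H H) (outer_module U V) (hopf_comul H b) $$ (i, j)"
    by (simp add: tensor_module_def act_elem_entry outer_module_def sum.cartesian_product case_prod_unfold)
qed (simp_all add: tensor_module_def)

lemma rep_wf_tensor: "rep_wf H (tensor_module H U V)"
  by (simp add: rep_wf_def tensor_module_def)

lemma hom_mat_tensor:
  assumes wf: "rep_wf H U" "rep_wf H V" "rep_wf H U'" "rep_wf H V'"
    and P: "hom_mat H U U' P" and Q: "hom_mat H V V' Q"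
  shows "hom_mat H (tensor_module H U V) (tensor_module H U' V') (kronecker P Q)"
proof -
  note d = hom_matD(1,2)[OF P] hom_matD(1,2)[OF Q]
  have "hom_mat (tensor_alg H H) (outer_module U V) (outer_module U' V') (kronecker P Q)"
    unfolding hom_mat_def
  proof (intro conjI ballI)
    fix p assume p: "p \<in> alg_basis (tensor_alg H H)"
    then show "kronecker P Q * rep_act (outer_module U V) p = rep_act (outer_module U' V') p * kronecker P Q"
      using d wf by (cases p) (simp add: outer_module_def kronecker_mult rep_wfD hom_matD(3)[OF P] hom_matD(3)[OF Q])
  qed (use d in simp_all)
  note hom_mat_act_elem[OF this rep_wf_outer[OF wf(1,2)] rep_wf_outer[OF wf(3,4)]]
  then show ?thesis using d wf by (simp add: hom_mat_def tensor_act)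
qed

lemma tensor_iso:
  assumes wf: "rep_wf H U" "rep_wf H V" "rep_wf H U'" "rep_wf H V'"
    and iso: "module_iso H U U'" "module_iso H V V'"
  shows "module_iso H (tensor_module H U V) (tensor_module H U' V')"
proof -
  obtain P Q where P: "hom_mat H U U' P" "hom_mat H U' U Q" "P * Q = 1\<^sub>m (rep_dim U')" "Q * P = 1\<^sub>m (rep_dim U)"
    using module_isoE[OF iso(1) wf(1,3)] .
  obtain P' Q' where P': "hom_mat H V V' P'" "hom_mat H V' V Q'" "P' * Q' = 1\<^sub>m (rep_dim V')" "Q' * P' = 1\<^sub>m (rep_dim V)"
    using module_isoE[OF iso(2) wf(2,4)] .
  note d = hom_matD(1,2)[OF P(1)] hom_matD(1,2)[OF P(2)] hom_matD(1,2)[OF P'(1)] hom_matD(1,2)[OF P'(2)]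
  show ?thesis
    by (rule module_isoI[OF hom_mat_tensor[OF wf P(1) P'(1)], of "kronecker Q Q'"])
      (use d in \<open>simp_all add: kronecker_mult P P' kronecker_one\<close>)
qed

text \<open>Each of the four structure maps is tensored with the identity of \<open>W\<close>, on
  the right or on the left.\<close>

lemma biproduct_tensor:
  assumes wf: "rep_wf H W" "rep_wf H X" "rep_wf H U" "rep_wf H V" and bp: "biproduct H X U V"
  shows "biproduct H (tensor_module H X W) (tensor_module H U W) (tensor_module H V W)"
    and "biproduct H (tensor_module H W X) (tensor_module H W U) (tensor_module H W V)"
proof -
  obtain i1 i2 p1 p2 where h: "hom_mat H U X i1" "hom_mat H V X i2" "hom_mat H X U p1" "hom_mat H X V p2"
    and e: "p1 * i1 = 1\<^sub>m (rep_dim U)" "p2 * i2 = 1\<^sub>m (rep_dim V)"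
     "p1 * i2 = 0\<^sub>m (rep_dim U) (rep_dim V)" "p2 * i1 = 0\<^sub>m (rep_dim V) (rep_dim U)"
     "i1 * p1 + i2 * p2 = 1\<^sub>m (rep_dim X)"
    using bp by (auto simp: biproduct_def)
  note d = hom_matD(1,2)[OF h(1)] hom_matD(1,2)[OF h(2)] hom_matD(1,2)[OF h(3)] hom_matD(1,2)[OF h(4)]
  let ?w = "1\<^sub>m (rep_dim W)"
  note o = hom_mat_one[OF wf(1)]
  note hl = hom_mat_tensor[OF wf(3,1,2,1) h(1) o] hom_mat_tensor[OF wf(4,1,2,1) h(2) o]
    hom_mat_tensor[OF wf(2,1,3,1) h(3) o] hom_mat_tensor[OF wf(2,1,4,1) h(4) o]
  note hr = hom_mat_tensor[OF wf(1,3,1,2) o h(1)] hom_mat_tensor[OF wf(1,4,1,2) o h(2)]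
    hom_mat_tensor[OF wf(1,2,1,3) o h(3)] hom_mat_tensor[OF wf(1,2,1,4) o h(4)]
  have "kronecker i1 ?w * kronecker p1 ?w + kronecker i2 ?w * kronecker p2 ?w = 1\<^sub>m (rep_dim X * rep_dim W)"
    using d by (simp add: kronecker_mult e kronecker_one mat_simps flip: kronecker_add_left)
  then show "biproduct H (tensor_module H X W) (tensor_module H U W) (tensor_module H V W)"
    unfolding biproduct_def using hl d
    by (intro exI[of _ "kronecker i1 ?w"] exI[of _ "kronecker i2 ?w"] exI[of _ "kronecker p1 ?w"] exI[of _ "kronecker p2 ?w"])
      (simp add: kronecker_mult e kronecker_one kronecker_zero_left mat_simps)
  have "kronecker ?w i1 * kronecker ?w p1 + kronecker ?w i2 * kronecker ?w p2 = 1\<^sub>m (rep_dim W * rep_dim X)"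
    using d by (simp add: kronecker_mult e kronecker_one mat_simps flip: kronecker_add_right)
  then show "biproduct H (tensor_module H W X) (tensor_module H W U) (tensor_module H W V)"
    unfolding biproduct_def using hr d
    by (intro exI[of _ "kronecker ?w i1"] exI[of _ "kronecker ?w i2"] exI[of _ "kronecker ?w p1"] exI[of _ "kronecker ?w p2"])
      (simp add: kronecker_mult e kronecker_one kronecker_zero_right mat_simps)
qed

lemma dual_dim [simp]: "rep_dim (dual_module H V) = rep_dim V"
  by (simp add: dual_module_def)

lemma rep_wf_dual: "rep_wf H (dual_module H V)"
  by (simp add: rep_wf_def dual_module_def)

lemma hom_mat_dual:
  assumes wf: "rep_wf H U" "rep_wf H V" and P: "hom_mat H U V P"
  shows "hom_mat H (dual_module H V) (dual_module H U) (transpose_mat P)"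
  unfolding hom_mat_def
proof (intro conjI ballI)
  fix b
  note d = hom_matD(1,2)[OF P]
  have "transpose_mat P * transpose_mat (act_elem H V (hopf_antipode H b)) = transpose_mat (act_elem H V (hopf_antipode H b) * P)"
    using d by (simp add: transpose_mult_dim)
  also have "\<dots> = transpose_mat (P * act_elem H U (hopf_antipode H b))"
    by (simp only: hom_mat_act_elem[OF P wf])
  also have "\<dots> = transpose_mat (act_elem H U (hopf_antipode H b)) * transpose_mat P"
    using d by (simp add: transpose_mult_dim)
  finally show "transpose_mat P * rep_act (dual_module H V) b = rep_act (dual_module H U) b * transpose_mat P"
    by (simp add: dual_module_def)
qed (use hom_matD[OF P] in simp_all)

lemma dual_iso:
  assumes wf: "rep_wf H U" "rep_wf H V" and iso: "module_iso H U V"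
  shows "module_iso H (dual_module H U) (dual_module H V)"
proof -
  obtain P Q where P: "hom_mat H U V P" "hom_mat H V U Q" "P * Q = 1\<^sub>m (rep_dim V)" "Q * P = 1\<^sub>m (rep_dim U)"
    using module_isoE[OF iso wf] .
  note d = hom_matD(1,2)[OF P(1)] hom_matD(1,2)[OF P(2)]
  show ?thesis
    by (rule module_isoI[OF hom_mat_dual[OF wf(2,1) P(2)], of "transpose_mat P"])
      (use d in \<open>simp_all add: P flip: transpose_mult_dim\<close>)
qed

lemma biproduct_dual:
  assumes wf: "rep_wf H X" "rep_wf H U" "rep_wf H V" and bp: "biproduct H X U V"
  shows "biproduct H (dual_module H X) (dual_module H U) (dual_module H V)"
proof -
  obtain i1 i2 p1 p2 where h: "hom_mat H U X i1" "hom_mat H V X i2" "hom_mat H X U p1" "hom_mat H X V p2"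
    and e: "p1 * i1 = 1\<^sub>m (rep_dim U)" "p2 * i2 = 1\<^sub>m (rep_dim V)"
     "p1 * i2 = 0\<^sub>m (rep_dim U) (rep_dim V)" "p2 * i1 = 0\<^sub>m (rep_dim V) (rep_dim U)"
     "i1 * p1 + i2 * p2 = 1\<^sub>m (rep_dim X)"
    using bp by (auto simp: biproduct_def)
  note d = hom_matD(1,2)[OF h(1)] hom_matD(1,2)[OF h(2)] hom_matD(1,2)[OF h(3)] hom_matD(1,2)[OF h(4)]
  have "transpose_mat (i1 * p1) + transpose_mat (i2 * p2) = transpose_mat (i1 * p1 + i2 * p2)"
    by (rule eq_matI) (use d in auto)
  then have "transpose_mat p1 * transpose_mat i1 + transpose_mat p2 * transpose_mat i2 = 1\<^sub>m (rep_dim X)"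
    using d by (simp add: e transpose_mult_dim)
  then show ?thesis
    unfolding biproduct_def using hom_mat_dual[OF wf(1,2) h(3)] hom_mat_dual[OF wf(1,3) h(4)]
      hom_mat_dual[OF wf(2,1) h(1)] hom_mat_dual[OF wf(3,1) h(2)] d
    by (intro exI[of _ "transpose_mat p1"] exI[of _ "transpose_mat p2"] exI[of _ "transpose_mat i1"]
        exI[of _ "transpose_mat i2"]) (simp add: e flip: transpose_mult_dim)
qed

section \<open>Gaussian binomial coefficients\<close>

fun gbinom :: "'a::comm_ring_1 \<Rightarrow> nat \<Rightarrow> nat \<Rightarrow> 'a" where
  "gbinom q m 0 = 1"
| "gbinom q 0 (Suc k) = 0"
| "gbinom q (Suc m) (Suc k) = gbinom q m k + q ^ Suc k * gbinom q m (Suc k)"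

text \<open>The q-factorial of \<open>m\<close> times \<open>(1 - q) ^ m\<close>; this form avoids
  every division, also at roots of unity.\<close>

definition gfact :: "'a::comm_ring_1 \<Rightarrow> nat \<Rightarrow> 'a" where
  "gfact q m = (\<Prod>i\<in>{1..m}. 1 - q ^ i)"

lemma gfact_Suc: "gfact q (Suc m) = gfact q m * (1 - q ^ Suc m)"
  by (simp add: gfact_def)

lemma gbinom_eq_0: "m < k \<Longrightarrow> gbinom q m k = 0"
  by (induction q m k rule: gbinom.induct) auto

text \<open>The quotient formula for Gaussian binomials with denominators cleared. Its use is at a
  primitive root of unity, where the right side can vanish while the factorials on the left do
  not.\<close>

lemma gbinom_gfact: "k \<le> m \<Longrightarrow> gfact q k * gfact q (m - k) * gbinom q m k = gfact q m"
proof (induction m arbitrary: k)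
  case 0
  then show ?case by (simp add: gfact_def)
next
  case (Suc m)
  show ?case
  proof (cases k)
    case 0
    then show ?thesis by (simp add: gfact_def)
  next
    case (Suc j)
    show ?thesis
    proof (cases "j = m")
      case True
      then have "gfact q m * gbinom q m m = gfact q m" using Suc.IH[of m] by (simp add: gfact_def)
      then have "gfact q m * (1 - q ^ Suc m) * gbinom q m m = gfact q m * (1 - q ^ Suc m)"
        by (metis mult.assoc mult.commute)
      then show ?thesis using True Suc by (simp add: gfact_Suc gbinom_eq_0) (simp add: gfact_def)
    next
      case False
      then obtain b where b: "m = j + Suc b" using Suc Suc.prems less_imp_Suc_add[of j m] by auto
      have 1: "gfact q j * gfact q (Suc b) * gbinom q m j = gfact q m"
        using Suc.IH[of j] b by simp
      have 2: "gfact q (Suc j) * gfact q b * gbinom q m (Suc j) = gfact q m"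
        using Suc.IH[of "Suc j"] b by simp
      have "gfact q (Suc j) * gfact q (Suc b) * gbinom q (Suc m) (Suc j)
          = (1 - q ^ Suc j) * (gfact q j * gfact q (Suc b) * gbinom q m j)
          + q ^ Suc j * (1 - q ^ Suc b) * (gfact q (Suc j) * gfact q b * gbinom q m (Suc j))"
        by (simp add: gfact_Suc) (simp add: algebra_simps)
      \<comment> \<open>With \<open>a = j + 1\<close> and \<open>c = b + 1\<close> this is
        \<open>(1 - q^a) + q^a * (1 - q^c) = 1 - q^(a + c)\<close>, and
        \<open>a + c = Suc m\<close>.\<close>
      also have "\<dots> = gfact q m * (1 - q ^ Suc m)"
        unfolding 1 2 by (simp add: b algebra_simps power_add)
      finally show ?thesis using b Suc by (simp add: gfact_Suc)
    qed
  qed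
qed

section \<open>Matrices that commute up to a factor q\<close>

lemma q_commute_pow:
  fixes X Y :: "'a::comm_ring_1 mat"
  assumes "dim_row X = d" "dim_col X = d" "dim_row Y = d" "dim_col Y = d" "X * Y = q \<cdot>\<^sub>m (Y * X)"
  shows "X * Y ^\<^sub>m k = q ^ k \<cdot>\<^sub>m (Y ^\<^sub>m k * X)"
    and "X ^\<^sub>m j * Y ^\<^sub>m k = q ^ (j * k) \<cdot>\<^sub>m (Y ^\<^sub>m k * X ^\<^sub>m j)"
proof -
  show 1: "X * Y ^\<^sub>m k = q ^ k \<cdot>\<^sub>m (Y ^\<^sub>m k * X)" for k
  proof (induction k)
    case (Suc k)
    have "X * Y ^\<^sub>m Suc k = (X * Y ^\<^sub>m k) * Y" using assms by (simp add: mult_mat_assoc)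
    also have "\<dots> = q ^ k \<cdot>\<^sub>m (Y ^\<^sub>m k * (X * Y))" using assms Suc by (simp add: mult_mat_smult_left mult_mat_assoc)
    also have "\<dots> = q ^ Suc k \<cdot>\<^sub>m (Y ^\<^sub>m Suc k * X)"
      unfolding assms(5) using assms(1-4) by (simp add: mult_mat_smult_right smult_mat_smult mult_mat_assoc mult.commute)
    finally show ?case .
  qed (use assms in \<open>simp add: mat_simps smult_mat_one\<close>)
  show "X ^\<^sub>m j * Y ^\<^sub>m k = q ^ (j * k) \<cdot>\<^sub>m (Y ^\<^sub>m k * X ^\<^sub>m j)"
  proof (induction j)
    case (Suc j)
    have "X ^\<^sub>m Suc j * Y ^\<^sub>m k = X ^\<^sub>m j * (X * Y ^\<^sub>m k)" using assms by (simp add: mult_mat_assoc)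
    also have "\<dots> = q ^ k \<cdot>\<^sub>m ((X ^\<^sub>m j * Y ^\<^sub>m k) * X)"
      unfolding 1 using assms by (simp add: mult_mat_smult_right mult_mat_assoc)
    also have "\<dots> = q ^ (Suc j * k) \<cdot>\<^sub>m (Y ^\<^sub>m k * X ^\<^sub>m Suc j)"
      unfolding Suc using assms by (simp add: mult_mat_smult_left smult_mat_smult mult_mat_assoc power_add)
    finally show ?case .
  qed (use assms in \<open>simp add: mat_simps smult_mat_one\<close>)
qed

text \<open>Multiplying by \<open>X + Y\<close> from the left, \<open>X\<close> passes
  \<open>Y ^ k\<close> at the cost of \<open>q ^ k\<close>, which is the factor in the recursion of
  \<open>gbinom\<close>. The identity is stated on entries because matrices of varying sizes share
  no zero from which a sum could start.\<close>

lemma gbinomial_theorem_mat: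
  fixes X Y :: "'a::comm_ring_1 mat"
  assumes d: "dim_row X = d" "dim_col X = d" "dim_row Y = d" "dim_col Y = d" and XY: "X * Y = q \<cdot>\<^sub>m (Y * X)"
  shows "i < d \<Longrightarrow> j < d \<Longrightarrow>
    ((X + Y) ^\<^sub>m m) $$ (i, j) = (\<Sum>k\<le>m. gbinom q m k * (Y ^\<^sub>m k * X ^\<^sub>m (m - k)) $$ (i, j))"
proof (induction m arbitrary: i j)
  case 0
  then show ?case using d by (simp add: mat_simps)
next
  case (Suc m)
  let ?M = "\<lambda>k. Y ^\<^sub>m k * X ^\<^sub>m (m - k)"
  have e: "(X + Y) * ?M k = q ^ k \<cdot>\<^sub>m (Y ^\<^sub>m k * X ^\<^sub>m (Suc m - k)) + Y ^\<^sub>m Suc k * X ^\<^sub>m (m - k)"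
    if "k \<le> m" for k
  proof -
    have "X * ?M k = (X * Y ^\<^sub>m k) * X ^\<^sub>m (m - k)" using d by (simp add: mult_mat_assoc)
    also have "\<dots> = q ^ k \<cdot>\<^sub>m (Y ^\<^sub>m k * (X * X ^\<^sub>m (m - k)))"
      unfolding q_commute_pow(1)[OF d XY] using d by (simp add: mult_mat_smult_left mult_mat_assoc)
    also have "X * X ^\<^sub>m (m - k) = X ^\<^sub>m (Suc m - k)"
      using d that pow_mat_Suc_left[of X "m - k"] by (simp add: Suc_diff_le)
    finally have 1: "X * ?M k = q ^ k \<cdot>\<^sub>m (Y ^\<^sub>m k * X ^\<^sub>m (Suc m - k))" .
    have 2: "Y * ?M k = Y ^\<^sub>m Suc k * X ^\<^sub>m (m - k)"
      using d pow_mat_Suc_left[of Y k] by (simp add: mult_mat_assoc)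
    have "(X + Y) * ?M k = X * ?M k + Y * ?M k" using d by (intro mult_mat_add_left) simp_all
    then show ?thesis by (simp only: 1 2)
  qed
  have "((X + Y) ^\<^sub>m Suc m) $$ (i, j) = (\<Sum>t<d. (X + Y) $$ (i, t) * ((X + Y) ^\<^sub>m m) $$ (t, j))"
    using d Suc.prems pow_mat_Suc_left[of "X + Y" m] by (simp add: mult_mat_entry del: index_mult_mat(1))
  also have "\<dots> = (\<Sum>t<d. \<Sum>k\<le>m. gbinom q m k * ((X + Y) $$ (i, t) * ?M k $$ (t, j)))"
    using Suc.prems by (intro sum.cong refl) (simp add: Suc.IH sum_distrib_left mult.left_commute del: index_mult_mat(1) index_add_mat(1))
  also have "\<dots> = (\<Sum>k\<le>m. gbinom q m k * (\<Sum>t<d. (X + Y) $$ (i, t) * ?M k $$ (t, j)))"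
    by (subst sum.swap) (simp add: sum_distrib_left)
  also have "\<dots> = (\<Sum>k\<le>m. gbinom q m k * ((X + Y) * ?M k) $$ (i, j))"
    using d Suc.prems by (intro sum.cong refl) (simp add: mult_mat_entry[of i "X + Y"] del: index_mult_mat(1) index_add_mat(1))
  also have "\<dots> = (\<Sum>k\<le>m. q ^ k * gbinom q m k * (Y ^\<^sub>m k * X ^\<^sub>m (Suc m - k)) $$ (i, j)
      + gbinom q m k * (Y ^\<^sub>m Suc k * X ^\<^sub>m (m - k)) $$ (i, j))"
    using d Suc.prems by (intro sum.cong refl) (simp add: e distrib_left mult_ac del: index_mult_mat(1) pow_mat.simps)
  also have "\<dots> = (\<Sum>k\<le>m. q ^ k * gbinom q m k * (Y ^\<^sub>m k * X ^\<^sub>m (Suc m - k)) $$ (i, j))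
      + (\<Sum>k\<le>m. gbinom q m k * (Y ^\<^sub>m Suc k * X ^\<^sub>m (Suc m - Suc k)) $$ (i, j))"
    by (simp add: sum.distrib del: index_mult_mat(1) pow_mat.simps)
  \<comment> \<open>The term \<open>k = Suc m\<close> is added with coefficient zero, so that
    splitting off \<open>k = 0\<close> leaves the same range as in the other sum.\<close>
  also have "(\<Sum>k\<le>m. q ^ k * gbinom q m k * (Y ^\<^sub>m k * X ^\<^sub>m (Suc m - k)) $$ (i, j))
      = (\<Sum>k\<le>Suc m. q ^ k * gbinom q m k * (Y ^\<^sub>m k * X ^\<^sub>m (Suc m - k)) $$ (i, j))"
    by (simp add: gbinom_eq_0)
  also have "\<dots> = (Y ^\<^sub>m 0 * X ^\<^sub>m Suc m) $$ (i, j)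
      + (\<Sum>k\<le>m. q ^ Suc k * gbinom q m (Suc k) * (Y ^\<^sub>m Suc k * X ^\<^sub>m (Suc m - Suc k)) $$ (i, j))"
    by (subst sum.atMost_Suc_shift) (simp del: index_mult_mat(1) pow_mat.simps)
  also have "\<dots> + (\<Sum>k\<le>m. gbinom q m k * (Y ^\<^sub>m Suc k * X ^\<^sub>m (Suc m - Suc k)) $$ (i, j))
      = (Y ^\<^sub>m 0 * X ^\<^sub>m Suc m) $$ (i, j)
      + (\<Sum>k\<le>m. gbinom q (Suc m) (Suc k) * (Y ^\<^sub>m Suc k * X ^\<^sub>m (Suc m - Suc k)) $$ (i, j))"
    by (simp add: sum.distrib[symmetric] distrib_right add_ac del: index_mult_mat(1) pow_mat.simps)
  also have "\<dots> = (\<Sum>k\<le>Suc m. gbinom q (Suc m) k * (Y ^\<^sub>m k * X ^\<^sub>m (Suc m - k)) $$ (i, j))"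
    by (subst sum.atMost_Suc_shift) (simp del: index_mult_mat(1) pow_mat.simps)
  finally show ?case .
qed

section \<open>Modules over the Taft algebra\<close>

lemma smult_mat_add:
  fixes A B :: "'a::semiring_0 mat"
  shows "dim_row A = dim_row B \<Longrightarrow> dim_col A = dim_col B \<Longrightarrow> c \<cdot>\<^sub>m (A + B) = c \<cdot>\<^sub>m A + c \<cdot>\<^sub>m B"
  by (rule eq_matI) (simp_all add: distrib_left)

lemma one_pow_mat: "1\<^sub>m d ^\<^sub>m k = (1\<^sub>m d :: 'a::semiring_1 mat)"
  by (induction k) (simp_all add: mat_simps)

lemma pow_mat_mult:
  fixes A :: "'a::semiring_1 mat"
  assumes "dim_col A = dim_row A" shows "(A ^\<^sub>m a) ^\<^sub>m b = A ^\<^sub>m (a * b)"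
  by (induction b) (use assms in \<open>simp_all add: mult_mat_assoc flip: pow_mat_add\<close>, simp add: add.commute)

definition gact :: "(nat \<times> nat, 'k) rep \<Rightarrow> 'k mat" where "gact V = rep_act V (1, 0)"
definition hact :: "(nat \<times> nat, 'k) rep \<Rightarrow> 'k mat" where "hact V = rep_act V (0, 1)"

definition pair_module :: "nat \<Rightarrow> 'k::field mat \<Rightarrow> 'k mat \<Rightarrow> (nat \<times> nat, 'k) rep" where
  "pair_module d G H = \<lparr>rep_dim = d, rep_act = (\<lambda>(i, j). G ^\<^sub>m i * H ^\<^sub>m j)\<rparr>"

lemma act_elem_smult: "act_elem A V (\<lambda>b. c * x b) = c \<cdot>\<^sub>m act_elem A V x"
  by (rule eq_matI) (simp_all add: act_elem_def sum_distrib_left mult.assoc)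

lemma act_elem_zero: "act_elem A V (\<lambda>_. 0) = 0\<^sub>m (rep_dim V) (rep_dim V)"
  by (rule eq_matI) (simp_all add: act_elem_def)

locale taft_param =
  fixes n :: nat and q :: "'k::field"
  assumes n2: "2 \<le> n" and qn: "q ^ n = 1" and prim: "\<And>k. 0 < k \<Longrightarrow> k < n \<Longrightarrow> q ^ k \<noteq> 1"
begin

abbreviation K where "K \<equiv> taft n q"

lemma q_nonzero: "q \<noteq> 0"
  using qn n2 by (auto simp: power_0_left)

lemma basis_K: "alg_basis K = {..<n} \<times> {..<n}"
  by (simp add: taft_def alg.defs taft_alg_def)

lemma fin_K: "finite (alg_basis K)"
  by (simp add: basis_K)

lemma unit_K': "alg_unit (taft_alg n q) = alg_unit K"
  by (simp add: taft_def alg.defs taft_alg_def)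

lemma amul_K: "amul (taft_alg n q) = amul K"
  by (simp add: amul_def taft_def alg.defs fun_eq_iff)

lemma unit_K: "alg_unit K = bvec (0, 0)"
  by (simp add: taft_def alg.defs taft_alg_def)

lemma apow_K: "apow (taft_alg n q) x k = apow K x k"
  by (induction k) (simp_all add: amul_K unit_K, simp add: taft_alg_def)

lemma tensor_K: "tensor_alg (taft_alg n q) (taft_alg n q) = tensor_alg K K"
  by (simp add: tensor_alg_def taft_def alg.defs)

text \<open>\<open>gfact q n\<close> contains the factor \<open>1 - q ^ n = 0\<close>, but no factor
  of \<open>gfact q k\<close> or \<open>gfact q (n - k)\<close> vanishes, as \<open>q\<close> is
  primitive.\<close>

lemma gbinom_vanish: "0 < k \<Longrightarrow> k < n \<Longrightarrow> gbinom q n k = 0"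
proof -
  assume k: "0 < k" "k < n"
  have nz: "gfact q m \<noteq> 0" if "m < n" for m
    using prim that by (auto simp: gfact_def prod_zero_iff)
  have "gfact q n = 0" using n2 qn by (auto simp: gfact_def prod_zero_iff intro!: bexI[of _ n])
  then have "gfact q k * gfact q (n - k) * gbinom q n k = 0" using gbinom_gfact[of k n q] k by simp
  then show ?thesis using nz[of k] nz[of "n - k"] k by simp
qed

text \<open>Only \<open>X ^ n\<close> and \<open>Y ^ n\<close> survive in the expansion, and both
  are zero. This is why the relation for \<open>h\<close> passes to tensor products.\<close>

lemma q_binomial:
  fixes X Y :: "'k mat"
  assumes d: "dim_row X = d" "dim_col X = d" "dim_row Y = d" "dim_col Y = d" and XY: "X * Y = q \<cdot>\<^sub>m (Y * X)"
    and 0: "X ^\<^sub>m n = 0\<^sub>m d d" "Y ^\<^sub>m n = 0\<^sub>m d d"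
  shows "(X + Y) ^\<^sub>m n = 0\<^sub>m d d"
proof (rule eq_matI)
  fix i j assume "i < dim_row (0\<^sub>m d d :: 'k mat)" "j < dim_col (0\<^sub>m d d :: 'k mat)"
  then have ij: "i < d" "j < d" by simp_all
  have "((X + Y) ^\<^sub>m n) $$ (i, j) = (\<Sum>k\<le>n. gbinom q n k * (Y ^\<^sub>m k * X ^\<^sub>m (n - k)) $$ (i, j))"
    by (rule gbinomial_theorem_mat[OF d XY ij])
  also have "\<dots> = 0"
  proof (rule sum.neutral, rule ballI)
    fix k assume "k \<in> {..n}"
    then consider "k = 0" | "k = n" | "0 < k" "k < n" by fastforce
    then show "gbinom q n k * (Y ^\<^sub>m k * X ^\<^sub>m (n - k)) $$ (i, j) = 0"
    proof cases
      case 1 then show ?thesis using d ij by (simp add: 0 mult_mat_zero_right del: index_mult_mat(1))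
    next
      case 2 then show ?thesis using d ij by (simp add: 0 mult_mat_zero_left del: index_mult_mat(1))
    next
      case 3 then show ?thesis by (simp add: gbinom_vanish)
    qed
  qed
  finally show "((X + Y) ^\<^sub>m n) $$ (i, j) = 0\<^sub>m d d $$ (i, j)" using ij by simp
qed (use d in simp_all)

section \<open>Modules as pairs of matrices satisfying the Taft relations\<close>

definition taft_pair :: "nat \<Rightarrow> 'k mat \<Rightarrow> 'k mat \<Rightarrow> bool" where
  "taft_pair d G H \<longleftrightarrow> dim_row G = d \<and> dim_col G = d \<and> dim_row H = d \<and> dim_col H = d \<and>
     G ^\<^sub>m n = 1\<^sub>m d \<and> H ^\<^sub>m n = 0\<^sub>m d d \<and> H * G = q \<cdot>\<^sub>m (G * H)"

lemma taft_pairD: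
  assumes "taft_pair d G H"
  shows "dim_row G = d" "dim_col G = d" "dim_row H = d" "dim_col H = d"
    "G ^\<^sub>m n = 1\<^sub>m d" "H ^\<^sub>m n = 0\<^sub>m d d" "H * G = q \<cdot>\<^sub>m (G * H)"
  using assms by (simp_all add: taft_pair_def)

lemma gact_act_elem: "rep_wf K V \<Longrightarrow> act_elem K V (bvec (1, 0)) = gact V"
  and hact_act_elem: "rep_wf K V \<Longrightarrow> act_elem K V (bvec (0, 1)) = hact V"
  using n2 by (auto simp: gact_def hact_def basis_K fin_K intro!: act_elem_bvec)

lemma module_pair:
  assumes V: "is_module K V"
  shows "taft_pair (rep_dim V) (gact V) (hact V)"
    and "i < n \<Longrightarrow> j < n \<Longrightarrow> rep_act V (i, j) = gact V ^\<^sub>m i * hact V ^\<^sub>m j"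
proof -
  note wf = is_module_wf[OF V]
  note ga = gact_act_elem[OF wf] and ha = hact_act_elem[OF wf]
  note pw = module_act_apow[OF V fin_K] and mu = module_act_amul[OF V fin_K]
  have d: "dim_row (gact V) = rep_dim V" "dim_col (gact V) = rep_dim V"
    "dim_row (hact V) = rep_dim V" "dim_col (hact V) = rep_dim V"
    unfolding gact_def hact_def using n2 by (auto intro!: rep_wfD[OF wf] simp: basis_K)
  have gn: "gact V ^\<^sub>m n = 1\<^sub>m (rep_dim V)"
  proof -
    have "gact V ^\<^sub>m n = act_elem K V (apow K (bvec (1, 0)) n)" by (simp only: pw ga)
    also have "apow K (bvec (1, 0)) n = alg_unit K"
      using taft_relations(1)[OF n2, of q] by (simp only: apow_K unit_K')
    finally show ?thesis using V by (simp add: is_module_def)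
  qed
  have hn: "hact V ^\<^sub>m n = 0\<^sub>m (rep_dim V) (rep_dim V)"
  proof -
    have "hact V ^\<^sub>m n = act_elem K V (apow K (bvec (0, 1)) n)" by (simp only: pw ha)
    also have "apow K (bvec (0, 1)) n = (\<lambda>_. 0)"
      using taft_relations(2)[OF n2, of q] by (simp only: apow_K)
    finally show ?thesis by (simp only: act_elem_zero)
  qed
  have "hact V * gact V = act_elem K V (amul K (bvec (0, 1)) (bvec (1, 0)))"
    unfolding mu ga ha ..
  also have "\<dots> = act_elem K V (\<lambda>c. q * amul K (bvec (1, 0)) (bvec (0, 1)) c)"
    using taft_relations(3)[OF n2, of q] by (simp only: amul_K)
  also have "\<dots> = q \<cdot>\<^sub>m (gact V * hact V)"
    unfolding act_elem_smult mu ga ha ..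
  finally have "hact V * gact V = q \<cdot>\<^sub>m (gact V * hact V)" .
  then show "taft_pair (rep_dim V) (gact V) (hact V)" using d gn hn by (simp add: taft_pair_def)
  assume ij: "i < n" "j < n"
  have "rep_act V (i, j) = act_elem K V (bvec (i, j))"
    using ij by (intro act_elem_bvec[symmetric] fin_K wf) (simp add: basis_K)
  also have "\<dots> = act_elem K V (amul K (apow K (bvec (1, 0)) i) (apow K (bvec (0, 1)) j))"
    using taft_relations(4)[OF n2 ij, of q] by (simp only: amul_K apow_K)
  also have "\<dots> = gact V ^\<^sub>m i * hact V ^\<^sub>m j"
    by (simp only: mu pw ga ha)
  finally show "rep_act V (i, j) = gact V ^\<^sub>m i * hact V ^\<^sub>m j" .
qed

lemma pow_mod_pair: "taft_pair d G H \<Longrightarrow> G ^\<^sub>m (k mod n) = G ^\<^sub>m k"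
proof -
  assume p: "taft_pair d G H"
  note d = taft_pairD[OF p]
  have 1: "G ^\<^sub>m (n * j) = 1\<^sub>m d" for j
    by (induction j) (use d in \<open>simp_all add: pow_mat_add mat_simps\<close>)
  have "G ^\<^sub>m k = G ^\<^sub>m (n * (k div n) + k mod n)" by simp
  also have "\<dots> = G ^\<^sub>m (k mod n)" using d by (simp only: pow_mat_add 1) (simp add: mat_simps)
  finally show ?thesis ..
qed

text \<open>The converse of \<open>module_pair\<close>, through which all concrete modules below are
  recognized. The relations reorder \<open>H ^ j * G ^ k\<close> with the factor
  \<open>q ^ (j * k)\<close>, reduce powers of \<open>G\<close> modulo \<open>n\<close> and kill
  powers of \<open>H\<close> from \<open>n\<close> on, just as the structure constants of
  \<open>taft_alg\<close> prescribe.\<close>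

lemma pair_is_module:
  assumes p: "taft_pair (rep_dim V) G H"
    and act: "\<And>i j. i < n \<Longrightarrow> j < n \<Longrightarrow> rep_act V (i, j) = G ^\<^sub>m i * H ^\<^sub>m j"
  shows "is_module K V" and "gact V = G" and "hact V = H"
proof -
  note d = taft_pairD[OF p]
  have wf: "rep_wf K V" using d by (auto simp: rep_wf_def basis_K act)
  show g: "gact V = G" and h: "hact V = H"
    using d n2 by (simp_all add: gact_def hact_def act mat_simps)
  note bv = act_elem_bvec[OF fin_K _ wf]
  show "is_module K V" unfolding is_module_def
  proof (intro conjI ballI)
    fix b assume b: "b \<in> alg_basis K"
    show "rep_act V b \<in> carrier_mat (rep_dim V) (rep_dim V)"
      using rep_wfD[OF wf b] by (simp add: carrier_mat_def)
  next
    show "act_elem K V (alg_unit K) = 1\<^sub>m (rep_dim V)"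
      unfolding unit_K using n2 d by (subst bv) (simp_all add: basis_K act mat_simps)
  next
    fix a b assume a: "a \<in> alg_basis K" and b: "b \<in> alg_basis K"
    obtain i j k l where ab: "a = (i, j)" "b = (k, l)" by (cases a, cases b)
    have lt: "i < n" "j < n" "k < n" "l < n" using a b by (auto simp: basis_K ab)
    have "rep_act V a * rep_act V b = G ^\<^sub>m i * ((H ^\<^sub>m j * G ^\<^sub>m k) * H ^\<^sub>m l)"
      using d lt by (simp add: ab act mult_mat_assoc)
    also have "\<dots> = q ^ (j * k) \<cdot>\<^sub>m (G ^\<^sub>m (i + k) * H ^\<^sub>m (j + l))"
      unfolding q_commute_pow(2)[OF d(3,4,1,2,7)] using d
      by (simp add: mult_mat_smult_left mult_mat_smult_right mult_mat_assoc pow_mat_add)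
    also have "\<dots> = act_elem K V (alg_mul K a b)"
    proof (cases "j + l < n")
      case True
      then have "alg_mul K a b = (\<lambda>c. q ^ (j * k) * bvec ((i + k) mod n, j + l) c)"
        by (simp add: ab taft_def alg.defs taft_alg_def fun_eq_iff)
      then have "act_elem K V (alg_mul K a b) = q ^ (j * k) \<cdot>\<^sub>m rep_act V ((i + k) mod n, j + l)"
        using True lt by (simp only: act_elem_smult) (subst bv, simp_all add: basis_K)
      then show ?thesis using True lt pow_mod_pair[OF p, of "i + k"] by (simp add: act)
    next
      case False
      then have "alg_mul K a b = (\<lambda>c. 0)"
        by (simp add: ab taft_def alg.defs taft_alg_def fun_eq_iff)
      moreover have "H ^\<^sub>m (j + l) = 0\<^sub>m (rep_dim V) (rep_dim V)"
        using False d pow_mat_zero_mono[of H n "j + l"] by simp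
      ultimately show ?thesis using d by (simp add: act_elem_zero mult_mat_zero_right)
    qed
    finally show "act_elem K V (alg_mul K a b) = rep_act V a * rep_act V b" ..
  qed
qed

lemma is_module_pair_module:
  assumes "taft_pair d G H"
  shows "is_module K (pair_module d G H)" "gact (pair_module d G H) = G" "hact (pair_module d G H) = H"
  using pair_is_module[of "pair_module d G H" G H] assms by (simp_all add: pair_module_def)

lemma hom_mat_iff:
  assumes "is_module K U" "is_module K V"
  shows "hom_mat K U V P \<longleftrightarrow> dim_row P = rep_dim V \<and> dim_col P = rep_dim U \<and>
     P * gact U = gact V * P \<and> P * hact U = hact V * P" (is "_ \<longleftrightarrow> ?R")
proof
  assume "hom_mat K U V P"
  then show ?R using n2 by (auto simp: hom_mat_def gact_def hact_def basis_K)
next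
  assume R: ?R
  note d = taft_pairD[OF module_pair(1)[OF assms(1)]] taft_pairD[OF module_pair(1)[OF assms(2)]]
  show "hom_mat K U V P" unfolding hom_mat_def
  proof (intro conjI ballI)
    fix b assume b: "b \<in> alg_basis K"
    obtain i j where ij: "b = (i, j)" "i < n" "j < n" using b by (auto simp: basis_K)
    have g: "P * gact U ^\<^sub>m i = gact V ^\<^sub>m i * P" and h: "P * hact U ^\<^sub>m j = hact V ^\<^sub>m j * P"
      using R d by (auto intro!: pow_mat_intertwine)
    have "P * rep_act U b = (P * gact U ^\<^sub>m i) * hact U ^\<^sub>m j"
      using R d ij by (simp add: module_pair(2)[OF assms(1)] mult_mat_assoc)
    also have "\<dots> = gact V ^\<^sub>m i * (P * hact U ^\<^sub>m j)"
      unfolding g using R d by (simp add: mult_mat_assoc)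
    also have "\<dots> = rep_act V b * P"
      unfolding h using R d ij by (simp add: module_pair(2)[OF assms(2)] mult_mat_assoc)
    finally show "P * rep_act U b = rep_act V b * P" .
  qed (use R in auto)
qed

lemma module_iso_eqI:
  assumes "is_module K U" "is_module K V" "rep_dim U = rep_dim V" "gact U = gact V" "hact U = hact V"
  shows "module_iso K U V"
proof (rule module_isoI[of _ _ _ "1\<^sub>m (rep_dim V)" "1\<^sub>m (rep_dim V)"])
  show "hom_mat K U V (1\<^sub>m (rep_dim V))"
    using assms taft_pairD[OF module_pair(1)[OF assms(2)]] by (simp add: hom_mat_iff mat_simps)
qed (use assms in simp_all)

text \<open>The two summands of the comultiplication of \<open>h\<close> act by \<open>?X\<close>
  and \<open>?Y\<close>, and \<open>?X * ?Y = q * ?Y * ?X\<close> because \<open>h g = q g h\<close>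
  holds in the second factor. Hence \<open>q_binomial\<close> yields the nilpotency of their
  sum.\<close>

lemma tensor_module_K:
  assumes U: "is_module K U" and V: "is_module K V"
  shows "is_module K (tensor_module K U V)"
    and "gact (tensor_module K U V) = kronecker (gact U) (gact V)"
    and "hact (tensor_module K U V) = kronecker (1\<^sub>m (rep_dim U)) (hact V) + kronecker (hact U) (gact V)"
proof -
  note wf = is_module_wf[OF U] is_module_wf[OF V]
  let ?G = "kronecker (gact U) (gact V)"
  let ?X = "kronecker (1\<^sub>m (rep_dim U)) (hact V)" and ?Y = "kronecker (hact U) (gact V)"
  let ?T = "tensor_alg K K" and ?O = "outer_module U V" and ?d = "rep_dim U * rep_dim V"
  note u = taft_pairD[OF module_pair(1)[OF U]] and v = taft_pairD[OF module_pair(1)[OF V]]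
  have O: "is_module ?T ?O" by (rule is_module_outer[OF U V])
  have finT: "finite (alg_basis ?T)" using fin_K by simp
  note pw = module_act_apow[OF O finT] and mu = module_act_amul[OF O finT]
  have cg: "act_elem ?T ?O (taft_comul_g n q) = ?G"
    unfolding taft_comul_g_def by (simp only: act_elem_tens[OF wf] gact_act_elem wf)
  have un: "act_elem K U (alg_unit (taft_alg n q)) = 1\<^sub>m (rep_dim U)"
    using U by (simp add: is_module_def unit_K) (simp add: taft_alg_def)
  have ch: "act_elem ?T ?O (taft_comul_h n q) = ?X + ?Y"
    unfolding taft_comul_h_def by (simp only: act_elem_add act_elem_tens[OF wf] gact_act_elem hact_act_elem wf un)
  have act: "rep_act (tensor_module K U V) (i, j) = ?G ^\<^sub>m i * (?X + ?Y) ^\<^sub>m j" for i j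
  proof -
    have "hopf_comul K (i, j) = amul ?T (apow ?T (taft_comul_g n q) i) (apow ?T (taft_comul_h n q) j)"
      unfolding tensor_K[symmetric] by (simp add: taft_def alg.defs Let_def)
    then show ?thesis by (simp only: tensor_act[OF wf] mu pw cg ch)
  qed
  have dims: "dim_row ?X = ?d" "dim_col ?X = ?d" "dim_row ?Y = ?d" "dim_col ?Y = ?d"
    "dim_row ?G = ?d" "dim_col ?G = ?d" using u v by simp_all
  have XY: "?X * ?Y = q \<cdot>\<^sub>m (?Y * ?X)"
    using u v by (simp add: kronecker_mult kronecker_smult_right mat_simps)
  have Xn: "?X ^\<^sub>m n = 0\<^sub>m ?d ?d" and Yn: "?Y ^\<^sub>m n = 0\<^sub>m ?d ?d" and Gn: "?G ^\<^sub>m n = 1\<^sub>m ?d"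
    using u v by (simp_all add: kronecker_pow kronecker_zero_left kronecker_zero_right kronecker_one)
  have HG: "(?X + ?Y) * ?G = q \<cdot>\<^sub>m (?G * (?X + ?Y))"
  proof -
    have "(?X + ?Y) * ?G = ?X * ?G + ?Y * ?G" "?G * (?X + ?Y) = ?G * ?X + ?G * ?Y"
      by (rule mult_mat_add_left mult_mat_add_right; simp only: dims)+
    moreover have "q \<cdot>\<^sub>m (?G * ?X + ?G * ?Y) = q \<cdot>\<^sub>m (?G * ?X) + q \<cdot>\<^sub>m (?G * ?Y)"
      by (rule smult_mat_add; simp only: index_mult_mat dims)
    moreover have "?X * ?G = q \<cdot>\<^sub>m (?G * ?X)" "?Y * ?G = q \<cdot>\<^sub>m (?G * ?Y)"
      using u v by (simp_all add: kronecker_mult kronecker_smult_left kronecker_smult_right mat_simps)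
    ultimately show ?thesis by (simp only:)
  qed
  have pair: "taft_pair (rep_dim (tensor_module K U V)) ?G (?X + ?Y)"
    unfolding taft_pair_def using dims Gn HG q_binomial[OF dims(1-4) XY Xn Yn] by simp
  show "is_module K (tensor_module K U V)" "gact (tensor_module K U V) = ?G"
    "hact (tensor_module K U V) = ?X + ?Y"
    using pair_is_module[OF pair act] by blast+
qed

lemma trivial_module_K:
  shows "is_module K (trivial_module K)" "gact (trivial_module K) = 1\<^sub>m 1" "hact (trivial_module K) = 0\<^sub>m 1 1"
proof -
  have pair: "taft_pair (rep_dim (trivial_module K)) (1\<^sub>m 1) (0\<^sub>m 1 1)"
    using n2 by (simp add: taft_pair_def trivial_module_def mat_simps) (cases n, simp_all add: one_pow_mat mat_simps)
  have act: "rep_act (trivial_module K) (i, j) = (1\<^sub>m 1) ^\<^sub>m i * (0\<^sub>m 1 1) ^\<^sub>m j" for i j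
    by (cases j) (auto simp: trivial_module_def taft_def alg.defs one_pow_mat mat_simps intro!: eq_matI)
  show "is_module K (trivial_module K)" "gact (trivial_module K) = 1\<^sub>m 1" "hact (trivial_module K) = 0\<^sub>m 1 1"
    using pair_is_module[OF pair act] by blast+
qed

text \<open>The Kronecker product is strictly associative, so both sides have the same matrices for
  \<open>g\<close> and \<open>h\<close> and the identity is an isomorphism.\<close>

lemma tensor_assoc_K:
  assumes "is_module K U" "is_module K V" "is_module K W"
  shows "module_iso K (tensor_module K (tensor_module K U V) W) (tensor_module K U (tensor_module K V W))"
proof (rule module_iso_eqI)
  note d = taft_pairD[OF module_pair(1)[OF assms(1)]] taft_pairD[OF module_pair(1)[OF assms(2)]]
    taft_pairD[OF module_pair(1)[OF assms(3)]]
  show "hact (tensor_module K (tensor_module K U V) W) = hact (tensor_module K U (tensor_module K V W))"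
    using assms d by (simp add: tensor_module_K kronecker_add_left kronecker_add_right kronecker_assoc
        flip: kronecker_one) (rule eq_matI, simp_all add: mult.assoc)
qed (use assms in \<open>simp_all add: tensor_module_K kronecker_assoc mult.assoc\<close>)

lemma tensor_unit_K:
  assumes "is_module K V"
  shows "module_iso K (tensor_module K (trivial_module K) V) V"
    and "module_iso K (tensor_module K V (trivial_module K)) V"
proof -
  note d = taft_pairD[OF module_pair(1)[OF assms]]
  note t = trivial_module_K
  have dt: "rep_dim (trivial_module K) = 1" by (simp add: trivial_module_def)
  have e: "kronecker (1\<^sub>m (Suc 0)) B = B" "kronecker B (1\<^sub>m (Suc 0)) = B" for B :: "'k mat"
    using kronecker_one_left[of B] kronecker_one_right[of B] by simp_all
  show "module_iso K (tensor_module K (trivial_module K) V) V"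
    by (rule module_iso_eqI) (use assms t d dt in
      \<open>simp_all add: tensor_module_K e kronecker_zero_left mat_add_zero\<close>)
  show "module_iso K (tensor_module K V (trivial_module K)) V"
    by (rule module_iso_eqI) (use assms t d dt in
      \<open>simp_all add: tensor_module_K e kronecker_zero_right mat_add_zero\<close>)
qed

text \<open>\<open>G'\<close> is the inverse of \<open>gact V\<close>, since the \<open>n\<close>-th
  power of \<open>g\<close> is 1. The antipode reverses products and so does transposition, so the
  dual acts multiplicatively. The last claim, up to a nonzero scalar from reordering, serves to see
  that a power of \<open>h\<close> that is nonzero on \<open>V\<close> stays nonzero on the
  dual.\<close>

lemma dual_module_K:
  assumes V: "is_module K V"
  defines "G' \<equiv> gact V ^\<^sub>m (n - 1)"
  shows "is_module K (dual_module K V)"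
    and "gact (dual_module K V) = transpose_mat G'"
    and "hact (dual_module K V) = transpose_mat (- (hact V * G'))"
    and "\<exists>c. c \<noteq> 0 \<and> hact (dual_module K V) ^\<^sub>m k = c \<cdot>\<^sub>m transpose_mat (hact V ^\<^sub>m k * G' ^\<^sub>m k)"
proof -
  let ?G = "gact V" and ?H = "hact V" and ?d = "rep_dim V"
  note wf = is_module_wf[OF V]
  note d = taft_pairD[OF module_pair(1)[OF V]]
  note pw = module_act_apow[OF V fin_K] and mu = module_act_amul[OF V fin_K]
  have dG': "dim_row G' = ?d" "dim_col G' = ?d" using d by (simp_all add: G'_def)
  have Sg: "act_elem K V (taft_antipode_g n q) = G'"
    unfolding taft_antipode_g_def using n2 d
    by (subst act_elem_bvec[OF fin_K _ wf]) (simp_all add: basis_K module_pair(2)[OF V] G'_def mat_simps)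
  have bg: "act_elem K V (bvec (n - 1, 0)) = G'" using Sg by (simp add: taft_antipode_g_def)
  have Sh: "act_elem K V (taft_antipode_h n q) = - (?H * G')"
    unfolding taft_antipode_h_def amul_K
    by (simp only: act_elem_uminus mu hact_act_elem[OF wf] bg)
  have dS: "dim_row (- (?H * G')) = ?d" "dim_col (- (?H * G')) = ?d" using d dG' by simp_all
  have act: "rep_act (dual_module K V) (i, j) = transpose_mat G' ^\<^sub>m i * transpose_mat (- (?H * G')) ^\<^sub>m j" for i j
  proof -
    have "hopf_antipode K (i, j) = amul (taft_alg n q) (apow (taft_alg n q) (taft_antipode_h n q) j)
        (apow (taft_alg n q) (taft_antipode_g n q) i)"
      by (simp add: taft_def alg.defs Let_def)
    then have "hopf_antipode K (i, j) = amul K (apow K (taft_antipode_h n q) j) (apow K (taft_antipode_g n q) i)"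
      by (simp only: amul_K apow_K)
    then have "act_elem K V (hopf_antipode K (i, j)) = (- (?H * G')) ^\<^sub>m j * G' ^\<^sub>m i"
      by (simp only: mu pw Sg Sh)
    then show ?thesis using dG' dS
      by (simp add: dual_module_def transpose_mult_dim transpose_pow_mat del: transpose_uminus)
  qed
  have G'H: "G' * ?H = q \<cdot>\<^sub>m (?H * G')"
  proof -
    \<comment> \<open>Passing all \<open>n - 1\<close> factors costs \<open>q ^ (n - 1)\<close>, the
      inverse of \<open>q\<close>.\<close>
    have "?H * G' = q ^ (n - 1) \<cdot>\<^sub>m (G' * ?H)"
      unfolding G'_def by (rule q_commute_pow(1)[OF d(3,4,1,2,7)])
    then have "q \<cdot>\<^sub>m (?H * G') = q ^ Suc (n - 1) \<cdot>\<^sub>m (G' * ?H)" by (simp add: smult_mat_smult)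
    then show ?thesis using n2 qn by (simp add: smult_mat_one)
  qed
  have pw': "\<exists>c. c \<noteq> 0 \<and> (- (?H * G')) ^\<^sub>m k = c \<cdot>\<^sub>m (?H ^\<^sub>m k * G' ^\<^sub>m k)" for k
  proof (induction k)
    case 0
    then show ?case using d dG' by (intro exI[of _ 1]) (simp add: mat_simps smult_mat_one)
  next
    case (Suc k)
    then obtain c where c: "c \<noteq> 0" "(- (?H * G')) ^\<^sub>m k = c \<cdot>\<^sub>m (?H ^\<^sub>m k * G' ^\<^sub>m k)" by blast
    have m: "- (?H * G') = (-1) \<cdot>\<^sub>m (?H * G')" by (rule eq_matI) simp_all
    have GH: "G' ^\<^sub>m k * ?H = q ^ k \<cdot>\<^sub>m (?H * G' ^\<^sub>m k)"
      using q_commute_pow(2)[OF dG' d(3,4) G'H, of k 1] d by (simp add: mat_simps)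
    have "(- (?H * G')) ^\<^sub>m Suc k = (c \<cdot>\<^sub>m (?H ^\<^sub>m k * G' ^\<^sub>m k)) * (- (?H * G'))"
      by (simp only: pow_mat.simps c(2))
    also have "\<dots> = (c \<cdot>\<^sub>m (?H ^\<^sub>m k * G' ^\<^sub>m k)) * ((-1) \<cdot>\<^sub>m (?H * G'))"
      by (simp only: m)
    also have "\<dots> = (c * -1) \<cdot>\<^sub>m (?H ^\<^sub>m k * ((G' ^\<^sub>m k * ?H) * G'))"
      using d dG' by (simp add: mult_mat_smult_left mult_mat_smult_right smult_mat_smult mult_mat_assoc)
    also have "\<dots> = (c * -1 * q ^ k) \<cdot>\<^sub>m (?H ^\<^sub>m Suc k * G' ^\<^sub>m Suc k)"
      unfolding GH using d dG'
      by (simp add: mult_mat_smult_left mult_mat_smult_right smult_mat_smult mult_mat_assoc)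
    finally show ?case using c q_nonzero by (intro exI[of _ "c * -1 * q ^ k"]) simp
  qed
  have pair: "taft_pair (rep_dim (dual_module K V)) (transpose_mat G') (transpose_mat (- (?H * G')))"
    unfolding taft_pair_def
  proof (intro conjI)
    have "G' ^\<^sub>m n = ?G ^\<^sub>m ((n - 1) * n)"
      unfolding G'_def using d by (simp add: pow_mat_mult)
    also have "\<dots> = ?G ^\<^sub>m (((n - 1) * n) mod n)" by (rule pow_mod_pair[OF module_pair(1)[OF V], symmetric])
    also have "\<dots> = 1\<^sub>m ?d" using d by simp
    finally show "transpose_mat G' ^\<^sub>m n = 1\<^sub>m (rep_dim (dual_module K V))"
      using dG' by (simp flip: transpose_pow_mat)
    obtain c where "(- (?H * G')) ^\<^sub>m n = c \<cdot>\<^sub>m (?H ^\<^sub>m n * G' ^\<^sub>m n)" using pw'[of n] by blast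
    then have "(- (?H * G')) ^\<^sub>m n = 0\<^sub>m ?d ?d" using d dG' by (simp add: mat_simps)
    then show "transpose_mat (- (?H * G')) ^\<^sub>m n = 0\<^sub>m (rep_dim (dual_module K V)) (rep_dim (dual_module K V))"
      using dS transpose_pow_mat[of "- (?H * G')" n] by simp
    have "G' * (- (?H * G')) = q \<cdot>\<^sub>m ((- (?H * G')) * G')"
    proof -
      have m: "- (?H * G') = (-1) \<cdot>\<^sub>m (?H * G')" by (rule eq_matI) simp_all
      have "G' * (?H * G') = q \<cdot>\<^sub>m ((?H * G') * G')"
        using G'H d dG' by (simp add: mult_mat_smult_left flip: mult_mat_assoc)
      then show ?thesis unfolding m using d dG'
        by (simp add: mult_mat_smult_left mult_mat_smult_right smult_mat_smult)
    qed
    from arg_cong[OF this, of transpose_mat]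
    have "transpose_mat (G' * (- (?H * G'))) = q \<cdot>\<^sub>m transpose_mat ((- (?H * G')) * G')"
      using dS dG' by (auto intro!: eq_matI)
    then show "transpose_mat (- (?H * G')) * transpose_mat G' = q \<cdot>\<^sub>m (transpose_mat G' * transpose_mat (- (?H * G')))"
      using dS dG' by (simp only: transpose_mult_dim)
  qed (use dG' dS in simp_all)
  show "is_module K (dual_module K V)" "gact (dual_module K V) = transpose_mat G'"
    and h: "hact (dual_module K V) = transpose_mat (- (?H * G'))"
    using pair_is_module[OF pair act] by blast+
  obtain c where c: "c \<noteq> 0" "(- (?H * G')) ^\<^sub>m k = c \<cdot>\<^sub>m (?H ^\<^sub>m k * G' ^\<^sub>m k)" using pw' by blast
  have "hact (dual_module K V) ^\<^sub>m k = transpose_mat ((- (?H * G')) ^\<^sub>m k)"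
    unfolding h using dS transpose_pow_mat[of "- (?H * G')" k] by simp
  also have "\<dots> = c \<cdot>\<^sub>m transpose_mat (?H ^\<^sub>m k * G' ^\<^sub>m k)"
    unfolding c(2) by (rule eq_matI) simp_all
  finally show "\<exists>c. c \<noteq> 0 \<and> hact (dual_module K V) ^\<^sub>m k = c \<cdot>\<^sub>m transpose_mat (hact V ^\<^sub>m k * G' ^\<^sub>m k)"
    using c(1) by blast
qed

end

section \<open>Weight vectors and indecomposable summands\<close>

context taft_param begin

section \<open>The modules M(l, r) in matrix form\<close>

abbreviation M :: "nat \<Rightarrow> int \<Rightarrow> (nat \<times> nat, 'k) rep" where "M l r \<equiv> taft_module q l r"

lemma q_powi_n: "(q powi z) ^ n = 1"
  using q_nonzero by (metis mult.commute power_int_1_left power_int_mult power_int_of_nat qn)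

text \<open>Primitivity makes weights the same as residues modulo \<open>n\<close>, although they
  are indexed by integers.\<close>

lemma q_powi_eq_iff: "q powi a = q powi b \<longleftrightarrow> a mod int n = b mod int n"
proof -
  have 1: "q powi c = q ^ nat (c mod int n)" for c
  proof -
    have "q powi c = q powi (int n * (c div int n) + c mod int n)" by simp
    also have "\<dots> = q powi (int n * (c div int n)) * q powi (c mod int n)"
      using q_nonzero by (intro power_int_add) simp
    also have "q powi (int n * (c div int n)) = 1" by (simp add: power_int_mult qn)
    also have "q powi (c mod int n) = q ^ nat (c mod int n)"
      using n2 by (simp add: power_int_def)
    finally show ?thesis by simp
  qed
  have inj: "i = j" if "q ^ i = q ^ j" "i \<le> j" "j < n" for i j
  proof (rule ccontr)
    assume "i \<noteq> j"
    then have "0 < j - i" "j - i < n" using that by auto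
    moreover have "q ^ i * q ^ (j - i) = q ^ j" using \<open>i \<le> j\<close> by (simp flip: power_add)
    then have "q ^ i * q ^ (j - i) = q ^ i * 1" using that by simp
    ultimately show False using prim q_nonzero by simp
  qed
  have lt: "nat (c mod int n) < n" for c using n2 by (simp add: nat_less_iff)
  have "q powi a = q powi b \<longleftrightarrow> nat (a mod int n) = nat (b mod int n)"
    unfolding 1 using inj lt by (metis nat_le_linear)
  then show ?thesis using n2 by (simp add: eq_nat_nat_iff)
qed

lemma taft_g_dim [simp]: "dim_row (taft_g_mat q l r) = l" "dim_col (taft_g_mat q l r) = l"
  by (simp_all add: taft_g_mat_def)

lemma taft_h_dim [simp]: "dim_row (taft_h_mat l) = l" "dim_col (taft_h_mat l) = l"
  by (simp_all add: taft_h_mat_def)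

lemma mult_taft_g_entry:
  fixes A :: "'k mat"
  assumes "dim_col A = l" "i < dim_row A" "k < l"
  shows "(A * taft_g_mat q l r) $$ (i, k) = q powi (r - int k) * A $$ (i, k)"
proof -
  have "(A * taft_g_mat q l r) $$ (i, k) = (\<Sum>t<l. A $$ (i, t) * (if t = k then q powi (r - int k) else 0))"
    using assms by (subst mult_mat_entry) (auto simp: taft_g_mat_def intro!: sum.cong)
  then show ?thesis using assms by (simp add: sum_delta_right)
qed

lemma taft_g_mult_entry:
  fixes A :: "'k mat"
  assumes "dim_row A = l" "k < dim_col A" "i < l"
  shows "(taft_g_mat q l r * A) $$ (i, k) = q powi (r - int i) * A $$ (i, k)"
proof -
  have "(taft_g_mat q l r * A) $$ (i, k) = (\<Sum>t<l. (if t = i then q powi (r - int i) else 0) * A $$ (t, k))"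
    using assms by (subst mult_mat_entry) (auto simp: taft_g_mat_def intro!: sum.cong)
  then show ?thesis using assms by (simp add: sum_delta_right)
qed

lemma mult_taft_h_entry:
  fixes A :: "'k mat"
  assumes "dim_col A = l" "i < dim_row A" "k < l"
  shows "(A * taft_h_mat l) $$ (i, k) = (if k + 1 < l then A $$ (i, k + 1) else 0)"
proof -
  have "(A * taft_h_mat l) $$ (i, k) = (\<Sum>t<l. A $$ (i, t) * (if t = k + 1 then 1 else 0))"
    using assms by (subst mult_mat_entry) (auto simp: taft_h_mat_def intro!: sum.cong)
  then show ?thesis using assms by (simp add: sum_delta_right)
qed

lemma taft_h_mult_entry:
  fixes A :: "'k mat"
  assumes "dim_row A = l" "k < dim_col A" "i < l"
  shows "(taft_h_mat l * A) $$ (i, k) = (if 0 < i then A $$ (i - 1, k) else 0)"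
proof (cases i)
  case 0
  then have "(taft_h_mat l * A) $$ (i, k) = (\<Sum>t<l. 0)"
    using assms by (subst mult_mat_entry) (auto simp: taft_h_mat_def intro!: sum.neutral)
  then show ?thesis using 0 by simp
next
  case (Suc j)
  have "(taft_h_mat l * A) $$ (i, k) = (\<Sum>t<l. (if t = j then 1 else 0) * A $$ (t, k))"
    using assms Suc by (subst mult_mat_entry) (auto simp: taft_h_mat_def intro!: sum.cong)
  then show ?thesis using assms Suc by (simp add: sum_delta_right)
qed

lemma taft_h_pow_entry:
  "a < l \<Longrightarrow> b < l \<Longrightarrow> (taft_h_mat l ^\<^sub>m j) $$ (a, b) = (if a = b + j then 1 else (0 :: 'k))"
proof (induction j arbitrary: a b)
  case (Suc j)
  have "(taft_h_mat l ^\<^sub>m Suc j) $$ (a, b)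
      = (if b + 1 < l then (taft_h_mat l ^\<^sub>m j :: 'k mat) $$ (a, b + 1) else 0)"
    using Suc.prems by (simp only: pow_mat.simps) (rule mult_taft_h_entry, simp_all)
  then show ?case using Suc by auto
qed auto

lemma taft_g_pow_entry:
  "a < l \<Longrightarrow> b < l \<Longrightarrow> (taft_g_mat q l r ^\<^sub>m j) $$ (a, b) = (if a = b then (q powi (r - int a)) ^ j else 0)"
proof (induction j arbitrary: a b)
  case (Suc j)
  then show ?case by (simp only: pow_mat.simps) (simp add: mult_taft_g_entry del: index_mult_mat(1))
qed auto

lemma taft_pair_M:
  assumes "l \<le> n"
  shows "taft_pair l (taft_g_mat q l r) (taft_h_mat l)"
  unfolding taft_pair_def
proof (intro conjI)
  show "taft_g_mat q l r ^\<^sub>m n = 1\<^sub>m l"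
    by (rule eq_matI) (auto simp: taft_g_pow_entry q_powi_n)
  show "taft_h_mat l ^\<^sub>m n = (0\<^sub>m l l :: 'k mat)"
    using assms by (intro eq_matI) (auto simp: taft_h_pow_entry)
  show "taft_h_mat l * taft_g_mat q l r = q \<cdot>\<^sub>m (taft_g_mat q l r * taft_h_mat l)"
  proof (rule eq_matI)
    fix a b assume "a < dim_row (q \<cdot>\<^sub>m (taft_g_mat q l r * taft_h_mat l))"
      "b < dim_col (q \<cdot>\<^sub>m (taft_g_mat q l r * taft_h_mat l))"
    then have ab: "a < l" "b < l" by simp_all
    have "q * q powi (r - int (b + 1)) = q powi (r - int b)"
      using q_nonzero by (simp flip: power_int_add_1')
    then show "(taft_h_mat l * taft_g_mat q l r) $$ (a, b) = (q \<cdot>\<^sub>m (taft_g_mat q l r * taft_h_mat l)) $$ (a, b)"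
      using ab by (simp add: mult_taft_g_entry taft_g_mult_entry del: index_mult_mat(1)) (auto simp: taft_h_mat_def)
  qed simp_all
qed simp_all

lemma taft_module_pair: "M l r = pair_module l (taft_g_mat q l r) (taft_h_mat l)"
  by (simp add: taft_module_def pair_module_def)

lemma dim_M [simp]: "rep_dim (M l r) = l"
  by (simp add: taft_module_def)

lemma module_M:
  assumes "l \<le> n"
  shows "is_module K (M l r)" "gact (M l r) = taft_g_mat q l r" "hact (M l r) = taft_h_mat l"
  using is_module_pair_module[OF taft_pair_M[OF assms, of r]] by (simp_all add: taft_module_pair)

lemma M_cong: "r mod int n = r' mod int n \<Longrightarrow> M l r = M l r'"
proof -
  assume r: "r mod int n = r' mod int n"
  have "q powi (r - a) = q powi (r' - a)" for a
    unfolding q_powi_eq_iff using r by (metis mod_diff_cong)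
  then have "taft_g_mat q l r = taft_g_mat q l r'" by (simp add: taft_g_mat_def cong: if_cong)
  then show ?thesis by (simp add: taft_module_pair)
qed

section \<open>Weight vectors and covectors, as one-column and one-row matrices\<close>

definition wt_vec :: "(nat \<times> nat, 'k) rep \<Rightarrow> int \<Rightarrow> 'k mat \<Rightarrow> bool" where
  "wt_vec V r v \<longleftrightarrow> dim_row v = rep_dim V \<and> dim_col v = 1 \<and> gact V * v = (q powi r) \<cdot>\<^sub>m v"

definition wt_covec :: "(nat \<times> nat, 'k) rep \<Rightarrow> int \<Rightarrow> 'k mat \<Rightarrow> bool" where
  "wt_covec V r f \<longleftrightarrow> dim_row f = 1 \<and> dim_col f = rep_dim V \<and> f * gact V = (q powi r) \<cdot>\<^sub>m f"

text \<open>From \<open>h g = q g h\<close> the vector \<open>g h v\<close> is the inverse of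
  \<open>q\<close> times \<open>h g v\<close>, so \<open>h\<close> lowers weights by one. On
  covectors \<open>h\<close> acts from the other side and raises them.\<close>

lemma wt_vec_hact_pow:
  assumes V: "is_module K V" and v: "wt_vec V r v"
  shows "wt_vec V (r - int k) (hact V ^\<^sub>m k * v)"
proof (induction k)
  case 0
  then show ?case using v taft_pairD[OF module_pair(1)[OF V]] by (simp add: wt_vec_def mat_simps)
next
  case (Suc k)
  let ?w = "hact V ^\<^sub>m k * v"
  note d = taft_pairD[OF module_pair(1)[OF V]]
  have dv: "dim_row v = rep_dim V" "dim_col v = 1" using v by (simp_all add: wt_vec_def)
  have w: "hact V ^\<^sub>m Suc k * v = hact V * ?w"
    using d dv pow_mat_Suc_left[of "hact V" k] by (simp add: mult_mat_assoc)
  have "hact V * (gact V * ?w) = (hact V * gact V) * ?w" using d(1-4) dv by (simp add: mult_mat_assoc)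
  also have "\<dots> = q \<cdot>\<^sub>m (gact V * (hact V * ?w))"
    unfolding d(7) using d dv by (simp add: mult_mat_smult_left mult_mat_assoc)
  finally have "q \<cdot>\<^sub>m (gact V * (hact V * ?w)) = q powi (r - int k) \<cdot>\<^sub>m (hact V * ?w)"
    using Suc d dv by (simp add: wt_vec_def mult_mat_smult_right)
  from arg_cong[OF this, of "\<lambda>A. inverse q \<cdot>\<^sub>m A"]
  have "gact V * (hact V * ?w) = (inverse q * q powi (r - int k)) \<cdot>\<^sub>m (hact V * ?w)"
    using q_nonzero by (simp add: smult_mat_smult smult_mat_one)
  also have "inverse q * q powi (r - int k) = q powi (r - int (Suc k))"
    using q_nonzero power_int_diff[of q "r - int k" 1] by (simp add: field_simps)
  finally show ?case unfolding w using d dv by (simp add: wt_vec_def)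
qed

lemma wt_covec_hact_pow:
  assumes V: "is_module K V" and f: "wt_covec V r f"
  shows "wt_covec V (r + int k) (f * hact V ^\<^sub>m k)"
proof (induction k)
  case 0
  then show ?case using f taft_pairD[OF module_pair(1)[OF V]] by (simp add: wt_covec_def mat_simps)
next
  case (Suc k)
  let ?w = "f * hact V ^\<^sub>m k"
  note d = taft_pairD[OF module_pair(1)[OF V]]
  have df: "dim_row f = 1" "dim_col f = rep_dim V" using f by (simp_all add: wt_covec_def)
  have w: "f * hact V ^\<^sub>m Suc k = ?w * hact V"
    using d df by (simp add: mult_mat_assoc)
  have "?w * hact V * gact V = ?w * (hact V * gact V)" using d(1-4) df by (simp add: mult_mat_assoc)
  also have "\<dots> = q \<cdot>\<^sub>m ((?w * gact V) * hact V)"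
    unfolding d(7) using d df by (simp add: mult_mat_smult_right mult_mat_assoc)
  also have "?w * gact V = q powi (r + int k) \<cdot>\<^sub>m ?w" using Suc by (simp add: wt_covec_def)
  also have "q \<cdot>\<^sub>m (q powi (r + int k) \<cdot>\<^sub>m ?w * hact V) = (q * q powi (r + int k)) \<cdot>\<^sub>m (?w * hact V)"
    using d df by (simp add: mult_mat_smult_left smult_mat_smult)
  also have "q * q powi (r + int k) = q powi (r + int (Suc k))"
    using q_nonzero power_int_add[of q 1 "r + int k"] by (simp add: algebra_simps)
  finally show ?case unfolding w using d df by (simp add: wt_covec_def)
qed

text \<open>Evaluating \<open>f * gact V * v\<close> in two ways gives
  \<open>(q^r - q^s) * (f * v) = 0\<close>, and the first factor is nonzero.\<close>

lemma wt_pairing: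
  assumes V: "is_module K V" and v: "wt_vec V r v" and f: "wt_covec V s f" and ne: "r mod int n \<noteq> s mod int n"
  shows "f * v = 0\<^sub>m 1 1"
proof -
  note d = taft_pairD[OF module_pair(1)[OF V]]
  have dv: "dim_row v = rep_dim V" "dim_col v = 1" "gact V * v = q powi r \<cdot>\<^sub>m v"
    and df: "dim_row f = 1" "dim_col f = rep_dim V" "f * gact V = q powi s \<cdot>\<^sub>m f"
    using v f by (simp_all add: wt_vec_def wt_covec_def)
  have "f * (gact V * v) = (f * gact V) * v" using d(1-4) dv(1,2) df(1,2) by (simp add: mult_mat_assoc)
  then have e: "q powi r \<cdot>\<^sub>m (f * v) = q powi s \<cdot>\<^sub>m (f * v)"
    using dv df by (simp add: mult_mat_smult_left mult_mat_smult_right)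
  show ?thesis
  proof (rule eq_matI)
    fix i j assume "i < dim_row (0\<^sub>m 1 1 :: 'k mat)" "j < dim_col (0\<^sub>m 1 1 :: 'k mat)"
    then have ij: "i = 0" "j = 0" by simp_all
    have "(q powi r \<cdot>\<^sub>m (f * v)) $$ (0, 0) = (q powi s \<cdot>\<^sub>m (f * v)) $$ (0, 0)" by (simp only: e)
    then have "q powi r * (f * v) $$ (0, 0) = q powi s * (f * v) $$ (0, 0)"
      using dv df by (simp del: index_mult_mat(1))
    then show "(f * v) $$ (i, j) = 0\<^sub>m 1 1 $$ (i, j)" using ne ij by (simp add: q_powi_eq_iff)
  qed (use dv df in simp_all)
qed

section \<open>Homomorphisms from and to M(l, r)\<close>

definition cyc_mat :: "(nat \<times> nat, 'k) rep \<Rightarrow> nat \<Rightarrow> 'k mat \<Rightarrow> 'k mat" where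
  "cyc_mat V l v = mat (rep_dim V) l (\<lambda>(i, k). (hact V ^\<^sub>m k * v) $$ (i, 0))"

text \<open>Dual to \<open>cyc_mat\<close>, whose columns are the iterates of \<open>h\<close> on
  \<open>v\<close>. The exponent decreases along the rows, so that composing with \<open>h\<close>
  moves every row down by one, as \<open>taft_h_mat\<close> does; the last row is \<open>f\<close>
  itself.\<close>

definition cocyc_mat :: "(nat \<times> nat, 'k) rep \<Rightarrow> nat \<Rightarrow> 'k mat \<Rightarrow> 'k mat" where
  "cocyc_mat V l f = mat l (rep_dim V) (\<lambda>(i, j). (f * hact V ^\<^sub>m (l - 1 - i)) $$ (0, j))"

lemma dim_cyc [simp]: "dim_row (cyc_mat V l v) = rep_dim V" "dim_col (cyc_mat V l v) = l"
  and dim_cocyc [simp]: "dim_row (cocyc_mat V l v) = l" "dim_col (cocyc_mat V l v) = rep_dim V"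
  by (simp_all add: cyc_mat_def cocyc_mat_def)

lemma mult_cyc_entry:
  assumes "is_module K V" "dim_row v = rep_dim V" "dim_col v = 1" "dim_col A = rep_dim V" "i < dim_row A" "k < l"
  shows "(A * cyc_mat V l v) $$ (i, k) = (A * (hact V ^\<^sub>m k * v)) $$ (i, 0)"
  using assms taft_pairD[OF module_pair(1)[OF assms(1)]]
  by (simp add: mult_mat_entry[of i A] del: index_mult_mat(1)) (simp add: cyc_mat_def del: index_mult_mat(1))

lemma cocyc_mult_entry:
  assumes "is_module K V" "dim_col f = rep_dim V" "dim_row f = 1" "dim_row A = rep_dim V" "k < dim_col A" "i < l"
  shows "(cocyc_mat V l f * A) $$ (i, k) = ((f * hact V ^\<^sub>m (l - 1 - i)) * A) $$ (0, k)"
  using assms taft_pairD[OF module_pair(1)[OF assms(1)]]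
  by (simp add: mult_mat_entry[of _ _ k A] del: index_mult_mat(1)) (simp add: cocyc_mat_def del: index_mult_mat(1))

text \<open>\<open>M l r\<close> is generated by a vector of weight \<open>r\<close> subject to
  \<open>h^l = 0\<close>, so such a \<open>v\<close> determines a homomorphism; the hypothesis on
  \<open>hact V ^ l\<close> settles the last column.\<close>

lemma hom_cyc:
  assumes V: "is_module K V" and l: "l \<le> n" and v: "wt_vec V r v"
    and 0: "hact V ^\<^sub>m l * v = 0\<^sub>m (rep_dim V) 1"
  shows "hom_mat K (M l r) V (cyc_mat V l v)"
proof -
  note d = taft_pairD[OF module_pair(1)[OF V]]
  have dv: "dim_row v = rep_dim V" "dim_col v = 1" using v by (simp_all add: wt_vec_def)
  have "cyc_mat V l v * taft_g_mat q l r = gact V * cyc_mat V l v"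
  proof (rule eq_matI)
    fix i k assume "i < dim_row (gact V * cyc_mat V l v)" "k < dim_col (gact V * cyc_mat V l v)"
    then have ik: "i < rep_dim V" "k < l" using d by simp_all
    have "gact V * (hact V ^\<^sub>m k * v) = q powi (r - int k) \<cdot>\<^sub>m (hact V ^\<^sub>m k * v)"
      using wt_vec_hact_pow[OF V v, of k] by (simp add: wt_vec_def)
    then have "(gact V * cyc_mat V l v) $$ (i, k) = q powi (r - int k) * (hact V ^\<^sub>m k * v) $$ (i, 0)"
      using mult_cyc_entry[OF V dv, of "gact V" i k l] d dv ik by (simp del: index_mult_mat(1))
    then show "(cyc_mat V l v * taft_g_mat q l r) $$ (i, k) = (gact V * cyc_mat V l v) $$ (i, k)"
      using ik by (simp add: mult_taft_g_entry del: index_mult_mat(1)) (simp add: cyc_mat_def)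
  qed (use d in simp_all)
  moreover have "cyc_mat V l v * taft_h_mat l = hact V * cyc_mat V l v"
  proof (rule eq_matI)
    fix i k assume "i < dim_row (hact V * cyc_mat V l v)" "k < dim_col (hact V * cyc_mat V l v)"
    then have ik: "i < rep_dim V" "k < l" using d by simp_all
    have "hact V * (hact V ^\<^sub>m k * v) = hact V ^\<^sub>m Suc k * v"
      using d dv pow_mat_Suc_left[of "hact V" k] by (simp add: mult_mat_assoc)
    then have e: "(hact V * cyc_mat V l v) $$ (i, k) = (hact V ^\<^sub>m Suc k * v) $$ (i, 0)"
      using mult_cyc_entry[OF V dv, of "hact V" i k l] d ik by simp
    show "(cyc_mat V l v * taft_h_mat l) $$ (i, k) = (hact V * cyc_mat V l v) $$ (i, k)"
    proof (cases "Suc k < l")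
      case True
      have "(cyc_mat V l v * taft_h_mat l) $$ (i, k) = cyc_mat V l v $$ (i, Suc k)"
        using mult_taft_h_entry[of "cyc_mat V l v" l i k] ik True by simp
      then show ?thesis unfolding e using ik True by (simp add: cyc_mat_def)
    next
      case False
      then have "Suc k = l" using ik by simp
      then have "(hact V * cyc_mat V l v) $$ (i, k) = 0" unfolding e using 0 ik by simp
      then show ?thesis
        using mult_taft_h_entry[of "cyc_mat V l v" l i k] ik False by simp
    qed
  qed (use d in simp_all)
  ultimately show ?thesis using V l by (simp add: hom_mat_iff module_M)
qed

text \<open>The weight \<open>r - l + 1\<close> is that of the last basis vector of
  \<open>M l r\<close>, whose coordinate is read by \<open>f\<close>; row \<open>i\<close> has
  weight \<open>r - i\<close>.\<close>

lemma hom_cocyc: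
  assumes V: "is_module K V" and l: "1 \<le> l" "l \<le> n" and f: "wt_covec V (r - int l + 1) f"
    and f0: "f * hact V ^\<^sub>m l = 0\<^sub>m 1 (rep_dim V)"
  shows "hom_mat K V (M l r) (cocyc_mat V l f)"
proof -
  note d = taft_pairD[OF module_pair(1)[OF V]]
  have df: "dim_col f = rep_dim V" "dim_row f = 1" using f by (simp_all add: wt_covec_def)
  have "cocyc_mat V l f * gact V = taft_g_mat q l r * cocyc_mat V l f"
  proof (rule eq_matI)
    fix i k assume "i < dim_row (taft_g_mat q l r * cocyc_mat V l f)" "k < dim_col (taft_g_mat q l r * cocyc_mat V l f)"
    then have ik: "i < l" "k < rep_dim V" by simp_all
    have "r - int l + 1 + int (l - 1 - i) = r - int i" using ik by auto
    then have "f * hact V ^\<^sub>m (l - 1 - i) * gact V = q powi (r - int i) \<cdot>\<^sub>m (f * hact V ^\<^sub>m (l - 1 - i))"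
      using wt_covec_hact_pow[OF V f, of "l - 1 - i"] by (simp add: wt_covec_def)
    then have "(cocyc_mat V l f * gact V) $$ (i, k) = q powi (r - int i) * (f * hact V ^\<^sub>m (l - 1 - i)) $$ (0, k)"
      using cocyc_mult_entry[OF V df, of "gact V" k i l] d df ik by (simp del: index_mult_mat(1))
    then show "(cocyc_mat V l f * gact V) $$ (i, k) = (taft_g_mat q l r * cocyc_mat V l f) $$ (i, k)"
      using ik by (simp add: taft_g_mult_entry del: index_mult_mat(1)) (simp add: cocyc_mat_def)
  qed (use d in simp_all)
  moreover have "cocyc_mat V l f * hact V = taft_h_mat l * cocyc_mat V l f"
  proof (rule eq_matI)
    fix i k assume "i < dim_row (taft_h_mat l * cocyc_mat V l f)" "k < dim_col (taft_h_mat l * cocyc_mat V l f)"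
    then have ik: "i < l" "k < rep_dim V" by simp_all
    have "f * hact V ^\<^sub>m (l - 1 - i) * hact V = f * hact V ^\<^sub>m Suc (l - 1 - i)"
      using d df by (simp add: mult_mat_assoc)
    also have "Suc (l - 1 - i) = l - i" using ik by simp
    finally have e: "(cocyc_mat V l f * hact V) $$ (i, k) = (f * hact V ^\<^sub>m (l - i)) $$ (0, k)"
      using cocyc_mult_entry[OF V df, of "hact V" k i l] d ik by simp
    show "(cocyc_mat V l f * hact V) $$ (i, k) = (taft_h_mat l * cocyc_mat V l f) $$ (i, k)"
    proof (cases i)
      case 0
      then have "(cocyc_mat V l f * hact V) $$ (i, k) = 0" unfolding e using f0 ik by simp
      then show ?thesis using taft_h_mult_entry[of "cocyc_mat V l f" l k i] ik 0 by simp
    next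
      case (Suc j)
      then have "(taft_h_mat l * cocyc_mat V l f) $$ (i, k) = cocyc_mat V l f $$ (j, k)"
        using taft_h_mult_entry[of "cocyc_mat V l f" l k i] ik by simp
      then show ?thesis unfolding e using ik Suc by (simp add: cocyc_mat_def)
    qed
  qed (use d in simp_all)
  ultimately show ?thesis using V l by (simp add: hom_mat_iff module_M)
qed

lemma cocyc_cyc_entry:
  assumes V: "is_module K V" and v: "dim_row v = rep_dim V" "dim_col v = 1"
    and f: "dim_col f = rep_dim V" "dim_row f = 1" and "i < l" "k < l'"
  shows "(cocyc_mat V l f * cyc_mat V l' v) $$ (i, k) = (f * (hact V ^\<^sub>m (l - 1 - i + k) * v)) $$ (0, 0)"
proof -
  note d = taft_pairD[OF module_pair(1)[OF V]]
  have "(cocyc_mat V l f * cyc_mat V l' v) $$ (i, k) = (cocyc_mat V l f * (hact V ^\<^sub>m k * v)) $$ (i, 0)"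
    using assms by (intro mult_cyc_entry) simp_all
  also have "\<dots> = (f * hact V ^\<^sub>m (l - 1 - i) * (hact V ^\<^sub>m k * v)) $$ (0, 0)"
    using assms d by (intro cocyc_mult_entry) simp_all
  also have "f * hact V ^\<^sub>m (l - 1 - i) * (hact V ^\<^sub>m k * v) = f * ((hact V ^\<^sub>m (l - 1 - i) * hact V ^\<^sub>m k) * v)"
    using v f d(1-4) by (simp add: mult_mat_assoc)
  also have "hact V ^\<^sub>m (l - 1 - i) * hact V ^\<^sub>m k = hact V ^\<^sub>m (l - 1 - i + k)"
    using d(3,4) by (intro pow_mat_add[symmetric]) simp
  finally show ?thesis .
qed

text \<open>By weights, only the terms \<open>f h^(l-1) v\<close> on the diagonal survive.\<close>

lemma cocyc_cyc_one:
  assumes V: "is_module K V" and l: "1 \<le> l" "l \<le> n" and v: "wt_vec V r v"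
    and v0: "hact V ^\<^sub>m l * v = 0\<^sub>m (rep_dim V) 1" and f: "wt_covec V (r - int l + 1) f"
    and one: "(f * (hact V ^\<^sub>m (l - 1) * v)) $$ (0, 0) = 1"
  shows "cocyc_mat V l f * cyc_mat V l v = 1\<^sub>m l"
proof (rule eq_matI)
  fix i k assume "i < dim_row (1\<^sub>m l :: 'k mat)" "k < dim_col (1\<^sub>m l :: 'k mat)"
  then have ik: "i < l" "k < l" by simp_all
  note d = taft_pairD[OF module_pair(1)[OF V]]
  have dv: "dim_row v = rep_dim V" "dim_col v = 1" using v by (simp_all add: wt_vec_def)
  have df: "dim_col f = rep_dim V" "dim_row f = 1" using f by (simp_all add: wt_covec_def)
  let ?m = "l - 1 - i + k"
  note e = cocyc_cyc_entry[OF V dv df ik]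
  show "(cocyc_mat V l f * cyc_mat V l v) $$ (i, k) = 1\<^sub>m l $$ (i, k)"
  proof (cases "i = k")
    case True
    then show ?thesis using e one ik by simp
  next
    case False
    show ?thesis
    proof (cases "l \<le> ?m")
      case True
      have "hact V ^\<^sub>m ?m * v = hact V ^\<^sub>m (?m - l) * (hact V ^\<^sub>m l * v)"
        using True d dv pow_mat_add[of "hact V" "?m - l" l] by (simp add: mult_mat_assoc)
      then have "f * (hact V ^\<^sub>m ?m * v) = 0\<^sub>m 1 1" using v0 d df by (simp add: mat_simps)
      then show ?thesis using e ik False by simp
    next
      case lt: False
      \<comment> \<open>The two weights differ by \<open>i - k\<close>, which is nonzero and smaller
        than \<open>n\<close> in absolute value.\<close>
      have "(r - int ?m) mod int n \<noteq> (r - int l + 1) mod int n"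
      proof
        assume "(r - int ?m) mod int n = (r - int l + 1) mod int n"
        then have "int n dvd (r - int ?m) - (r - int l + 1)" by (simp add: mod_eq_dvd_iff)
        moreover have "(r - int ?m) - (r - int l + 1) = int i - int k" using ik by auto
        ultimately have "int n dvd int i - int k" by simp
        moreover have "\<bar>int i - int k\<bar> < int n" using ik l by auto
        ultimately show False using False zdvd_imp_le[of "int n" "\<bar>int i - int k\<bar>"] by auto
      qed
      then have "f * (hact V ^\<^sub>m ?m * v) = 0\<^sub>m 1 1"
        by (rule wt_pairing[OF V wt_vec_hact_pow[OF V v] f])
      then show ?thesis using e ik False by simp
    qed
  qed
qed simp_all

lemma biproduct_zero_right:
  assumes "biproduct A X U W" "rep_dim W = 0"
  shows "module_iso A X U"
proof -
  obtain i1 i2 p1 p2 where h: "hom_mat A U X i1" "hom_mat A W X i2" "hom_mat A X U p1" "hom_mat A X W p2"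
    and e: "p1 * i1 = 1\<^sub>m (rep_dim U)" "i1 * p1 + i2 * p2 = 1\<^sub>m (rep_dim X)"
    using assms(1) by (auto simp: biproduct_def)
  note d = hom_matD(1,2)[OF h(1)] hom_matD(1,2)[OF h(2)] hom_matD(1,2)[OF h(3)] hom_matD(1,2)[OF h(4)]
  have "i2 * p2 = 0\<^sub>m (rep_dim X) (rep_dim X)"
    using d assms(2) by (intro eq_matI) (simp_all add: mult_mat_entry del: index_mult_mat(1))
  then have "i1 * p1 = 1\<^sub>m (rep_dim X)" using e d by (simp add: mat_add_zero)
  then show ?thesis using module_isoI[OF h(3), of i1] d e by simp
qed

subsection \<open>Weight projections\<close>

lemma geometric_root_sum:
  assumes "x ^ n = 1" "x \<noteq> (1 :: 'k)" shows "(\<Sum>i<n. x ^ i) = 0"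
proof -
  have "(x - 1) * (\<Sum>i<n. x ^ i) = x ^ n - 1" by (simp add: power_diff_1_eq)
  then show ?thesis using assms by simp
qed

text \<open>If \<open>n\<close> vanished in \<open>k\<close>, all the powers of \<open>q\<close> would be roots of \<open>1 + X + \<dots> + X^(n-1)\<close>.\<close>

lemma of_nat_n_nonzero: "(of_nat n :: 'k) \<noteq> 0"
proof
  assume 0: "(of_nat n :: 'k) = 0"
  define p where "p = (\<Sum>i<n. monom (1 :: 'k) i)"
  have ev: "poly p x = (\<Sum>i<n. x ^ i)" for x by (simp add: p_def poly_sum poly_monom)
  have cf: "coeff p i = (if i < n then 1 else 0)" for i by (simp add: p_def coeff_sum)
  have p0: "p \<noteq> 0" using cf[of 0] n2 by auto
  have deg: "degree p \<le> n - 1" by (rule degree_le) (auto simp: cf)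
  have inj: "inj_on (\<lambda>t. q ^ t) {..<n}"
  proof (rule inj_onI)
    fix i j assume "i \<in> {..<n}" "j \<in> {..<n}" "q ^ i = q ^ j"
    then show "i = j" using q_powi_eq_iff[of "int i" "int j"] by simp
  qed
  have "(\<lambda>t. q ^ t) ` {..<n} \<subseteq> {x. poly p x = 0}"
  proof safe
    fix t assume "t < n"
    show "poly p (q ^ t) = 0"
    proof (cases "t = 0")
      case True then show ?thesis using 0 by (simp add: ev)
    next
      case False
      moreover have "(q ^ t) ^ n = 1" by (metis power_mult mult.commute power_one qn)
      ultimately show ?thesis unfolding ev using prim \<open>t < n\<close> by (intro geometric_root_sum) auto
    qed
  qed
  then have "card ((\<lambda>t. q ^ t) ` {..<n}) \<le> card {x. poly p x = 0}"
    by (rule card_mono[OF poly_roots_finite[OF p0]])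
  then have "n \<le> card {x. poly p x = 0}" by (simp add: card_image[OF inj])
  then show False using card_poly_roots_bound[OF p0] deg n2 by linarith
qed

text \<open>The group algebra element whose action is \<open>n\<close> times the projection onto the
  weight space of \<open>q^s\<close>; the division by \<open>n\<close> is left out.\<close>

definition wproj :: "int \<Rightarrow> nat \<times> nat \<Rightarrow> 'k" where
  "wproj s = (\<lambda>(i, j). if j = 0 then q powi (- s * int i) else 0)"

lemma sum_wproj: "(\<Sum>b\<in>alg_basis K. wproj s b * F b) = (\<Sum>i<n. q powi (- s * int i) * F (i, 0))"
proof -
  have "(\<Sum>b\<in>alg_basis K. wproj s b * F b) = (\<Sum>i<n. \<Sum>j<n. (if j = 0 then q powi (- s * int i) else 0) * F (i, j))"
    by (simp add: basis_K wproj_def sum.cartesian_product case_prod_unfold)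
  then show ?thesis using n2 by (simp add: sum_delta_right(2))
qed

lemma mult_wproj:
  assumes V: "is_module K V" and A: "dim_col A = rep_dim V" "i < dim_row A" "j < rep_dim V"
  shows "(A * act_elem K V (wproj s)) $$ (i, j) = (\<Sum>k<n. q powi (- s * int k) * (A * gact V ^\<^sub>m k) $$ (i, j))"
proof -
  note d = taft_pairD[OF module_pair(1)[OF V]]
  have "(A * act_elem K V (wproj s)) $$ (i, j) = (\<Sum>k<n. q powi (- s * int k) * (A * rep_act V (k, 0)) $$ (i, j))"
    using A by (simp add: mult_act_elem is_module_wf[OF V] sum_wproj del: index_mult_mat(1))
  also have "\<dots> = (\<Sum>k<n. q powi (- s * int k) * (A * gact V ^\<^sub>m k) $$ (i, j))"
    using n2 d by (intro sum.cong refl) (simp add: module_pair(2)[OF V] mat_simps del: index_mult_mat(1))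
  finally show ?thesis .
qed

lemma wproj_mult:
  assumes V: "is_module K V" and A: "dim_row A = rep_dim V" "i < rep_dim V" "j < dim_col A"
  shows "(act_elem K V (wproj s) * A) $$ (i, j) = (\<Sum>k<n. q powi (- s * int k) * (gact V ^\<^sub>m k * A) $$ (i, j))"
proof -
  note d = taft_pairD[OF module_pair(1)[OF V]]
  have "(act_elem K V (wproj s) * A) $$ (i, j) = (\<Sum>k<n. q powi (- s * int k) * (rep_act V (k, 0) * A) $$ (i, j))"
    using A by (simp add: act_elem_mult is_module_wf[OF V] sum_wproj del: index_mult_mat(1))
  also have "\<dots> = (\<Sum>k<n. q powi (- s * int k) * (gact V ^\<^sub>m k * A) $$ (i, j))"
    using n2 d by (intro sum.cong refl) (simp add: module_pair(2)[OF V] mat_simps del: index_mult_mat(1))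
  finally show ?thesis .
qed

text \<open>Multiplication by \<open>g\<close> shifts the sum over the powers of \<open>g\<close>
  cyclically, up to the factor \<open>q^s\<close>. The shift closes up because the terms with index
  \<open>n\<close> and 0 agree.\<close>

lemma wproj_gact:
  assumes V: "is_module K V"
  shows "gact V * act_elem K V (wproj s) = q powi s \<cdot>\<^sub>m act_elem K V (wproj s)"
    and "act_elem K V (wproj s) * gact V = q powi s \<cdot>\<^sub>m act_elem K V (wproj s)"
proof -
  note d = taft_pairD[OF module_pair(1)[OF V]]
  have shift: "(\<Sum>k<n. q powi (- s * int k) * (gact V ^\<^sub>m Suc k) $$ (i, j))
      = q powi s * act_elem K V (wproj s) $$ (i, j)" if ij: "i < rep_dim V" "j < rep_dim V" for i j
  proof -
    define \<phi> where "\<phi> k = q powi (- s * int k) * (gact V ^\<^sub>m k) $$ (i, j)" for k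
    have E: "act_elem K V (wproj s) $$ (i, j) = sum \<phi> {..<n}"
      using ij n2 d by (simp add: act_elem_entry sum_wproj \<phi>_def module_pair(2)[OF V] mat_simps)
    have "q powi (- s * int n) = 1"
      using q_powi_eq_iff[of "- s * int n" 0] by simp
    then have "\<phi> n = \<phi> 0" using d ij by (simp add: \<phi>_def)
    then have "sum \<phi> {..<n} = (\<Sum>k<n. \<phi> (Suc k))"
      using sum.lessThan_Suc_shift[of \<phi> n] by (simp add: add.commute)
    moreover have "q powi (- s * int k) * (gact V ^\<^sub>m Suc k) $$ (i, j) = q powi s * \<phi> (Suc k)" for k
    proof -
      have "q powi (- s * int k) = q powi s * q powi (- s * int (Suc k))"
        using q_nonzero by (subst power_int_add[symmetric]) (simp_all add: algebra_simps)
      then show ?thesis unfolding \<phi>_def by (simp only: mult.assoc)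
    qed
    ultimately show ?thesis unfolding E by (simp only: sum_distrib_left)
  qed
  show "gact V * act_elem K V (wproj s) = q powi s \<cdot>\<^sub>m act_elem K V (wproj s)"
    by (rule eq_matI) (use d V shift pow_mat_Suc_left[of "gact V"] in \<open>simp_all add: mult_wproj del: index_mult_mat(1)\<close>)
  show "act_elem K V (wproj s) * gact V = q powi s \<cdot>\<^sub>m act_elem K V (wproj s)"
    by (rule eq_matI) (use d V shift in \<open>simp_all add: wproj_mult del: index_mult_mat(1)\<close>)
qed

lemma gact_pow_wt_vec:
  assumes V: "is_module K V" and v: "wt_vec V r v"
  shows "gact V ^\<^sub>m k * v = (q powi r) ^ k \<cdot>\<^sub>m v"
proof (induction k)
  case 0
  then show ?case using v by (simp add: wt_vec_def mat_simps smult_mat_one taft_pairD[OF module_pair(1)[OF V]])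
next
  case (Suc k)
  note d = taft_pairD[OF module_pair(1)[OF V]]
  have dv: "dim_row v = rep_dim V" "gact V * v = q powi r \<cdot>\<^sub>m v" using v by (simp_all add: wt_vec_def)
  have "gact V ^\<^sub>m Suc k * v = gact V ^\<^sub>m k * (gact V * v)" using d dv by (simp add: mult_mat_assoc)
  then show ?case using d dv Suc by (simp add: mult_mat_smult_right smult_mat_smult)
qed

lemma wproj_wt_vec:
  assumes V: "is_module K V" and v: "wt_vec V r v"
  shows "act_elem K V (wproj r) * v = of_nat n \<cdot>\<^sub>m v"
proof (rule eq_matI)
  fix i j assume "i < dim_row (of_nat n \<cdot>\<^sub>m v)" "j < dim_col (of_nat n \<cdot>\<^sub>m v)"
  then have ij: "i < rep_dim V" "j < dim_col v" "i < dim_row v" using v by (simp_all add: wt_vec_def)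
  have "(act_elem K V (wproj r) * v) $$ (i, j) = (\<Sum>k<n. q powi (- r * int k) * (q powi r) ^ k * v $$ (i, j))"
    using ij v by (subst wproj_mult[OF V]) (simp_all add: wt_vec_def[of V r v] gact_pow_wt_vec[OF V v] mult.assoc del: index_mult_mat(1))
  also have "\<dots> = (\<Sum>k<n. v $$ (i, j))"
  proof (rule sum.cong)
    fix k
    have "(q powi r) ^ k = q powi (r * int k)" by (simp add: power_int_mult)
    then have "q powi (- r * int k) * (q powi r) ^ k = 1"
      using q_nonzero by (simp flip: power_int_add)
    then show "q powi (- r * int k) * (q powi r) ^ k * v $$ (i, j) = v $$ (i, j)" by simp
  qed simp
  finally show "(act_elem K V (wproj r) * v) $$ (i, j) = (of_nat n \<cdot>\<^sub>m v) $$ (i, j)" using ij by simp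
qed (use v in \<open>simp_all add: wt_vec_def\<close>)

text \<open>Orthogonality of the characters of the cyclic group: summing over all weights
  \<open>s\<close> leaves only the term \<open>k = 0\<close>.\<close>

lemma sum_wproj_one:
  assumes V: "is_module K V" and A: "dim_col A = rep_dim V" "i < dim_row A" "j < rep_dim V"
  shows "(\<Sum>s<n. (A * act_elem K V (wproj (int s))) $$ (i, j)) = of_nat n * A $$ (i, j)"
proof -
  note d = taft_pairD[OF module_pair(1)[OF V]]
  have "(\<Sum>s<n. (A * act_elem K V (wproj (int s))) $$ (i, j))
      = (\<Sum>k<n. (\<Sum>s<n. q powi (- int s * int k)) * (A * gact V ^\<^sub>m k) $$ (i, j))"
    unfolding mult_wproj[OF V A] by (subst sum.swap) (simp only: sum_distrib_right)
  also have "\<dots> = (\<Sum>k<n. (if k = 0 then of_nat n else 0) * (A * gact V ^\<^sub>m k) $$ (i, j))"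
  proof (rule sum.cong)
    fix k assume k: "k \<in> {..<n}"
    have "(\<Sum>s<n. q powi (- int s * int k)) = (\<Sum>s<n. (q powi (- int k)) ^ s)"
    proof (rule sum.cong)
      fix s
      have "(q powi (- int k)) ^ s = (q powi (- int k)) powi int s" by simp
      also have "\<dots> = q powi (- int s * int k)"
        by (simp only: power_int_mult[symmetric]) (simp add: mult.commute)
      finally show "q powi (- int s * int k) = (q powi (- int k)) ^ s" ..
    qed simp
    also have "\<dots> = (if k = 0 then of_nat n else 0)"
    proof (cases "k = 0")
      case False
      then have "q powi (- int k) \<noteq> 1" using k prim[of k] q_nonzero by (simp add: power_int_minus)
      then show ?thesis using False geometric_root_sum[OF q_powi_n] by simp
    qed simp
    finally show "(\<Sum>s<n. q powi (- int s * int k)) * (A * gact V ^\<^sub>m k) $$ (i, j)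
      = (if k = 0 then of_nat n else 0) * (A * gact V ^\<^sub>m k) $$ (i, j)" by simp
  qed simp
  also have "\<dots> = of_nat n * A $$ (i, j)"
    using n2 d A by (simp add: sum_delta_right(2) mat_simps del: index_mult_mat(1))
  finally show ?thesis .
qed

text \<open>The summand is generated by a weight vector of maximal height \<open>l\<close>.\<close>

lemma split_M:
  assumes V: "is_module K V" and d0: "0 < rep_dim V"
  obtains l r W where "1 \<le> l" "l \<le> n" "is_module K W" "biproduct K V (M l r) W" "rep_dim V = l + rep_dim W"
    "hact V ^\<^sub>m l = 0\<^sub>m (rep_dim V) (rep_dim V)"
proof -
  let ?d = "rep_dim V" and ?H = "hact V"
  note d = taft_pairD[OF module_pair(1)[OF V]]
  \<comment> \<open>The nilpotency index of \<open>h\<close> on all of \<open>V\<close>. Its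
    maximality makes the covector below satisfy \<open>f0\<close>.\<close>
  define l where "l = (LEAST k. ?H ^\<^sub>m k = 0\<^sub>m ?d ?d)"
  have l0: "?H ^\<^sub>m l = 0\<^sub>m ?d ?d" and ln: "l \<le> n"
    using LeastI[of "\<lambda>k. ?H ^\<^sub>m k = 0\<^sub>m ?d ?d" n] Least_le[of "\<lambda>k. ?H ^\<^sub>m k = 0\<^sub>m ?d ?d" n] d
    by (auto simp: l_def)
  have "l \<noteq> 0"
  proof
    assume "l = 0"
    then have "1\<^sub>m ?d $$ (0, 0) = (0\<^sub>m ?d ?d :: 'k mat) $$ (0, 0)" using l0 d by simp
    then show False using d0 by simp
  qed
  then have l1: "1 \<le> l" by simp
  have "?H ^\<^sub>m (l - 1) \<noteq> 0\<^sub>m ?d ?d"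
    using not_less_Least[of "l - 1" "\<lambda>k. ?H ^\<^sub>m k = 0\<^sub>m ?d ?d"] l1 by (simp add: l_def[symmetric])
  moreover have "?H ^\<^sub>m (l - 1) = 0\<^sub>m ?d ?d" if "\<forall>a<?d. \<forall>b<?d. (?H ^\<^sub>m (l - 1)) $$ (a, b) = 0"
    using that d by (intro eq_matI) simp_all
  ultimately obtain a b where ab: "a < ?d" "b < ?d" "(?H ^\<^sub>m (l - 1)) $$ (a, b) \<noteq> 0" by blast
  let ?E = "\<lambda>s. act_elem K V (wproj s)"
  \<comment> \<open>The projections add up to the nonzero scalar \<open>n\<close>, so the nonzero
    entry of \<open>?H ^ (l - 1)\<close> survives on some weight space.\<close>
  have "(\<Sum>s<n. (?H ^\<^sub>m (l - 1) * ?E (int s)) $$ (a, b)) \<noteq> 0"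
    using sum_wproj_one[OF V, of "?H ^\<^sub>m (l - 1)" a b] ab d of_nat_n_nonzero by simp
  then obtain s where s: "(?H ^\<^sub>m (l - 1) * ?E (int s)) $$ (a, b) \<noteq> 0"
    by (meson sum.neutral)
  define u where "u = mat ?d 1 (\<lambda>(i, j). if i = b then 1 else (0 :: 'k))"
  define w where "w = mat 1 ?d (\<lambda>(i, j). if j = a then 1 else (0 :: 'k))"
  have du: "dim_row u = ?d" "dim_col u = 1" "dim_row w = 1" "dim_col w = ?d" by (simp_all add: u_def w_def)
  have mu: "(A * u) $$ (i, 0) = A $$ (i, b)" if "dim_col A = ?d" "i < dim_row A" for A i
  proof -
    have "(A * u) $$ (i, 0) = (\<Sum>t<?d. A $$ (i, t) * (if t = b then 1 else 0))"
      using that du by (subst mult_mat_entry) (auto simp: u_def intro!: sum.cong)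
    then show ?thesis using ab by (simp add: sum_delta_right)
  qed
  have wm: "(w * A) $$ (0, j) = A $$ (a, j)" if "dim_row A = ?d" "j < dim_col A" for A j
  proof -
    have "(w * A) $$ (0, j) = (\<Sum>t<?d. (if t = a then 1 else 0) * A $$ (t, j))"
      using that du by (subst mult_mat_entry) (auto simp: w_def intro!: sum.cong)
    then show ?thesis using ab by (simp add: sum_delta_right)
  qed
  define v where "v = ?E (int s) * u"
  have dv: "dim_row v = ?d" "dim_col v = 1" using du by (simp_all add: v_def)
  have v: "wt_vec V (int s) v"
    unfolding wt_vec_def using dv du d wproj_gact(1)[OF V, of "int s"]
    by (simp add: v_def mult_mat_smult_left flip: mult_mat_assoc)
  \<comment> \<open>The weight of \<open>?x\<close>, the last nonzero iterate of \<open>v\<close>. A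
    covector has to carry this weight to pair nontrivially with \<open>?x\<close>.\<close>
  define t where "t = int s - int l + 1"
  let ?x = "?H ^\<^sub>m (l - 1) * v"
  have "int s - int (l - 1) = t" using l1 by (simp add: t_def)
  then have x: "wt_vec V t ?x" using wt_vec_hact_pow[OF V v, of "l - 1"] by simp
  have x0: "?x $$ (a, 0) \<noteq> 0"
  proof -
    have "?x = (?H ^\<^sub>m (l - 1) * ?E (int s)) * u" using d du by (simp add: v_def mult_mat_assoc)
    then show ?thesis using s mu[of "?H ^\<^sub>m (l - 1) * ?E (int s)" a] ab d by simp
  qed
  \<comment> \<open>Normalizes \<open>f * ?x\<close> to 1; the factor \<open>n\<close> comes from
    \<open>?E t\<close>, which acts on \<open>?x\<close> as \<open>n\<close>.\<close>
  define c where "c = inverse (of_nat n * ?x $$ (a, 0))"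
  define f where "f = c \<cdot>\<^sub>m (w * ?E t)"
  have df: "dim_row f = 1" "dim_col f = ?d" using du by (simp_all add: f_def)
  have f: "wt_covec V t f"
    unfolding wt_covec_def using df du d wproj_gact(2)[OF V, of t]
    by (simp add: f_def mult_mat_smult_left mult_mat_smult_right mult_mat_assoc smult_mat_smult mult.commute)
  have dx: "dim_row ?x = ?d" "dim_col ?x = 1" using d dv by simp_all
  have "f * ?x = c \<cdot>\<^sub>m (w * (?E t * ?x))"
    unfolding f_def using du dx by (simp add: mult_mat_smult_left mult_mat_assoc)
  also have "\<dots> = c \<cdot>\<^sub>m (of_nat n \<cdot>\<^sub>m (w * ?x))"
    unfolding wproj_wt_vec[OF V x] using du dx by (simp add: mult_mat_smult_right)
  finally have "(f * ?x) $$ (0, 0) = c * (of_nat n * ?x $$ (a, 0))"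
    using wm[OF dx(1), of 0] dx du by (simp del: index_mult_mat(1))
  moreover have "of_nat n * ?x $$ (a, 0) \<noteq> 0" using x0 of_nat_n_nonzero by simp
  ultimately have one: "(f * ?x) $$ (0, 0) = 1" by (simp add: c_def del: inverse_mult_distrib)
  have v0: "?H ^\<^sub>m l * v = 0\<^sub>m ?d 1" and f0: "f * ?H ^\<^sub>m l = 0\<^sub>m 1 ?d"
    unfolding l0 using dv df by (simp_all add: mat_simps)
  note P = hom_cyc[OF V ln v v0] and Q = hom_cocyc[OF V l1 ln f[unfolded t_def] f0]
  have "cocyc_mat V l f * cyc_mat V l v = 1\<^sub>m (rep_dim (M l (int s)))"
    using cocyc_cyc_one[OF V l1 ln v v0 f[unfolded t_def] one] by simp
  from split_summand[OF V module_M(1)[OF ln] P Q this] that[OF l1 ln _ _ _ l0] show thesis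
    by (metis dim_M)
qed

text \<open>The summand split off by \<open>split_M\<close> has length equal to the nilpotency index
  of \<open>h\<close>, which is \<open>n\<close> here, and it fills the whole dimension.\<close>

lemma top_height_iso:
  assumes V: "is_module K V" and "rep_dim V = n" and "hact V ^\<^sub>m (n - 1) \<noteq> 0\<^sub>m n n"
  obtains r where "module_iso K V (M n r)"
proof -
  have "0 < rep_dim V" using assms n2 by simp
  then obtain l r W where lr: "1 \<le> l" "l \<le> n" "biproduct K V (M l r) W" "rep_dim V = l + rep_dim W"
    "hact V ^\<^sub>m l = 0\<^sub>m (rep_dim V) (rep_dim V)"
    by (rule split_M[OF V]) blast
  note d = taft_pairD[OF module_pair(1)[OF V]]
  have "l = n"
  proof (rule ccontr)
    assume "l \<noteq> n"
    then have "l \<le> n - 1" using lr by simp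
    then show False using pow_mat_zero_mono[of "hact V" l "n - 1"] lr d assms by simp
  qed
  moreover from this have "rep_dim W = 0" using lr assms by simp
  ultimately show thesis using biproduct_zero_right[OF lr(3)] that by simp
qed

end

section \<open>Tensoring with the two-dimensional module\<close>

lemma hom_mat_hcat:
  assumes wf: "rep_wf A U1" "rep_wf A U2" "rep_wf A V" and P: "hom_mat A U1 V P1" "hom_mat A U2 V P2"
  shows "hom_mat A (direct_sum U1 U2) V (hcat P1 P2)"
  unfolding hom_mat_def
proof (intro conjI ballI)
  fix b assume b: "b \<in> alg_basis A"
  note d = hom_matD(1,2)[OF P(1)] hom_matD(1,2)[OF P(2)] rep_wfD[OF wf(1) b] rep_wfD[OF wf(2) b] rep_wfD[OF wf(3) b]
  show "hcat P1 P2 * rep_act (direct_sum U1 U2) b = rep_act V b * hcat P1 P2"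
    using d by (simp add: direct_sum_def hcat_mult_four_block mult_hcat hom_matD(3)[OF P(1) b] hom_matD(3)[OF P(2) b])
qed (use hom_matD[OF P(1)] hom_matD[OF P(2)] in simp_all)

text \<open>\<open>Q1\<close> and \<open>Q2\<close> are mere matrices that certify invertibility of
  \<open>hcat P1 P2\<close>. The product \<open>Q2 * P1\<close> is arbitrary, so the system is
  triangular and is made diagonal by passing from \<open>Q2\<close> to \<open>R\<close>. The
  dimension count turns the left inverse into a two-sided one.\<close>

lemma two_summands:
  assumes wf: "rep_wf A U1" "rep_wf A U2" "rep_wf A V"
    and P: "hom_mat A U1 V P1" "hom_mat A U2 V P2"
    and Q1: "dim_row Q1 = rep_dim U1" "dim_col Q1 = rep_dim V"
    and Q2: "dim_row Q2 = rep_dim U2" "dim_col Q2 = rep_dim V"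
    and e: "Q1 * P1 = 1\<^sub>m (rep_dim U1)" "Q1 * P2 = 0\<^sub>m (rep_dim U1) (rep_dim U2)" "Q2 * P2 = 1\<^sub>m (rep_dim U2)"
    and dim: "rep_dim V = rep_dim U1 + rep_dim U2"
  shows "module_iso A V (direct_sum U1 U2)"
proof -
  note d = hom_matD(1,2)[OF P(1)] hom_matD(1,2)[OF P(2)] Q1 Q2
  let ?d = "rep_dim U1 + rep_dim U2"
  define R where "R = Q2 - Q2 * (P1 * Q1)"
  have dR: "dim_row R = rep_dim U2" "dim_col R = rep_dim V" using d by (simp_all add: R_def)
  have 1: "R * P1 = 0\<^sub>m (rep_dim U2) (rep_dim U1)"
  proof -
    have "R * P1 = Q2 * P1 - Q2 * (P1 * (Q1 * P1))"
      using d by (simp add: R_def mult_mat_minus_left mult_mat_assoc)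
    then show ?thesis using d by (auto simp: e mat_simps)
  qed
  have 2: "R * P2 = 1\<^sub>m (rep_dim U2)"
  proof -
    have "R * P2 = Q2 * P2 - Q2 * (P1 * (Q1 * P2))"
      using d by (simp add: R_def mult_mat_minus_left mult_mat_assoc)
    then show ?thesis using d by (simp add: e mat_simps) (rule eq_matI, simp_all)
  qed
  have LP: "vcat Q1 R * hcat P1 P2 = 1\<^sub>m ?d"
    using d dR by (simp add: vcat_mult_hcat e 1 2)
  have c: "vcat Q1 R \<in> carrier_mat ?d ?d" "hcat P1 P2 \<in> carrier_mat ?d ?d"
    using d dR dim by (auto intro!: carrier_matI)
  have PL: "hcat P1 P2 * vcat Q1 R = 1\<^sub>m ?d"
    by (rule mat_mult_left_right_inverse[OF c LP])
  have h: "hom_mat A (direct_sum U1 U2) V (hcat P1 P2)" by (rule hom_mat_hcat[OF wf P])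
  have "module_iso A (direct_sum U1 U2) V"
    by (rule module_isoI[OF h, of "vcat Q1 R"]) (use d dR dim LP PL in simp_all)
  then show ?thesis by (rule module_iso_sym) (use wf rep_wf_direct_sum in auto)
qed

definition ucol :: "nat \<Rightarrow> nat \<Rightarrow> 'k::field mat" where
  "ucol m a = mat m 1 (\<lambda>(i, j). if i = a then 1 else 0)"

definition urow :: "nat \<Rightarrow> nat \<Rightarrow> 'k::field mat" where
  "urow m a = mat 1 m (\<lambda>(i, j). if j = a then 1 else 0)"

lemma dim_ucol [simp]: "dim_row (ucol m a) = m" "dim_col (ucol m a) = 1"
  and dim_urow [simp]: "dim_row (urow m a) = 1" "dim_col (urow m a) = m"
  by (simp_all add: ucol_def urow_def)

lemma urow_ucol: "(urow m a * ucol m b :: 'k::field mat) = (if a = b \<and> a < m then 1 else 0) \<cdot>\<^sub>m 1\<^sub>m 1"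
proof (rule eq_matI)
  fix i j assume "i < dim_row ((if a = b \<and> a < m then 1 else 0) \<cdot>\<^sub>m 1\<^sub>m 1 :: 'k mat)"
    "j < dim_col ((if a = b \<and> a < m then 1 else 0) \<cdot>\<^sub>m 1\<^sub>m 1 :: 'k mat)"
  then have ij: "i = 0" "j = 0" by simp_all
  have "(urow m a * ucol m b :: 'k mat) $$ (0, 0) = (\<Sum>t<m. (if t = a then 1 else 0) * (if t = b then 1 else 0))"
    by (subst mult_mat_entry) (simp_all add: urow_def ucol_def)
  then show "(urow m a * ucol m b :: 'k mat) $$ (i, j) = ((if a = b \<and> a < m then 1 else 0) \<cdot>\<^sub>m 1\<^sub>m 1) $$ (i, j)"
    using ij by (simp add: sum_delta_right del: index_mult_mat(1))
qed simp_all

lemma ucol_zero: "m \<le> a \<Longrightarrow> ucol m a = 0\<^sub>m m 1"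
  by (rule eq_matI) (auto simp: ucol_def)

context taft_param begin

lemma taft_h_ucol: "taft_h_mat l * ucol l a = (ucol l (a + 1) :: 'k mat)"
proof (rule eq_matI)
  fix i j assume "i < dim_row (ucol l (a + 1) :: 'k mat)" "j < dim_col (ucol l (a + 1) :: 'k mat)"
  then show "(taft_h_mat l * ucol l a :: 'k mat) $$ (i, j) = ucol l (a + 1) $$ (i, j)"
    by (subst taft_h_mult_entry) (auto simp: ucol_def)
qed simp_all

lemma taft_g_ucol: "taft_g_mat q l r * ucol l a = q powi (r - int a) \<cdot>\<^sub>m ucol l a"
proof (rule eq_matI)
  fix i j assume "i < dim_row (q powi (r - int a) \<cdot>\<^sub>m ucol l a)" "j < dim_col (q powi (r - int a) \<cdot>\<^sub>m ucol l a)"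
  then show "(taft_g_mat q l r * ucol l a) $$ (i, j) = (q powi (r - int a) \<cdot>\<^sub>m ucol l a) $$ (i, j)"
    by (subst taft_g_mult_entry) (auto simp: ucol_def)
qed simp_all

lemma urow_taft_g: "urow l a * taft_g_mat q l r = q powi (r - int a) \<cdot>\<^sub>m urow l a"
proof (rule eq_matI)
  fix i j assume "i < dim_row (q powi (r - int a) \<cdot>\<^sub>m urow l a)" "j < dim_col (q powi (r - int a) \<cdot>\<^sub>m urow l a)"
  then show "(urow l a * taft_g_mat q l r) $$ (i, j) = (q powi (r - int a) \<cdot>\<^sub>m urow l a) $$ (i, j)"
    by (subst mult_taft_g_entry) (auto simp: urow_def)
qed simp_all

text \<open>\<open>M 1 s\<close> is a character: it shifts all weights by \<open>s\<close> and
  leaves \<open>h\<close> unchanged. In particular its class is invertible, with inverse that of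
  \<open>M 1 (- s)\<close>.\<close>

lemma tensor_M1:
  assumes "l \<le> n" shows "module_iso K (tensor_module K (M 1 s) (M l r)) (M l (r + s))"
proof (rule module_iso_eqI)
  have 1: "(1::nat) \<le> n" using n2 by simp
  note m = module_M[OF 1] module_M[OF assms]
  have g1: "taft_g_mat q 1 s = q powi s \<cdot>\<^sub>m 1\<^sub>m 1" and h1: "taft_h_mat 1 = (0\<^sub>m 1 1 :: 'k mat)"
    by (rule eq_matI; simp add: taft_g_mat_def taft_h_mat_def)+
  show "is_module K (tensor_module K (M 1 s) (M l r))" by (rule tensor_module_K(1)[OF m(1,4)])
  show "is_module K (M l (r + s))" by (rule module_M(1)[OF assms])
  have "q powi s \<cdot>\<^sub>m taft_g_mat q l r = taft_g_mat q l (r + s)"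
    by (rule eq_matI) (use q_nonzero in \<open>auto simp: taft_g_mat_def algebra_simps simp flip: power_int_add\<close>)
  then show "gact (tensor_module K (M 1 s) (M l r)) = gact (M l (r + s))"
    by (simp only: tensor_module_K(2)[OF m(1,4)] m g1 kronecker_smult_left kronecker_one_left module_M[OF assms])
  show "hact (tensor_module K (M 1 s) (M l r)) = hact (M l (r + s))"
    by (simp only: tensor_module_K(3)[OF m(1,4)] m h1 dim_M kronecker_zero_left kronecker_one_left module_M[OF assms])
      (simp add: mat_add_zero)
qed simp

text \<open>Here \<open>x a\<close> and \<open>z a\<close> are the tensors of the two basis vectors
  of \<open>M 2 0\<close> with the vector of index \<open>a\<close> in \<open>M l r\<close>, and
  \<open>\<phi>\<close> is the dual basis. One has
  \<open>h (x a) = x (a + 1) + q^(r - a) * z a\<close> and \<open>h (z a) = z (a + 1)\<close>; the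
  number \<open>c k\<close> collects the weights picked up along \<open>k\<close> applications of
  \<open>h\<close>.\<close>

lemma tensor_M2_aux:
  assumes l: "1 \<le> l" "l \<le> n"
    and X_def: "X = tensor_module K (M 2 0) (M l r)"
    and x_def: "x = (\<lambda>a. kronecker (ucol 2 0) (ucol l a))"
    and z_def: "z = (\<lambda>a. kronecker (ucol 2 1) (ucol l a))"
    and \<phi>_def: "\<phi> = (\<lambda>i a. kronecker (urow 2 i) (urow l a))"
    and c_def: "c = (\<lambda>k::nat. \<Sum>i<k. q powi (r - int i))"
  shows "is_module K X" and "wt_vec X r (x 0)" and "wt_vec X (r - 1) (z 0)"
    and "a < l \<Longrightarrow> i < 2 \<Longrightarrow> wt_covec X (r - int a - int i) (\<phi> i a)"
    and "hact X ^\<^sub>m k * z 0 = z k" and "hact X ^\<^sub>m k * x 0 = x k + c k \<cdot>\<^sub>m z (k - 1)"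
    and "hact X ^\<^sub>m (l + 1) = 0\<^sub>m (2 * l) (2 * l)"
    and "\<phi> i a * x b = (if i = 0 \<and> a = b \<and> a < l then 1 else 0) \<cdot>\<^sub>m 1\<^sub>m 1"
    and "\<phi> i a * z b = (if i = 1 \<and> a = b \<and> a < l then 1 else 0) \<cdot>\<^sub>m 1\<^sub>m 1"
proof -
  note m = module_M[OF n2] module_M[OF l(2)]
  note t = tensor_module_K[OF module_M(1)[OF n2, of 0] module_M(1)[OF l(2), of r], folded X_def]
  show X: "is_module K X" by (rule t(1))
  have g: "gact X = kronecker (taft_g_mat q 2 0) (taft_g_mat q l r)"
    and h: "hact X = kronecker (1\<^sub>m 2) (taft_h_mat l) + kronecker (taft_h_mat 2) (taft_g_mat q l r)"
    using t m by simp_all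
  have dX: "rep_dim X = 2 * l" by (simp add: X_def)
  note dH = taft_pairD(3,4)[OF module_pair(1)[OF X], unfolded dX]
  have dx: "dim_row (x a) = 2 * l" "dim_col (x a) = 1" "dim_row (z a) = 2 * l" "dim_col (z a) = 1"
    "dim_row (\<phi> i a) = 1" "dim_col (\<phi> i a) = 2 * l" for a i
    by (simp_all add: x_def z_def \<phi>_def)
  have "gact X * x 0 = q powi r \<cdot>\<^sub>m x 0"
    by (simp add: g x_def kronecker_mult taft_g_ucol kronecker_smult_left kronecker_smult_right smult_mat_one)
  then show "wt_vec X r (x 0)" using dx dX by (simp add: wt_vec_def)
  have q1: "q powi r * inverse q = q powi (r - 1)"
    using power_int_diff[of q r 1] q_nonzero by (simp add: field_simps)
  have "gact X * z 0 = q powi (r - 1) \<cdot>\<^sub>m z 0"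
    using q_nonzero by (simp add: q1 g z_def kronecker_mult taft_g_ucol kronecker_smult_left kronecker_smult_right
        smult_mat_smult)
  then show "wt_vec X (r - 1) (z 0)" using dx dX by (simp add: wt_vec_def)
  show "wt_covec X (r - int a - int i) (\<phi> i a)" if "a < l" "i < 2"
  proof -
    have "\<phi> i a * gact X = q powi (r - int a - int i) \<cdot>\<^sub>m \<phi> i a"
      using q_nonzero by (simp add: g \<phi>_def kronecker_mult urow_taft_g kronecker_smult_left kronecker_smult_right
          smult_mat_smult algebra_simps flip: power_int_add)
    then show ?thesis using dx dX by (simp add: wt_covec_def)
  qed
  have h1': "ucol 2 (Suc (Suc 0)) = (0\<^sub>m 2 1 :: 'k mat)" by (rule ucol_zero) simp
  have h0: "taft_h_mat 2 * ucol 2 0 = (ucol 2 1 :: 'k mat)" using taft_h_ucol[of 2 0] by simp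
  have Hz: "hact X * z a = z (a + 1)" for a
  proof -
    have "hact X * z a = kronecker (ucol 2 1) (ucol l (a + 1)) + kronecker (0\<^sub>m 2 1) (taft_g_mat q l r * ucol l a)"
      unfolding h z_def by (simp add: mult_mat_add_left kronecker_mult taft_h_ucol h1' mat_simps)
    then show ?thesis by (simp add: z_def kronecker_zero_left mat_add_zero)
  qed
  have Hx: "hact X * x a = x (a + 1) + q powi (r - int a) \<cdot>\<^sub>m z a" for a
    unfolding h x_def z_def
    by (simp add: mult_mat_add_left kronecker_mult taft_h_ucol h0 taft_g_ucol kronecker_smult_right mat_simps)
  have pz: "hact X ^\<^sub>m k * z 0 = z k" for k
  proof (induction k)
    case 0 then show ?case using dH dx by (simp add: mat_simps)
  next
    case (Suc k)
    have "hact X ^\<^sub>m Suc k * z 0 = hact X * (hact X ^\<^sub>m k * z 0)"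
      using dH dx pow_mat_Suc_left[of "hact X" k] by (simp add: mult_mat_assoc)
    then show ?case using Suc Hz by simp
  qed
  then show "hact X ^\<^sub>m k * z 0 = z k" .
  show "hact X ^\<^sub>m k * x 0 = x k + c k \<cdot>\<^sub>m z (k - 1)"
  proof (induction k)
    case 0
    \<comment> \<open>At \<open>k = 0\<close> the truncated index \<open>k - 1\<close> does no harm,
      because \<open>c 0 = 0\<close>.\<close>
    have "0 \<cdot>\<^sub>m z 0 = 0\<^sub>m (2 * l) 1" by (rule eq_matI) (use dx in auto)
    then show ?case using dH dx by (simp add: mat_simps c_def mat_add_zero)
  next
    case (Suc k)
    have "hact X ^\<^sub>m Suc k * x 0 = hact X * (hact X ^\<^sub>m k * x 0)"
      using dH dx pow_mat_Suc_left[of "hact X" k] by (simp add: mult_mat_assoc)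
    also have "\<dots> = x (k + 1) + q powi (r - int k) \<cdot>\<^sub>m z k + c k \<cdot>\<^sub>m z (k - 1 + 1)"
      unfolding Suc using dH dx by (simp add: mult_mat_add_right mult_mat_smult_right Hx Hz)
    also have "\<dots> = x (Suc k) + c (Suc k) \<cdot>\<^sub>m z k"
    proof (cases k)
      case 0
      then show ?thesis by (intro eq_matI) (use dx in \<open>simp_all add: c_def\<close>)
    next
      case (Suc j)
      then show ?thesis by (intro eq_matI) (use dx in \<open>simp_all add: c_def algebra_simps\<close>)
    qed
    finally show ?case by simp
  qed
  show "hact X ^\<^sub>m (l + 1) = 0\<^sub>m (2 * l) (2 * l)"
  proof (rule eq_matI)
    let ?A = "kronecker (1\<^sub>m 2) (taft_h_mat l :: 'k mat)" and ?B = "kronecker (taft_h_mat 2) (taft_g_mat q l r)"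
    fix i j assume "i < dim_row (0\<^sub>m (2 * l) (2 * l) :: 'k mat)" "j < dim_col (0\<^sub>m (2 * l) (2 * l) :: 'k mat)"
    then have ij: "i < 2 * l" "j < 2 * l" by simp_all
    have "?A * ?B = q \<cdot>\<^sub>m (?B * ?A)"
      using taft_pairD(7)[OF taft_pair_M[OF l(2), of r]]
      by (simp add: kronecker_mult kronecker_smult_right mat_simps)
    then have "((?A + ?B) ^\<^sub>m (l + 1)) $$ (i, j)
        = (\<Sum>k\<le>l + 1. gbinom q (l + 1) k * (?B ^\<^sub>m k * ?A ^\<^sub>m (l + 1 - k)) $$ (i, j))"
      by (intro gbinomial_theorem_mat[of _ "2 * l"] ij) simp_all
    \<comment> \<open>Terms with \<open>k >= 2\<close> contain the square of
      \<open>taft_h_mat 2\<close>, the others contain at least the \<open>l\<close>-th power of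
      \<open>taft_h_mat l\<close>.\<close>
    also have "\<dots> = 0"
    proof (rule sum.neutral, rule ballI)
      fix k
      have A: "?A ^\<^sub>m (l + 1 - k) = 0\<^sub>m (2 * l) (2 * l)" if "k < 2"
      proof -
        have "taft_h_mat l ^\<^sub>m (l + 1 - k) = (0\<^sub>m l l :: 'k mat)"
          using that by (intro eq_matI) (auto simp: taft_h_pow_entry)
        then show ?thesis by (simp add: kronecker_pow kronecker_zero_right)
      qed
      have B: "?B ^\<^sub>m k = 0\<^sub>m (2 * l) (2 * l)" if "2 \<le> k"
      proof -
        have "taft_h_mat 2 ^\<^sub>m k = (0\<^sub>m 2 2 :: 'k mat)"
          using that by (intro eq_matI) (auto simp: taft_h_pow_entry)
        then show ?thesis by (simp add: kronecker_pow kronecker_zero_left)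
      qed
      have "?B ^\<^sub>m k * ?A ^\<^sub>m (l + 1 - k) = 0\<^sub>m (2 * l) (2 * l)"
        using A B by (cases "k < 2") (simp_all add: mat_simps)
      then show "gbinom q (l + 1) k * (?B ^\<^sub>m k * ?A ^\<^sub>m (l + 1 - k)) $$ (i, j) = 0" using ij by simp
    qed
    finally show "(hact X ^\<^sub>m (l + 1)) $$ (i, j) = 0\<^sub>m (2 * l) (2 * l) $$ (i, j)" using ij by (simp add: h)
  qed (use dH in simp_all)
  have s1: "kronecker (u \<cdot>\<^sub>m 1\<^sub>m 1) (w \<cdot>\<^sub>m 1\<^sub>m 1) = (u * w) \<cdot>\<^sub>m (1\<^sub>m 1 :: 'k mat)" for u w
    by (simp only: kronecker_smult_left kronecker_smult_right kronecker_one_left smult_mat_smult mult.commute)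
  have p: "kronecker (urow 2 i) (urow l a) * kronecker (ucol 2 j) (ucol l b)
      = ((if i = j \<and> i < 2 then 1 else 0) * (if a = b \<and> a < l then 1 else 0)) \<cdot>\<^sub>m (1\<^sub>m 1 :: 'k mat)" for i j
    by (subst kronecker_mult) (simp_all only: dim_ucol dim_urow urow_ucol s1)
  show "\<phi> i a * x b = (if i = 0 \<and> a = b \<and> a < l then 1 else 0) \<cdot>\<^sub>m 1\<^sub>m 1"
    "\<phi> i a * z b = (if i = 1 \<and> a = b \<and> a < l then 1 else 0) \<cdot>\<^sub>m 1\<^sub>m 1"
    unfolding \<phi>_def x_def z_def p by (cases "i = 0"; cases "i = 1"; simp)+
qed

lemma rows_mult_cyc:
  assumes V: "is_module K V" and v: "dim_row v = rep_dim V" "dim_col v = 1"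
    and F: "\<And>j. j < m \<Longrightarrow> dim_row (F j) = 1 \<and> dim_col (F j) = rep_dim V"
    and jk: "j < m" "k < l"
  shows "(mat m (rep_dim V) (\<lambda>(j, t). F j $$ (0, t)) * cyc_mat V l v) $$ (j, k)
    = (F j * (hact V ^\<^sub>m k * v)) $$ (0, 0)"
proof -
  note d = taft_pairD[OF module_pair(1)[OF V]]
  let ?Q = "mat m (rep_dim V) (\<lambda>(j, t). F j $$ (0, t))"
  have "(?Q * cyc_mat V l v) $$ (j, k) = (?Q * (hact V ^\<^sub>m k * v)) $$ (j, 0)"
    using jk by (intro mult_cyc_entry[OF V v]) simp_all
  also have "\<dots> = (F j * (hact V ^\<^sub>m k * v)) $$ (0, 0)"
    using jk d v F[OF jk(1)]
    by (simp add: mult_mat_entry[of _ ?Q] mult_mat_entry[of 0 "F j"] del: index_mult_mat(1))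
  finally show ?thesis .
qed

text \<open>The \<open>l\<close>-th iterate of \<open>x 0\<close> is \<open>c l * z (l - 1)\<close>,
  nonzero for \<open>l < n\<close>, so \<open>x 0\<close> generates a copy of
  \<open>M (l + 1) r\<close>. The corrected vector \<open>y = h (x 0) - c l * z 0\<close> has weight
  \<open>r - 1\<close> and dies after \<open>l - 1\<close> steps, which gives the other summand; for
  \<open>l = 1\<close> that is the zero module.\<close>

lemma tensor_M2_lt:
  assumes l: "1 \<le> l" "l < n"
  shows "module_iso K (tensor_module K (M 2 0) (M l r)) (direct_sum (M (l + 1) r) (M (l - 1) (r - 1)))"
proof -
  have ln: "l \<le> n" using l by simp
  define X where "X = tensor_module K (M 2 0) (M l r)"
  define x where "x = (\<lambda>a. kronecker (ucol 2 0) (ucol l a) :: 'k mat)"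
  define z where "z = (\<lambda>a. kronecker (ucol 2 1) (ucol l a) :: 'k mat)"
  define \<phi> where "\<phi> = (\<lambda>i a. kronecker (urow 2 i) (urow l a) :: 'k mat)"
  define c where "c = (\<lambda>k::nat. \<Sum>i<k. q powi (r - int i))"
  note aux = tensor_M2_aux[OF l(1) ln X_def x_def z_def \<phi>_def c_def]
  note X = aux(1)
  have dX: "rep_dim X = 2 * l" by (simp add: X_def)
  have dx: "dim_row (x a) = 2 * l" "dim_col (x a) = 1" "dim_row (z a) = 2 * l" "dim_col (z a) = 1"
    "dim_row (\<phi> i a) = 1" "dim_col (\<phi> i a) = 2 * l" for a i
    by (simp_all add: x_def z_def \<phi>_def)
  note dH = taft_pairD(3,4)[OF module_pair(1)[OF X], unfolded dX]
  \<comment> \<open>Up to the factor \<open>q^r\<close> this is a geometric sum in the inverse of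
    \<open>q\<close>; it could vanish only if \<open>q ^ l = 1\<close>.\<close>
  have cl: "c l \<noteq> 0"
  proof
    assume "c l = 0"
    have "c l = q powi r * (\<Sum>i<l. (inverse q) ^ i)"
      unfolding c_def sum_distrib_left
      by (rule sum.cong) (use q_nonzero in \<open>simp_all add: power_int_diff field_simps\<close>)
    then have "(\<Sum>i<l. (inverse q) ^ i) = 0" using \<open>c l = 0\<close> q_nonzero by simp
    then have "(inverse q) ^ l = 1" using power_diff_1_eq[of "inverse q" l] by simp
    then show False using prim[of l] l by (simp add: power_inverse)
  qed
  \<comment> \<open>The covector dual to the end \<open>z (l - 1)\<close> of the long chain,
    rescaled to take the value 1 on \<open>h^l (x 0)\<close>.\<close>
  define f where "f = inverse (c l) \<cdot>\<^sub>m \<phi> 1 (l - 1)"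
  define y where "y = x 1 + (c 1 - c l) \<cdot>\<^sub>m z 0"
  have df: "dim_row f = 1" "dim_col f = 2 * l" and dy: "dim_row y = 2 * l" "dim_col y = 1"
    using dx by (simp_all add: f_def y_def)
  have "wt_covec X (r - int (l - 1) - int 1) (\<phi> 1 (l - 1))" using l by (intro aux(4)) auto
  moreover have "r - int (l - 1) - int 1 = r - int (l + 1) + 1" using l by auto
  ultimately have "wt_covec X (r - int (l + 1) + 1) (\<phi> 1 (l - 1))" by (simp only:)
  then have f: "wt_covec X (r - int (l + 1) + 1) f"
    unfolding wt_covec_def f_def using dX dx taft_pairD(1,2)[OF module_pair(1)[OF X]]
    by (simp add: mult_mat_smult_left smult_mat_smult mult.commute)
  have yk: "hact X ^\<^sub>m k * y = x (k + 1) + (c (k + 1) - c l) \<cdot>\<^sub>m z k" for k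
  proof -
    have "y = hact X * x 0 - c l \<cdot>\<^sub>m z 0"
      using aux(6)[of 1] dH dx by (simp add: mat_simps) (rule eq_matI, simp_all add: y_def dx algebra_simps)
    then have "hact X ^\<^sub>m k * y = hact X ^\<^sub>m Suc k * x 0 - c l \<cdot>\<^sub>m z k"
      using dH dx aux(5)[of k] by (simp add: mult_mat_minus_right mult_mat_smult_right mult_mat_assoc)
    also have "\<dots> = x (k + 1) + (c (k + 1) - c l) \<cdot>\<^sub>m z k"
      unfolding aux(6) by (rule eq_matI) (use dx in \<open>simp_all add: algebra_simps\<close>)
    finally show ?thesis .
  qed
  have y: "wt_vec X (r - 1) y"
  proof -
    have "wt_vec X (r - 1) (hact X * x 0)"
      using wt_vec_hact_pow[OF X aux(2), of 1] dH by (simp add: mat_simps)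
    moreover have "hact X * x 0 = x 1 + c 1 \<cdot>\<^sub>m z 0" using aux(6)[of 1] dH by (simp add: mat_simps)
    moreover have "y = (x 1 + c 1 \<cdot>\<^sub>m z 0) - c l \<cdot>\<^sub>m z 0"
      by (rule eq_matI) (simp_all add: y_def dx algebra_simps)
    ultimately show ?thesis
      using aux(3) dx dX taft_pairD(1,2)[OF module_pair(1)[OF X]] unfolding wt_vec_def
      by (simp add: mult_mat_minus_right mult_mat_smult_right smult_mat_smult)
        (rule eq_matI, simp_all add: algebra_simps)
  qed
  have zero: "x a = 0\<^sub>m (2 * l) 1" "z a = 0\<^sub>m (2 * l) 1" if "l \<le> a" for a
    using that by (simp_all add: x_def z_def ucol_zero kronecker_zero_right)
  have x0: "hact X ^\<^sub>m (l + 1) * x 0 = 0\<^sub>m (rep_dim X) 1"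
    unfolding aux(7) dX using dx by (simp add: mat_simps)
  have y0: "hact X ^\<^sub>m (l - 1) * y = 0\<^sub>m (rep_dim X) 1"
    unfolding yk using l dX zero by (simp add: mat_add_zero) (rule eq_matI, simp_all add: dx)
  have f0: "f * hact X ^\<^sub>m (l + 1) = 0\<^sub>m 1 (rep_dim X)"
    unfolding aux(7) dX using df by (simp add: mat_simps)
  have \<phi>f: "(f * (x a + s \<cdot>\<^sub>m z b)) $$ (0, 0) = inverse (c l) * s * (if b = l - 1 then 1 else 0)" for a b s
    unfolding f_def using dx l
    by (simp add: mult_mat_smult_left mult_mat_add_right mult_mat_smult_right aux(8,9) del: index_mult_mat(1))
  have one: "(f * (hact X ^\<^sub>m (l + 1 - 1) * x 0)) $$ (0, 0) = 1"
    unfolding aux(6) \<phi>f using cl by simp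
  have l1: "1 \<le> l + 1" "l + 1 \<le> n" "l - 1 \<le> n" using l by auto
  have PQ: "cocyc_mat X (l + 1) f * cyc_mat X (l + 1) (x 0) = 1\<^sub>m (l + 1)"
    by (rule cocyc_cyc_one[OF X l1(1,2) aux(2) x0 f one])
  have PQ0: "cocyc_mat X (l + 1) f * cyc_mat X (l - 1) y = 0\<^sub>m (l + 1) (l - 1)"
  proof (rule eq_matI)
    fix i k assume "i < dim_row (0\<^sub>m (l + 1) (l - 1) :: 'k mat)" "k < dim_col (0\<^sub>m (l + 1) (l - 1) :: 'k mat)"
    then have ik: "i < l + 1" "k < l - 1" by simp_all
    have "(cocyc_mat X (l + 1) f * cyc_mat X (l - 1) y) $$ (i, k) = (f * (hact X ^\<^sub>m (l + 1 - 1 - i + k) * y)) $$ (0, 0)"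
      by (rule cocyc_cyc_entry[OF X _ _ _ _ ik]) (use df dy dX in simp_all)
    also have "\<dots> = 0" unfolding yk \<phi>f by (cases "l + 1 - 1 - i + k = l - 1") (use l in auto)
    finally show "(cocyc_mat X (l + 1) f * cyc_mat X (l - 1) y) $$ (i, k) = 0\<^sub>m (l + 1) (l - 1) $$ (i, k)"
      using ik by simp
  qed simp_all
  \<comment> \<open>The \<open>x\<close>-part of \<open>h^k y\<close> is \<open>x (k + 1)\<close>,
    so reading the coordinates of \<open>x 1\<close>, ..., \<open>x (l - 1)\<close> inverts the
    short chain.\<close>
  define Q2 where "Q2 = mat (l - 1) (rep_dim X) (\<lambda>(j, t). \<phi> 0 (j + 1) $$ (0, t))"
  have Q2: "Q2 * cyc_mat X (l - 1) y = 1\<^sub>m (l - 1)"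
  proof (rule eq_matI)
    fix j k assume "j < dim_row (1\<^sub>m (l - 1) :: 'k mat)" "k < dim_col (1\<^sub>m (l - 1) :: 'k mat)"
    then have jk: "j < l - 1" "k < l - 1" by simp_all
    have "(Q2 * cyc_mat X (l - 1) y) $$ (j, k) = (\<phi> 0 (j + 1) * (hact X ^\<^sub>m k * y)) $$ (0, 0)"
      unfolding Q2_def by (rule rows_mult_cyc[OF X _ _ _ jk]) (use dx dy dX in simp_all)
    also have "\<dots> = (if j = k then 1 else 0)"
      unfolding yk using jk dx
      by (simp add: mult_mat_add_right mult_mat_smult_right aux(8,9) del: index_mult_mat(1)) arith
    finally show "(Q2 * cyc_mat X (l - 1) y) $$ (j, k) = 1\<^sub>m (l - 1) $$ (j, k)" using jk by simp
  qed (simp_all add: Q2_def)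
  have "module_iso K X (direct_sum (M (l + 1) r) (M (l - 1) (r - 1)))"
    by (rule two_summands[OF is_module_wf is_module_wf is_module_wf hom_cyc[OF X l1(2) aux(2) x0] hom_cyc[OF X l1(3) y y0],
          of "cocyc_mat X (l + 1) f" Q2])
      (use PQ PQ0 Q2 l in \<open>simp_all add: module_M X dX Q2_def\<close>)
  then show ?thesis unfolding X_def .
qed

text \<open>No chain is longer than \<open>n\<close>, so \<open>x 0\<close> and \<open>z 0\<close>
  each generate a module of full length \<open>n\<close>. The \<open>x\<close>-coordinate of index
  \<open>n - 1\<close> separates the first chain from the second, which lies in the span of the
  \<open>z a\<close>.\<close>

lemma tensor_M2_top:
  shows "module_iso K (tensor_module K (M 2 0) (M n r)) (direct_sum (M n r) (M n (r - 1)))"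
proof -
  have ln: "1 \<le> n" "n \<le> n" using n2 by simp_all
  define X where "X = tensor_module K (M 2 0) (M n r)"
  define x where "x = (\<lambda>a. kronecker (ucol 2 0) (ucol n a) :: 'k mat)"
  define z where "z = (\<lambda>a. kronecker (ucol 2 1) (ucol n a) :: 'k mat)"
  define \<phi> where "\<phi> = (\<lambda>i a. kronecker (urow 2 i) (urow n a) :: 'k mat)"
  define c where "c = (\<lambda>k::nat. \<Sum>i<k. q powi (r - int i))"
  note aux = tensor_M2_aux[OF ln X_def x_def z_def \<phi>_def c_def]
  note X = aux(1)
  have dX: "rep_dim X = 2 * n" by (simp add: X_def)
  have dx: "dim_row (x a) = 2 * n" "dim_col (x a) = 1" "dim_row (z a) = 2 * n" "dim_col (z a) = 1"
    "dim_row (\<phi> i a) = 1" "dim_col (\<phi> i a) = 2 * n" for a i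
    by (simp_all add: x_def z_def \<phi>_def)
  note dH = taft_pairD(3,4,6)[OF module_pair(1)[OF X]]
  let ?f = "\<phi> 0 (n - 1)"
  have "wt_covec X (r - int (n - 1) - int 0) ?f" using n2 by (intro aux(4)) auto
  moreover have "r - int (n - 1) - int 0 = r - int n + 1" using n2 by auto
  ultimately have f: "wt_covec X (r - int n + 1) ?f" by (simp only:)
  have x0: "hact X ^\<^sub>m n * x 0 = 0\<^sub>m (rep_dim X) 1" and z0: "hact X ^\<^sub>m n * z 0 = 0\<^sub>m (rep_dim X) 1"
    unfolding dH dX using dx by (simp_all add: mat_simps)
  have one: "(?f * (hact X ^\<^sub>m (n - 1) * x 0)) $$ (0, 0) = 1"
    unfolding aux(6) using dx n2 by (simp add: mult_mat_add_right mult_mat_smult_right aux(8,9) del: index_mult_mat(1))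
  have PQ: "cocyc_mat X n ?f * cyc_mat X n (x 0) = 1\<^sub>m n"
    by (rule cocyc_cyc_one[OF X ln aux(2) x0 f one])
  have PQ0: "cocyc_mat X n ?f * cyc_mat X n (z 0) = 0\<^sub>m n n"
  proof (rule eq_matI)
    fix i k assume "i < dim_row (0\<^sub>m n n :: 'k mat)" "k < dim_col (0\<^sub>m n n :: 'k mat)"
    then have ik: "i < n" "k < n" by simp_all
    have "(cocyc_mat X n ?f * cyc_mat X n (z 0)) $$ (i, k) = (?f * (hact X ^\<^sub>m (n - 1 - i + k) * z 0)) $$ (0, 0)"
      by (rule cocyc_cyc_entry[OF X _ _ _ _ ik]) (use dx dX in simp_all)
    then show "(cocyc_mat X n ?f * cyc_mat X n (z 0)) $$ (i, k) = 0\<^sub>m n n $$ (i, k)"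
      unfolding aux(5) using ik by (simp add: aux(9) del: index_mult_mat(1))
  qed simp_all
  define Q2 where "Q2 = mat n (rep_dim X) (\<lambda>(j, t). \<phi> 1 j $$ (0, t))"
  have Q2: "Q2 * cyc_mat X n (z 0) = 1\<^sub>m n"
  proof (rule eq_matI)
    fix j k assume "j < dim_row (1\<^sub>m n :: 'k mat)" "k < dim_col (1\<^sub>m n :: 'k mat)"
    then have jk: "j < n" "k < n" by simp_all
    have "(Q2 * cyc_mat X n (z 0)) $$ (j, k) = (\<phi> 1 j * (hact X ^\<^sub>m k * z 0)) $$ (0, 0)"
      unfolding Q2_def by (rule rows_mult_cyc[OF X _ _ _ jk]) (use dx dX in simp_all)
    then show "(Q2 * cyc_mat X n (z 0)) $$ (j, k) = 1\<^sub>m n $$ (j, k)"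
      unfolding aux(5) using jk by (simp add: aux(9)[of 1, simplified] aux(9) del: index_mult_mat(1))
  qed (simp_all add: Q2_def)
  have "module_iso K X (direct_sum (M n r) (M n (r - 1)))"
    by (rule two_summands[OF is_module_wf is_module_wf is_module_wf hom_cyc[OF X ln(2) aux(2) x0] hom_cyc[OF X ln(2) aux(3) z0],
          of "cocyc_mat X n ?f" Q2])
      (use PQ PQ0 Q2 in \<open>simp_all add: module_M X dX Q2_def\<close>)
  then show ?thesis unfolding X_def .
qed

end

section \<open>Multiplicities of the indecomposable summands\<close>

context taft_param begin

text \<open>The dimension of the image of the weight space of \<open>q^s\<close> under
  \<open>h^j\<close>: the scalar \<open>n\<close> in \<open>wproj\<close> is nonzero and does not
  affect the rank. Values are integers because differences are taken.\<close>

definition wt_rank :: "nat \<Rightarrow> int \<Rightarrow> (nat \<times> nat, 'k) rep \<Rightarrow> int" where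
  "wt_rank j s V = int (mat_rank (hact V ^\<^sub>m j * act_elem K V (wproj s)))"

text \<open>The functions that factor through the additive group of the Green ring. The codomain is
  left general since integer, real and free-group values all occur.\<close>

definition add_inv :: "((nat \<times> nat, 'k) rep \<Rightarrow> 'a::ab_group_add) \<Rightarrow> bool" where
  "add_inv \<phi> \<longleftrightarrow> (\<forall>U V. is_module K U \<longrightarrow> is_module K V \<longrightarrow>
     (module_iso K U V \<longrightarrow> \<phi> U = \<phi> V) \<and> \<phi> (direct_sum U V) = \<phi> U + \<phi> V)"

lemma add_invD:
  assumes "add_inv \<phi>" "is_module K U" "is_module K V"
  shows "module_iso K U V \<Longrightarrow> \<phi> U = \<phi> V" "\<phi> (direct_sum U V) = \<phi> U + \<phi> V"
  using assms by (auto simp: add_inv_def)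

lemma add_inv_biproduct:
  assumes "add_inv \<phi>" "is_module K X" "is_module K U" "is_module K V" "biproduct K X U V"
  shows "\<phi> X = \<phi> U + \<phi> V"
  using add_invD[OF assms(1)] biproduct_imp_iso[OF assms(5)] is_module_direct_sum assms is_module_wf by metis

lemma add_inv_minus: "add_inv \<phi> \<Longrightarrow> add_inv \<xi> \<Longrightarrow> add_inv (\<lambda>V. \<phi> V - \<xi> V)"
  by (auto simp: add_inv_def)

lemma add_inv_sum: "(\<And>b. b \<in> B \<Longrightarrow> add_inv (\<phi> b)) \<Longrightarrow> add_inv (\<lambda>V. \<Sum>b\<in>B. \<phi> b V)"
  unfolding add_inv_def by (auto simp: sum.distrib[symmetric] intro!: sum.cong)

lemma add_inv_real_mult: "add_inv \<phi> \<Longrightarrow> add_inv (\<lambda>V. real_of_int (\<phi> V) * c)"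
  by (auto simp: add_inv_def distrib_right)

text \<open>A zero module is isomorphic to the direct sum of two copies of itself, by the empty
  matrix.\<close>

lemma add_inv_zero:
  assumes "add_inv \<phi>" "is_module K V" "rep_dim V = 0"
  shows "\<phi> V = 0"
proof -
  have "hom_mat K V (direct_sum V V) (0\<^sub>m 0 0)"
    using assms rep_wfD[OF is_module_wf[OF assms(2)]] rep_wfD[OF rep_wf_direct_sum[OF is_module_wf is_module_wf], OF assms(2,2)]
    by (auto simp: hom_mat_def intro!: eq_matI)
  then have "module_iso K V (direct_sum V V)"
    by (rule module_isoI[of _ _ _ _ "0\<^sub>m 0 0"]) (use assms in \<open>auto intro!: eq_matI\<close>)
  then have "\<phi> V = \<phi> V + \<phi> V"
    using add_invD[OF assms(1)] is_module_direct_sum assms(2) by metis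
  then show ?thesis by simp
qed

lemma hom_hact_wproj:
  assumes U: "is_module K U" and V: "is_module K V" and P: "hom_mat K U V P"
  shows "P * (hact U ^\<^sub>m j * act_elem K U (wproj s)) = hact V ^\<^sub>m j * act_elem K V (wproj s) * P"
proof -
  note u = taft_pairD[OF module_pair(1)[OF U]] and v = taft_pairD[OF module_pair(1)[OF V]]
  note d = hom_matD(1,2)[OF P]
  have h: "P * hact U ^\<^sub>m j = hact V ^\<^sub>m j * P"
    using P d u v by (intro pow_mat_intertwine) (simp_all add: hom_mat_iff[OF U V])
  have "P * (hact U ^\<^sub>m j * act_elem K U (wproj s)) = hact V ^\<^sub>m j * P * act_elem K U (wproj s)"
    using d u by (simp add: mult_mat_assoc flip: h)
  also have "\<dots> = hact V ^\<^sub>m j * (P * act_elem K U (wproj s))" using d v by (simp add: mult_mat_assoc)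
  also have "\<dots> = hact V ^\<^sub>m j * act_elem K V (wproj s) * P"
    unfolding hom_mat_act_elem[OF P is_module_wf[OF U] is_module_wf[OF V]]
    using d v by (simp add: mult_mat_assoc)
  finally show ?thesis .
qed

lemma add_inv_wt_rank: "add_inv (wt_rank j s)"
  unfolding add_inv_def
proof (intro allI impI conjI)
  fix U V assume U: "is_module K U" and V: "is_module K V"
  note u = taft_pairD[OF module_pair(1)[OF U]] and v = taft_pairD[OF module_pair(1)[OF V]]
  let ?X = "\<lambda>V. hact V ^\<^sub>m j * act_elem K V (wproj s)"
  {
    assume "module_iso K U V"
    then obtain P Q where P: "hom_mat K U V P" "hom_mat K V U Q"
      "P * Q = 1\<^sub>m (rep_dim V)" "Q * P = 1\<^sub>m (rep_dim U)"
      by (rule module_isoE[OF _ is_module_wf[OF U] is_module_wf[OF V]])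
    note d = hom_matD(1,2)[OF P(1)] hom_matD(1,2)[OF P(2)]
    have "P * (?X U * Q) = (P * ?X U) * Q" using d u by (simp add: mult_mat_assoc)
    also have "\<dots> = ?X V * (P * Q)" unfolding hom_hact_wproj[OF U V P(1)] using d v by (simp add: mult_mat_assoc)
    also have "\<dots> = ?X V" using v by (simp add: P mat_simps)
    finally show "wt_rank j s U = wt_rank j s V"
      using mat_rank_equivalent[of Q P "?X U" Q P] P d u by (simp add: wt_rank_def)
  }
  have h: "hact (direct_sum U V) = four_block_mat (hact U) (0\<^sub>m (rep_dim U) (rep_dim V)) (0\<^sub>m (rep_dim V) (rep_dim U)) (hact V)"
    by (simp add: hact_def direct_sum_def)
  have c: "hact U \<in> carrier_mat (rep_dim U) (rep_dim U)" "hact V \<in> carrier_mat (rep_dim V) (rep_dim V)"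
    using u v by (simp_all add: carrier_mat_def)
  have "?X (direct_sum U V) = four_block_mat (?X U) (0\<^sub>m (rep_dim U) (rep_dim V)) (0\<^sub>m (rep_dim V) (rep_dim U)) (?X V)"
    unfolding h four_block_diag_pow[OF c] act_elem_direct_sum[OF is_module_wf[OF U] is_module_wf[OF V]]
    using u v by (simp add: four_block_diag_mult)
  moreover have "?X U \<in> carrier_mat (rep_dim U) (rep_dim U)" "?X V \<in> carrier_mat (rep_dim V) (rep_dim V)"
    using u v by (simp_all add: carrier_mat_def)
  ultimately show "wt_rank j s (direct_sum U V) = wt_rank j s U + wt_rank j s V"
    by (simp add: wt_rank_def mat_rank_four_block)
qed

lemma powi_pow: "(q powi z) ^ k = q powi (z * int k)"
  by (simp add: power_int_mult)

lemma act_wproj_M: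
  assumes l: "l \<le> n" and ab: "a < l" "b < l"
  shows "act_elem K (M l r) (wproj s) $$ (a, b)
    = (if a = b \<and> (r - int a) mod int n = s mod int n then of_nat n else 0)"
proof -
  note m = module_M[OF l]
  have "act_elem K (M l r) (wproj s) $$ (a, b)
      = (\<Sum>k<n. q powi (- s * int k) * (1\<^sub>m l * taft_g_mat q l r ^\<^sub>m k) $$ (a, b))"
    using mult_wproj[OF module_M(1)[OF l, of r], where A = "1\<^sub>m l" and i = a and j = b and s = s] ab m
    by (simp add: mult_mat_one_left del: index_mult_mat(1))
  also have "\<dots> = (\<Sum>k<n. if a = b then (q powi (r - int a - s)) ^ k else 0)"
  proof (rule sum.cong)
    fix k
    have "q powi (- s * int k) * (q powi (r - int a)) ^ k = (q powi (r - int a - s)) ^ k"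
    proof -
      have "(q powi (r - int a - s)) ^ k = (q powi (r - int a) * q powi (- s)) ^ k"
        using q_nonzero by (simp flip: power_int_add)
      also have "\<dots> = (q powi (r - int a)) ^ k * q powi (- s * int k)"
        by (simp only: power_mult_distrib powi_pow)
      finally show ?thesis by (simp add: mult.commute)
    qed
    then show "q powi (- s * int k) * (1\<^sub>m l * taft_g_mat q l r ^\<^sub>m k) $$ (a, b)
      = (if a = b then (q powi (r - int a - s)) ^ k else 0)"
      using ab by (cases "a = b") (simp_all add: mult_mat_one_left taft_g_pow_entry del: index_mult_mat(1))
  qed simp
  also have "\<dots> = (if a = b \<and> (r - int a) mod int n = s mod int n then of_nat n else 0)"
  proof (cases "(r - int a) mod int n = s mod int n")
    case True
    then have "(r - int a - s) mod int n = 0 mod int n" by (metis mod_diff_cong diff_self)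
    then have "q powi (r - int a - s) = 1" using q_powi_eq_iff[of "r - int a - s" 0] by simp
    then show ?thesis using True by (cases "a = b") simp_all
  next
    case False
    have "q powi (r - int a - s) \<noteq> 1"
    proof
      assume "q powi (r - int a - s) = 1"
      then have "(r - int a - s) mod int n = 0 mod int n" using q_powi_eq_iff[of "r - int a - s" 0] by simp
      then show False using False by (simp add: mod_eq_dvd_iff mod_eq_0_iff_dvd)
    qed
    then have "(\<Sum>k<n. (q powi (r - int a - s)) ^ k) = 0" by (rule geometric_root_sum[OF q_powi_n])
    then show ?thesis using False by (cases "a = b") simp_all
  qed
  finally show ?thesis .
qed

text \<open>As \<open>l <= n\<close>, a weight occurs at most once in \<open>M l r\<close>, at index
  \<open>(r - s) mod n\<close>; \<open>h^j\<close> moves this basis vector \<open>j\<close> places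
  further, or kills it if it would leave the range.\<close>

lemma wt_rank_M:
  assumes l: "l \<le> n"
  shows "wt_rank j s (M l r) = (if (r - s) mod int n + int j < int l then 1 else 0)"
proof -
  define b0 where "b0 = nat ((r - s) mod int n)"
  have b0: "int b0 = (r - s) mod int n" "b0 < n" using n2 by (simp_all add: b0_def nat_less_iff)
  have eq: "(r - int b) mod int n = s mod int n \<longleftrightarrow> b = b0" if "b < l" for b
  proof -
    have "(r - int b) mod int n = s mod int n \<longleftrightarrow> (r - s) mod int n = int b mod int n"
      by (simp add: mod_eq_dvd_iff algebra_simps)
    also have "int b mod int n = int b" using that l by simp
    finally show ?thesis using b0(1) by auto
  qed
  let ?X = "hact (M l r) ^\<^sub>m j * act_elem K (M l r) (wproj s)"
  have X: "?X $$ (a, b) = (if a = b0 + j \<and> b = b0 then of_nat n else 0)" if "a < l" "b < l" for a b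
  proof -
    have "?X $$ (a, b) = (\<Sum>t<l. (if a = t + j then 1 else 0) * (if t = b \<and> b = b0 then of_nat n else (0::'k)))"
      using that l by (subst mult_mat_entry)
        (auto simp: module_M taft_h_pow_entry act_wproj_M eq intro!: sum.cong)
    also have "\<dots> = (\<Sum>t<l. (if t = b then (if a = b + j \<and> b = b0 then of_nat n else 0) else 0))"
      by (rule sum.cong) auto
    also have "\<dots> = (if a = b + j \<and> b = b0 then of_nat n else 0)" using that by simp
    finally show ?thesis by auto
  qed
  have dh: "dim_row (hact (M l r)) = l" "dim_col (hact (M l r)) = l" using l by (simp_all add: module_M)
  show ?thesis
  proof (cases "b0 + j < l")
    case True
    then have "?X = mat l l (\<lambda>(i, k). if i = b0 + j \<and> k = b0 then of_nat n else 0)"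
      by (intro eq_matI) (simp_all add: X dh del: index_mult_mat(1))
    then have "mat_rank ?X = 1" using True mat_rank_single_entry[of "b0 + j" l b0 l "of_nat n :: 'k"] of_nat_n_nonzero
      by simp
    then show ?thesis using True b0 by (simp add: wt_rank_def)
  next
    case False
    then have "?X = 0\<^sub>m l l"
      by (intro eq_matI) (simp_all add: X dh del: index_mult_mat(1))
    then show ?thesis using False b0 by (simp add: wt_rank_def mat_rank_zero)
  qed
qed

text \<open>\<open>wt_rank j s - wt_rank (j + 1) (s + 1)\<close> counts the summands with top weight \<open>s\<close> and length
  greater than \<open>j\<close>.\<close>

definition mult_M :: "nat \<Rightarrow> int \<Rightarrow> (nat \<times> nat, 'k) rep \<Rightarrow> int" where
  "mult_M l r V = (wt_rank (l - 1) r V - wt_rank l (r + 1) V) - (wt_rank l r V - wt_rank (l + 1) (r + 1) V)"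

lemma add_inv_mult: "add_inv (mult_M l r)"
  unfolding mult_M_def by (intro add_inv_minus add_inv_wt_rank)

lemma mult_M_M:
  assumes "1 \<le> l" "l \<le> n" "l' \<le> n"
  shows "mult_M l r (M l' r') = (if l = l' \<and> r mod int n = r' mod int n then 1 else 0)"
proof -
  \<comment> \<open>Weight \<open>s + 1\<close> sits one place before weight \<open>s\<close>, so
    increasing \<open>j\<close> as well makes the two ranks cancel. The exception is
    \<open>s\<close> being the top weight: then the index of \<open>s + 1\<close> wraps around to
    \<open>n - 1\<close> and its rank is zero.\<close>
  have T: "wt_rank j s (M l' r') - wt_rank (j + 1) (s + 1) (M l' r')
      = (if s mod int n = r' mod int n \<and> j < l' then 1 else 0)" for j s
  proof (cases "s mod int n = r' mod int n")
    case True
    then have 0: "(r' - s) mod int n = 0" by (metis mod_diff_cong diff_self mod_0)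
    have "(r' - (s + 1)) mod int n = ((r' - s) mod int n - 1) mod int n" by (simp add: mod_diff_left_eq algebra_simps)
    also have "\<dots> = int n - 1" unfolding 0 using n2 by (simp add: zmod_minus1)
    finally show ?thesis using True 0 assms by (simp add: wt_rank_M)
  next
    case False
    then have "(r' - s) mod int n \<noteq> 0" by (metis mod_0_imp_dvd mod_eq_dvd_iff)
    moreover have "0 \<le> (r' - s) mod int n" "(r' - s) mod int n < int n" using n2 by simp_all
    ultimately have "((r' - s) mod int n - 1) mod int n = (r' - s) mod int n - 1"
      by (intro mod_pos_pos_trivial) auto
    moreover have "(r' - (s + 1)) mod int n = ((r' - s) mod int n - 1) mod int n"
      by (simp add: mod_diff_left_eq algebra_simps)
    ultimately show ?thesis using False assms by (simp add: wt_rank_M)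
  qed
  show ?thesis
    using T[of "l - 1" r] T[of l r] assms by (auto simp: mult_M_def)
qed

text \<open>The existence half of Krull-Schmidt, packaged as an induction that peels off one
  \<open>M l r\<close> at a time.\<close>

lemma module_induct [consumes 1, case_names zero step]:
  assumes "is_module K V"
    and zero: "\<And>V. is_module K V \<Longrightarrow> rep_dim V = 0 \<Longrightarrow> P V"
    and step: "\<And>V l r W. is_module K V \<Longrightarrow> 1 \<le> l \<Longrightarrow> l \<le> n \<Longrightarrow> is_module K W \<Longrightarrow>
      biproduct K V (M l r) W \<Longrightarrow> P W \<Longrightarrow> P V"
  shows "P V"
  using assms(1)
proof (induction "rep_dim V" arbitrary: V rule: less_induct)
  case less
  show ?case
  proof (cases "rep_dim V = 0")
    case True
    then show ?thesis using zero less by blast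
  next
    case False
    then obtain l r W where W: "1 \<le> l" "l \<le> n" "is_module K W" "biproduct K V (M l r) W" "rep_dim V = l + rep_dim W"
      using split_M[OF less(2)] by (metis gr0I)
    then show ?thesis using step[OF less(2) W(1-4)] less(1)[of W] by simp
  qed
qed

text \<open>The principle behind all later identities: additive functions are determined by their
  values on the \<open>M l r\<close>.\<close>

lemma add_inv_eqI:
  assumes "add_inv \<phi>" "add_inv \<xi>" "\<And>l r. 1 \<le> l \<Longrightarrow> l \<le> n \<Longrightarrow> \<phi> (M l r) = \<xi> (M l r)" "is_module K V"
  shows "\<phi> V = \<xi> V"
  using assms(4)
proof (induction rule: module_induct)
  case (zero V)
  then show ?case using add_inv_zero assms(1,2) by metis
next
  case (step V l r W)
  then show ?case using add_inv_biproduct[OF assms(1) step(1) module_M(1) step(4,5)]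
      add_inv_biproduct[OF assms(2) step(1) module_M(1) step(4,5)] assms(3) by simp
qed

lemma mult_M_nonneg:
  assumes "is_module K V" "1 \<le> l" "l \<le> n"
  shows "0 \<le> mult_M l r V"
  using assms(1)
proof (induction rule: module_induct)
  case (zero V)
  then show ?case using add_inv_zero[OF add_inv_mult] by simp
next
  case (step V l' r' W)
  then show ?case using add_inv_biproduct[OF add_inv_mult step(1) module_M(1) step(4,5)]
    assms by (simp add: mult_M_M)
qed

section \<open>Classification of the indecomposable modules\<close>

definition idx :: "(nat \<times> int) set" where "idx = {1..n} \<times> {0..<int n}"

lemma finite_idx: "finite idx"
  by (simp add: idx_def)

lemma sum_idx_mult_M:
  fixes F :: "nat \<times> int \<Rightarrow> 'a::comm_ring_1"
  assumes "1 \<le> l" "l \<le> n"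
  shows "(\<Sum>b\<in>idx. of_int (mult_M (fst b) (snd b) (M l r)) * F b) = F (l, r mod int n)"
proof -
  have "(\<Sum>b\<in>idx. of_int (mult_M (fst b) (snd b) (M l r)) * F b)
      = (\<Sum>b\<in>idx. if b = (l, r mod int n) then F b else 0)"
    by (rule sum.cong) (use assms in \<open>auto simp: idx_def mult_M_M split: if_splits\<close>)
  also have "\<dots> = F (l, r mod int n)"
    using assms n2 finite_idx by (simp add: idx_def)
  finally show ?thesis .
qed

lemma nonzero_has_summand:
  assumes "is_module K V" "0 < rep_dim V"
  shows "1 \<le> (\<Sum>b\<in>idx. mult_M (fst b) (snd b) V)"
proof -
  obtain l r W where W: "1 \<le> l" "l \<le> n" "is_module K W" "biproduct K V (M l r) W"
    by (rule split_M[OF assms]) blast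
  have "(\<Sum>b\<in>idx. mult_M (fst b) (snd b) V)
      = (\<Sum>b\<in>idx. mult_M (fst b) (snd b) (M l r)) + (\<Sum>b\<in>idx. mult_M (fst b) (snd b) W)"
    by (rule add_inv_biproduct[OF add_inv_sum[OF add_inv_mult] assms(1) module_M(1)[OF W(2)] W(3,4)])
  moreover have "(\<Sum>b\<in>idx. mult_M (fst b) (snd b) (M l r)) = 1"
    using sum_idx_mult_M[OF W(1,2), of r "\<lambda>_. 1 :: int"] by simp
  moreover have "0 \<le> (\<Sum>b\<in>idx. mult_M (fst b) (snd b) W)"
    using mult_M_nonneg[OF W(3)] by (intro sum_nonneg) (auto simp: idx_def)
  ultimately show ?thesis by simp
qed

text \<open>The total number of summands is additive, equals 1 on \<open>M l r\<close> and is at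
  least 1 on every nonzero module, so two nonzero summands are impossible.\<close>

lemma indecomposable_M:
  assumes l: "1 \<le> l" "l \<le> n"
  shows "indecomposable K (M l r)"
  unfolding indecomposable_def
proof (intro conjI allI impI)
  show "is_module K (M l r)" "rep_dim (M l r) \<noteq> 0" using l by (simp_all add: module_M)
  fix U W assume UW: "is_module K U \<and> is_module K W \<and> module_iso K (M l r) (direct_sum U W)"
  let ?t = "\<lambda>V. \<Sum>b\<in>idx. mult_M (fst b) (snd b) V"
  have t: "add_inv ?t" by (intro add_inv_sum add_inv_mult)
  from UW have U: "is_module K U" and W: "is_module K W" and iso: "module_iso K (M l r) (direct_sum U W)"
    by simp_all
  have "?t (M l r) = ?t U + ?t W"
    using add_invD(1)[OF t module_M(1)[OF l(2)] is_module_direct_sum[OF U W] iso] add_invD(2)[OF t U W] by simp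
  moreover have "?t (M l r) = 1"
    using sum_idx_mult_M[OF l, of r "\<lambda>_. 1 :: int"] by simp
  ultimately have "\<not> (1 \<le> ?t U \<and> 1 \<le> ?t W)" by linarith
  then show "rep_dim U = 0 \<or> rep_dim W = 0"
    using nonzero_has_summand[OF U] nonzero_has_summand[OF W] by linarith
qed

lemma indecomposable_iso_M:
  assumes "indecomposable K V"
  obtains l r where "1 \<le> l" "l \<le> n" "module_iso K V (M l r)"
proof -
  have V: "is_module K V" and d: "0 < rep_dim V" using assms by (simp_all add: indecomposable_def)
  obtain l r W where W: "1 \<le> l" "l \<le> n" "is_module K W" "biproduct K V (M l r) W"
    by (rule split_M[OF V d]) blast
  have "module_iso K V (direct_sum (M l r) W)"
    using biproduct_imp_iso[OF W(4)] V W module_M(1) is_module_wf by blast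
  moreover have all: "\<forall>U W. is_module K U \<and> is_module K W \<and> module_iso K V (direct_sum U W) \<longrightarrow> rep_dim U = 0 \<or> rep_dim W = 0"
    using assms by (simp add: indecomposable_def)
  ultimately have "rep_dim (M l r) = 0 \<or> rep_dim W = 0"
    using W(3) module_M(1)[OF W(2), of r] spec[OF spec[OF all, of "M l r"], of W] by simp
  then have "rep_dim W = 0" using W(1) by simp
  then show thesis using biproduct_zero_right[OF W(4)] that W by blast
qed

section \<open>The multiplicative invariant\<close>

definition sinr :: "nat \<Rightarrow> real" where
  "sinr l = sin (real l * pi / real n) / sin (pi / real n)"

lemma sin_pi_n_pos: "0 < sin (pi / real n)"
  using n2 by (intro sin_gt_zero) (auto simp: field_simps)

lemma sinr_0 [simp]: "sinr 0 = 0" and sinr_n [simp]: "sinr n = 0" and sinr_1 [simp]: "sinr (Suc 0) = 1"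
  using sin_pi_n_pos n2 by (simp_all add: sinr_def)

text \<open>The addition theorems for sine; this is the numerical form of
  \<open>tensor_M2_lt\<close>.\<close>

lemma sinr_rec:
  assumes "1 \<le> l" shows "sinr (l + 1) + sinr (l - 1) = 2 * cos (pi / real n) * sinr l"
proof -
  have 1: "real (l + 1) * pi / real n = real l * pi / real n + pi / real n"
    "real (l - 1) * pi / real n = real l * pi / real n - pi / real n"
    using assms by (simp_all add: of_nat_diff add_divide_distrib diff_divide_distrib distrib_right left_diff_distrib)
  show ?thesis unfolding sinr_def 1 sin_add sin_diff by (simp add: add_divide_distrib[symmetric])
qed

text \<open>The angle lies between \<open>pi / n\<close> and \<open>pi - pi / n\<close>, where sine
  is at least \<open>sin (pi / n)\<close> by monotonicity up to \<open>pi / 2\<close> and by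
  symmetry beyond.\<close>

lemma sinr_ge_1:
  assumes "1 \<le> l" "l < n" shows "1 \<le> sinr l"
proof -
  have n0: "0 < real n" using n2 by simp
  have "sin (pi / real n) \<le> sin (real l * pi / real n)"
  proof (cases "real l * pi / real n \<le> pi / 2")
    case True
    have "pi / real n \<le> real l * pi / real n" using assms n0 by (simp add: field_simps)
    then show ?thesis using True n0 by (intro sin_monotone_2pi_le) (auto intro: order_trans[of _ 0])
  next
    case False
    have "real l + 1 \<le> real n" using assms by simp
    then have "(real l + 1) * pi \<le> real n * pi" by simp
    then have "pi / real n \<le> pi - real l * pi / real n" using n0 by (simp add: field_simps)
    moreover have "- (pi / 2) \<le> pi / real n" by (rule order_trans[of _ 0]) simp_all
    ultimately have "sin (pi / real n) \<le> sin (pi - real l * pi / real n)"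
      using False by (intro sin_monotone_2pi_le) auto
    then show ?thesis by (simp add: sin_pi_minus)
  qed
  then show ?thesis using sin_pi_n_pos by (simp add: sinr_def)
qed

lemma sinr_le: "sinr l \<le> 1 / sin (pi / real n)"
  using sin_pi_n_pos by (simp add: sinr_def divide_right_mono)

definition psi :: "(nat \<times> nat, 'k) rep \<Rightarrow> real" where
  "psi V = (\<Sum>b\<in>idx. real_of_int (mult_M (fst b) (snd b) V) * sinr (fst b))"

lemma add_inv_psi: "add_inv psi"
  unfolding psi_def by (intro add_inv_sum add_inv_real_mult add_inv_mult)

text \<open>The zero module \<open>M 0 r\<close> is included because it occurs as the shorter
  summand of \<open>tensor_M2_lt\<close> when \<open>l = 1\<close>.\<close>

lemma psi_M: "l \<le> n \<Longrightarrow> psi (M l r) = sinr l"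
proof (cases "l = 0")
  case True
  then show ?thesis using add_inv_zero[OF add_inv_psi module_M(1)[of 0 r]] by simp
next
  case False
  assume "l \<le> n"
  then show ?thesis using False sum_idx_mult_M[of l r "\<lambda>b. sinr (fst b)"] by (simp add: psi_def)
qed

text \<open>This allows multiplicativity to be checked on the \<open>M l r\<close> in one factor at
  a time, the other factor being an arbitrary module.\<close>

lemma add_inv_tensor:
  assumes \<phi>: "add_inv \<phi>" and W: "is_module K W"
  shows "add_inv (\<lambda>V. \<phi> (tensor_module K W V))" "add_inv (\<lambda>V. \<phi> (tensor_module K V W))"
proof -
  have *: "module_iso K (tensor_module K W U) (tensor_module K W V)"
    "module_iso K (tensor_module K U W) (tensor_module K V W)"
    if "is_module K U" "is_module K V" "module_iso K U V" for U V
    using that W is_module_wf module_iso_refl by (blast intro: tensor_iso)+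
  have **: "\<phi> (tensor_module K W (direct_sum U V)) = \<phi> (tensor_module K W U) + \<phi> (tensor_module K W V)"
    "\<phi> (tensor_module K (direct_sum U V) W) = \<phi> (tensor_module K U W) + \<phi> (tensor_module K V W)"
    if U: "is_module K U" and V: "is_module K V" for U V
  proof -
    note S = is_module_direct_sum[OF U V]
    note bp = biproduct_tensor[OF is_module_wf is_module_wf is_module_wf is_module_wf biproduct_direct_sum, OF W S U V is_module_wf is_module_wf, OF U V]
    show "\<phi> (tensor_module K W (direct_sum U V)) = \<phi> (tensor_module K W U) + \<phi> (tensor_module K W V)"
      by (rule add_inv_biproduct[OF \<phi> _ _ _ bp(2)]) (intro tensor_module_K W S U V)+
    show "\<phi> (tensor_module K (direct_sum U V) W) = \<phi> (tensor_module K U W) + \<phi> (tensor_module K V W)"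
      by (rule add_inv_biproduct[OF \<phi> _ _ _ bp(1)]) (intro tensor_module_K W S U V)+
  qed
  show "add_inv (\<lambda>V. \<phi> (tensor_module K W V))" "add_inv (\<lambda>V. \<phi> (tensor_module K V W))"
    using * ** add_invD(1)[OF \<phi>] tensor_module_K(1) W unfolding add_inv_def by metis+
qed

lemma add_inv_scale: "add_inv \<phi> \<Longrightarrow> add_inv (\<lambda>V. c * \<phi> V)" for c :: real
  by (auto simp: add_inv_def distrib_left)

lemma psi_tensor_M1: "is_module K V \<Longrightarrow> psi (tensor_module K (M 1 s) V) = psi V"
proof (rule add_inv_eqI[OF add_inv_tensor(1)[OF add_inv_psi] add_inv_psi])
  have 1: "(1::nat) \<le> n" using n2 by simp
  show "is_module K (M 1 s)" by (rule module_M(1)[OF 1])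
  fix l r assume l: "1 \<le> l" "l \<le> n"
  show "psi (tensor_module K (M 1 s) (M l r)) = psi (M l r)"
    using add_invD(1)[OF add_inv_psi _ _ tensor_M1[OF l(2)]] tensor_module_K(1) module_M(1) 1 l
    by (metis psi_M)
qed

text \<open>\<open>psi\<close> is an eigenfunction of tensoring with \<open>M 2 0\<close>. For
  \<open>l < n\<close> this is \<open>sinr_rec\<close>; for \<open>l = n\<close> both sides are
  zero.\<close>

lemma psi_tensor_M2: "is_module K V \<Longrightarrow> psi (tensor_module K (M 2 0) V) = 2 * cos (pi / real n) * psi V"
proof (rule add_inv_eqI[OF add_inv_tensor(1)[OF add_inv_psi] add_inv_scale[OF add_inv_psi]])
  show "is_module K (M 2 0)" by (rule module_M(1)[OF n2])
  fix l r assume l: "1 \<le> l" "l \<le> n"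
  show "psi (tensor_module K (M 2 0) (M l r)) = 2 * cos (pi / real n) * psi (M l r)"
  proof (cases "l = n")
    case True
    have "psi (tensor_module K (M 2 0) (M n r)) = psi (direct_sum (M n r) (M n (r - 1)))"
      by (intro add_invD(1)[OF add_inv_psi _ _ tensor_M2_top] tensor_module_K is_module_direct_sum module_M n2 order_refl)
    then show ?thesis using True by (simp add: add_invD(2)[OF add_inv_psi] module_M psi_M)
  next
    case False
    then have l': "l < n" "l + 1 \<le> n" "l - 1 \<le> n" using l by auto
    have "psi (tensor_module K (M 2 0) (M l r)) = psi (direct_sum (M (l + 1) r) (M (l - 1) (r - 1)))"
      by (intro add_invD(1)[OF add_inv_psi _ _ tensor_M2_lt] tensor_module_K is_module_direct_sum module_M n2 l l')
    also have "\<dots> = sinr (l + 1) + sinr (l - 1)"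
      using l' by (simp add: add_invD(2)[OF add_inv_psi] module_M psi_M)
    finally show ?thesis using sinr_rec[OF l(1)] l psi_M[of l r] by simp
  qed
qed

text \<open>\<open>M (k + 1) r\<close> is solved for in the decomposition of \<open>M 2 0\<close>
  tensored with \<open>M k r\<close>. After tensoring with \<open>V\<close>, associativity brings
  \<open>M 2 0\<close> to the outside, where the eigenvalue \<open>2 * cos (pi / n)\<close> applies,
  and the recursion of \<open>sinr\<close> closes the induction.\<close>

lemma psi_tensor_M:
  assumes V: "is_module K V"
  shows "l \<le> n \<Longrightarrow> psi (tensor_module K (M l r) V) = sinr l * psi V"
proof (induction l arbitrary: r rule: less_induct)
  case (less l)
  consider "l = 0" | "l = 1" | k where "l = Suc k" "1 \<le> k"
    by (metis One_nat_def Suc_le_eq not0_implies_Suc not_gr_zero)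
  then show ?case
  proof cases
    case 1
    then show ?thesis using add_inv_zero[OF add_inv_psi tensor_module_K(1)[OF module_M(1) V], of 0 r] by simp
  next
    case 2
    then show ?thesis using psi_tensor_M1[OF V] by simp
  next
    case 3
    have k: "k \<le> n" "k < n" "k + 1 \<le> n" "k - 1 \<le> n" "k < l" "k - 1 < l" using less(2) 3 by auto
    note m2 = module_M(1)[OF n2, of 0] and mk = module_M(1)[OF k(1), of r]
      and mp = module_M(1)[OF k(3), of r] and mm = module_M(1)[OF k(4), of "r - 1"]
    note T = tensor_module_K(1)
    note M2 = T[OF m2 mk] and S = is_module_direct_sum[OF mp mm]
    have "psi (tensor_module K (M (k + 1) r) V) + psi (tensor_module K (M (k - 1) (r - 1)) V)
        = psi (tensor_module K (direct_sum (M (k + 1) r) (M (k - 1) (r - 1))) V)"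
      using add_invD(2)[OF add_inv_tensor(2)[OF add_inv_psi V] mp mm] by simp
    also have "\<dots> = psi (tensor_module K (tensor_module K (M 2 0) (M k r)) V)"
      using add_invD(1)[OF add_inv_tensor(2)[OF add_inv_psi V] M2 S tensor_M2_lt[OF 3(2) k(2)]] by simp
    also have "\<dots> = psi (tensor_module K (M 2 0) (tensor_module K (M k r) V))"
      by (rule add_invD(1)[OF add_inv_psi T[OF M2 V] T[OF m2 T[OF mk V]] tensor_assoc_K[OF m2 mk V]])
    also have "\<dots> = 2 * cos (pi / real n) * (sinr k * psi V)"
      using psi_tensor_M2[OF T[OF mk V]] less(1)[OF k(5,1)] by simp
    also have "\<dots> = (sinr (k + 1) + sinr (k - 1)) * psi V" using sinr_rec[OF 3(2)] by simp
    also have "psi (tensor_module K (M (k - 1) (r - 1)) V) = sinr (k - 1) * psi V"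
      by (rule less(1)[OF k(6,4)])
    finally show ?thesis using 3 by (simp add: distrib_right)
  qed
qed

lemma psi_tensor:
  assumes U: "is_module K U" and V: "is_module K V"
  shows "psi (tensor_module K U V) = psi U * psi V"
proof -
  have "add_inv (\<lambda>U. psi U * psi V)" using add_inv_scale[OF add_inv_psi, of "psi V"] by (simp add: mult.commute)
  then show ?thesis
    using add_inv_eqI[OF add_inv_tensor(2)[OF add_inv_psi V] _ _ U, of "\<lambda>U. psi U * psi V"] psi_tensor_M[OF V] psi_M
    by simp
qed

text \<open>\<open>psi V\<close> is a sum of nonnegative terms, and among the lengths in
  \<open>idx\<close> the factor \<open>sinr\<close> vanishes only at \<open>n\<close>.\<close>

lemma psi_zero_iff:
  assumes V: "is_module K V"
  shows "psi V = 0 \<longleftrightarrow> (\<forall>(l, r)\<in>idx. l < n \<longrightarrow> mult_M l r V = 0)"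
proof -
  have nn: "0 \<le> real_of_int (mult_M (fst b) (snd b) V) * sinr (fst b)" if "b \<in> idx" for b
    using mult_M_nonneg[OF V, of "fst b" "snd b"] sinr_ge_1[of "fst b"] that
    by (cases "fst b = n") (auto simp: idx_def)
  have "psi V = 0 \<longleftrightarrow> (\<forall>b\<in>idx. real_of_int (mult_M (fst b) (snd b) V) * sinr (fst b) = 0)"
    unfolding psi_def by (rule sum_nonneg_eq_0_iff[OF finite_idx nn])
  also have "\<dots> \<longleftrightarrow> (\<forall>b\<in>idx. fst b < n \<longrightarrow> mult_M (fst b) (snd b) V = 0)"
  proof (rule ball_cong[OF refl])
    fix b assume b: "b \<in> idx"
    then consider "fst b = n" | "fst b < n" "1 \<le> sinr (fst b)" using sinr_ge_1[of "fst b"] by (fastforce simp: idx_def)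
    then show "(real_of_int (mult_M (fst b) (snd b) V) * sinr (fst b) = 0)
        = (fst b < n \<longrightarrow> mult_M (fst b) (snd b) V = 0)"
      by cases auto
  qed
  finally show ?thesis by (simp add: case_prod_unfold)
qed

text \<open>In dimension \<open>n\<close> the modules of length \<open>n\<close> are recognized by a
  nonzero \<open>(n - 1)\<close>-st power of \<open>h\<close>, and the dual inherits this: the
  corner entry of that power is \<open>c\<close> times a power of \<open>q powi r\<close>.\<close>

lemma dual_M_top: "\<exists>r'. module_iso K (dual_module K (M n r)) (M n r')"
proof -
  note m = module_M[OF order_refl]
  note D = dual_module_K[OF m(1)]
  let ?G = "taft_g_mat q n r ^\<^sub>m (n - 1)"
  obtain c where c: "c \<noteq> 0" "hact (dual_module K (M n r)) ^\<^sub>m (n - 1)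
      = c \<cdot>\<^sub>m transpose_mat (taft_h_mat n ^\<^sub>m (n - 1) * ?G ^\<^sub>m (n - 1))"
    using D(4)[of r "n - 1"] m by auto
  have p: "?G ^\<^sub>m (n - 1) = taft_g_mat q n r ^\<^sub>m ((n - 1) * (n - 1))" by (simp add: pow_mat_mult)
  have "(taft_h_mat n ^\<^sub>m (n - 1) * ?G ^\<^sub>m (n - 1)) $$ (n - 1, 0)
      = (\<Sum>t<n. (if t = 0 then 1 else 0) * (?G ^\<^sub>m (n - 1)) $$ (t, 0))"
    using n2 by (subst mult_mat_entry) (auto simp: taft_h_pow_entry intro!: sum.cong)
  also have "\<dots> = (q powi r) ^ ((n - 1) * (n - 1))"
    using n2 by (simp only: sum_delta_right p) (simp add: taft_g_pow_entry)
  finally have "(hact (dual_module K (M n r)) ^\<^sub>m (n - 1)) $$ (0, n - 1) = c * (q powi r) ^ ((n - 1) * (n - 1))"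
    unfolding c(2) using n2 by (simp del: index_mult_mat(1))
  then have "(hact (dual_module K (M n r)) ^\<^sub>m (n - 1)) $$ (0, n - 1) \<noteq> 0" using c q_nonzero by simp
  then have "hact (dual_module K (M n r)) ^\<^sub>m (n - 1) \<noteq> 0\<^sub>m n n" using n2 by auto
  then show ?thesis using top_height_iso[OF D(1)] by (metis dim_M dual_dim)
qed

end

section \<open>The Green ring of a Hopf algebra\<close>

definition fext :: "('c \<Rightarrow> 'a::comm_ring_1) \<Rightarrow> ('c \<Rightarrow>\<^sub>0 int) \<Rightarrow> 'a" where
  "fext f x = (\<Sum>C\<in>Poly_Mapping.keys x. of_int (Poly_Mapping.lookup x C) * f C)"

lemma fext_superset:
  "finite S \<Longrightarrow> Poly_Mapping.keys x \<subseteq> S \<Longrightarrow> fext f x = (\<Sum>C\<in>S. of_int (Poly_Mapping.lookup x C) * f C)"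
  unfolding fext_def by (rule sum.mono_neutral_left) (auto simp: in_keys_iff)

lemma fext_diff: "fext f (x - y) = fext f x - fext f y"
proof -
  let ?S = "Poly_Mapping.keys x \<union> Poly_Mapping.keys y"
  have "fext f (x - y) = (\<Sum>C\<in>?S. of_int (Poly_Mapping.lookup (x - y) C) * f C)"
    by (rule fext_superset) (auto dest: subsetD[OF keys_diff])
  also have "\<dots> = fext f x - fext f y"
    by (simp add: fext_superset[of ?S x] fext_superset[of ?S y] lookup_minus left_diff_distrib sum_subtractf)
  finally show ?thesis .
qed

lemma fext_0 [simp]: "fext f 0 = 0"
  by (simp add: fext_def)

lemma fext_of [simp]: "fext f (frag_of C) = f C"
  by (simp add: fext_def)

lemma fext_uminus: "fext f (- x) = - fext f x"
  using fext_diff[of f 0 x] by simp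

lemma fext_add: "fext f (x + y) = fext f x + fext f y"
  using fext_diff[of f x "- y"] by (simp add: fext_uminus)

lemma fext_frag_extend: "fext f (frag_extend g x) = fext (\<lambda>C. fext f (g C)) x"
  by (rule frag_induction[of x UNIV]) (simp_all add: frag_extend_diff fext_diff)

lemma fext_cmul: "fext f (frag_cmul c x) = of_int c * fext f x"
proof -
  have "fext f (frag_cmul c x) = (\<Sum>C\<in>Poly_Mapping.keys x. of_int (Poly_Mapping.lookup (frag_cmul c x) C) * f C)"
    by (rule fext_superset) (auto simp: keys_cmul)
  then show ?thesis by (simp add: fext_def sum_distrib_left mult.assoc)
qed

lemma fext_sum: "finite S \<Longrightarrow> fext f (\<Sum>i\<in>S. g i) = (\<Sum>i\<in>S. fext f (g i))"
  by (induction S rule: finite_induct) (simp_all add: fext_add)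

lemma frag_cmul_diff_right: "frag_cmul a (y - z) = frag_cmul a y - frag_cmul a z"
  by (rule poly_mapping_eqI) (simp add: lookup_minus right_diff_distrib)

lemma frag_extend_fun_diff: "frag_extend (\<lambda>c. f c - g c) x = frag_extend f x - frag_extend g x"
  by (simp add: frag_extend_def frag_cmul_diff_right sum_subtractf)

lemma frag_extend_fun_add: "frag_extend (\<lambda>c. f c + g c) x = frag_extend f x + frag_extend g x"
  by (simp add: frag_extend_def frag_cmul_distrib2 sum.distrib)

lemma frag_extend_fun_0: "frag_extend (\<lambda>c. 0) x = 0"
  by (simp add: frag_extend_def)

lemma iso_class_eq_iff:
  assumes "is_module A U" "is_module A V"
  shows "iso_class A U = iso_class A V \<longleftrightarrow> module_iso A U V"
proof
  assume "iso_class A U = iso_class A V"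
  moreover have "V \<in> iso_class A V"
    using assms module_iso_refl is_module_wf by (auto simp: iso_class_def)
  ultimately show "module_iso A U V" by (auto simp: iso_class_def)
next
  assume iso: "module_iso A U V"
  note wf = is_module_wf[OF assms(1)] is_module_wf[OF assms(2)]
  show "iso_class A U = iso_class A V"
    unfolding iso_class_def
    using module_iso_trans[OF iso _ wf] module_iso_trans[OF module_iso_sym[OF iso wf] _ wf(2,1)] is_module_wf
    by blast
qed

lemma rep_of_iso_class:
  assumes "is_module A V"
  shows "is_module A (rep_of (iso_class A V))" "module_iso A V (rep_of (iso_class A V))"
    "iso_class A (rep_of (iso_class A V)) = iso_class A V"
proof -
  have "V \<in> iso_class A V"
    using assms module_iso_refl is_module_wf by (auto simp: iso_class_def)
  then have "rep_of (iso_class A V) \<in> iso_class A V" unfolding rep_of_def by (rule someI)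
  then show 1: "is_module A (rep_of (iso_class A V))" "module_iso A V (rep_of (iso_class A V))"
    by (auto simp: iso_class_def)
  then show "iso_class A (rep_of (iso_class A V)) = iso_class A V"
    using iso_class_eq_iff[OF assms 1(1)] by simp
qed

lemma iso_classesE:
  assumes "C \<in> iso_classes A" obtains V where "is_module A V" "C = iso_class A V"
  using assms by (auto simp: iso_classes_def)

lemma iso_class_in: "is_module A V \<Longrightarrow> iso_class A V \<in> iso_classes A"
  by (simp add: iso_classes_def)

lemma indec_classes_subset: "indec_classes A \<subseteq> iso_classes A"
  by (auto simp: indec_classes_def iso_classes_def indecomposable_def)

text \<open>The axioms are properties of modules up to isomorphism, not identities in the Hopf
  algebra, since the ring structure on classes sees only these.\<close>

locale green_hopf =
  fixes H :: "('b, 'k::field, 'z) hopf_scheme"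
  assumes tensor_mod: "is_module H U \<Longrightarrow> is_module H V \<Longrightarrow> is_module H (tensor_module H U V)"
    and trivial_mod: "is_module H (trivial_module H)"
    and dual_mod: "is_module H V \<Longrightarrow> is_module H (dual_module H V)"
    and tensor_assoc: "is_module H U \<Longrightarrow> is_module H V \<Longrightarrow> is_module H W \<Longrightarrow>
      module_iso H (tensor_module H (tensor_module H U V) W) (tensor_module H U (tensor_module H V W))"
    and tensor_unit: "is_module H V \<Longrightarrow> module_iso H (tensor_module H (trivial_module H) V) V"
      "is_module H V \<Longrightarrow> module_iso H (tensor_module H V (trivial_module H)) V"
begin

abbreviation cls where "cls \<equiv> iso_class H"
abbreviation F where "F \<equiv> free_green_ring H"
abbreviation R where "R \<equiv> green_ring H"
abbreviation I where "I \<equiv> green_relations H"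
abbreviation co where "co \<equiv> green_coset H"

definition fmul :: "(('b, 'k) iso_cls \<Rightarrow>\<^sub>0 int) \<Rightarrow> (('b, 'k) iso_cls \<Rightarrow>\<^sub>0 int) \<Rightarrow> (('b, 'k) iso_cls \<Rightarrow>\<^sub>0 int)" where
  "fmul x y = frag_extend (\<lambda>C. frag_extend (\<lambda>D. frag_of (class_tensor H C D)) y) x"

definition rel :: "('b, 'k) rep \<Rightarrow> ('b, 'k) rep \<Rightarrow> (('b, 'k) iso_cls \<Rightarrow>\<^sub>0 int)" where
  "rel U V = frag_of (cls (direct_sum U V)) - (frag_of (cls U) + frag_of (cls V))"

lemma F_simps:
  "x \<in> carrier F \<longleftrightarrow> Poly_Mapping.keys x \<subseteq> iso_classes H"
  "x \<otimes>\<^bsub>F\<^esub> y = fmul x y" "x \<oplus>\<^bsub>F\<^esub> y = x + y" "\<zero>\<^bsub>F\<^esub> = 0" "\<one>\<^bsub>F\<^esub> = frag_of (cls (trivial_module H))"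
  by (simp_all add: free_green_ring_def fmul_def)

lemma class_tensor_cls:
  assumes "is_module H U" "is_module H V"
  shows "class_tensor H (cls U) (cls V) = cls (tensor_module H U V)"
proof -
  note u = rep_of_iso_class[OF assms(1)] and v = rep_of_iso_class[OF assms(2)]
  have "module_iso H (tensor_module H U V) (tensor_module H (rep_of (cls U)) (rep_of (cls V)))"
    using assms u v is_module_wf by (intro tensor_iso) auto
  then show ?thesis
    unfolding class_tensor_def using iso_class_eq_iff tensor_mod assms u v by metis
qed

lemma fmul_of: "is_module H U \<Longrightarrow> is_module H V \<Longrightarrow>
    fmul (frag_of (cls U)) (frag_of (cls V)) = frag_of (cls (tensor_module H U V))"
  by (simp add: fmul_def class_tensor_cls)

lemma fmul_diff: "fmul (x - y) z = fmul x z - fmul y z" "fmul x (y - z) = fmul x y - fmul x z"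
  by (simp_all add: fmul_def frag_extend_diff frag_extend_fun_diff)

lemma fmul_add: "fmul (x + y) z = fmul x z + fmul y z" "fmul x (y + z) = fmul x y + fmul x z"
  by (simp_all add: fmul_def frag_extend_add frag_extend_fun_add)

lemma fmul_0 [simp]: "fmul 0 x = 0" "fmul x 0 = 0"
  by (simp_all add: fmul_def frag_extend_fun_0)

lemma F_diff: "x \<in> carrier F \<Longrightarrow> y \<in> carrier F \<Longrightarrow> x - y \<in> carrier F"
  using keys_diff[of x y] by (auto simp: F_simps)

lemma F_0: "0 \<in> carrier F"
  by (simp add: F_simps)

lemma F_of: "is_module H V \<Longrightarrow> frag_of (cls V) \<in> carrier F"
  by (simp add: F_simps iso_class_in)

lemma F_induct [consumes 1, case_names zero of diff]:
  assumes x: "x \<in> carrier F" and "P 0" "\<And>V. is_module H V \<Longrightarrow> P (frag_of (cls V))"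
    "\<And>x y. P x \<Longrightarrow> P y \<Longrightarrow> P (x - y)"
  shows "P x"
proof (rule frag_induction[of x "iso_classes H"])
  show "Poly_Mapping.keys x \<subseteq> iso_classes H" using x by (simp add: F_simps)
  show "P (frag_of C)" if "C \<in> iso_classes H" for C
    using that assms(3) by (auto elim: iso_classesE)
qed (use assms in auto)

lemma fmul_closed: "x \<in> carrier F \<Longrightarrow> y \<in> carrier F \<Longrightarrow> fmul x y \<in> carrier F"
proof (induction x rule: F_induct)
  case (of U)
  from of(2,1) show ?case
    by (induction y rule: F_induct) (simp_all add: fmul_of F_of tensor_mod fmul_diff F_diff F_0)
qed (simp_all add: fmul_diff F_diff F_0)

lemma fmul_assoc:
  assumes "x \<in> carrier F" "y \<in> carrier F" "z \<in> carrier F"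
  shows "fmul (fmul x y) z = fmul x (fmul y z)"
  using assms
proof (induction x rule: F_induct)
  case (of U)
  note U = of(1)
  show ?case using of(2,3)
  proof (induction y rule: F_induct)
    case (of V)
    note V = of(1)
    show ?case using of(2)
    proof (induction z rule: F_induct)
      case (of W)
      then show ?case using U V tensor_assoc[OF U V of]
        by (simp add: fmul_of tensor_mod iso_class_eq_iff frag_of_eq)
    qed (simp_all add: fmul_diff)
  qed (simp_all add: fmul_diff)
qed (simp_all add: fmul_diff)

lemma fmul_one:
  assumes "x \<in> carrier F"
  shows "fmul (frag_of (cls (trivial_module H))) x = x" "fmul x (frag_of (cls (trivial_module H))) = x"
  using assms
proof (induction x rule: F_induct)
  case (of V)
  { case 1 show ?case using of tensor_unit by (simp add: fmul_of trivial_mod tensor_mod iso_class_eq_iff frag_of_eq) }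
  { case 2 show ?case using of tensor_unit by (simp add: fmul_of trivial_mod tensor_mod iso_class_eq_iff frag_of_eq) }
qed (simp_all add: fmul_diff)

lemma ring_F: "ring F"
proof (rule ringI)
  show "abelian_group F"
  proof (rule abelian_groupI)
    fix x assume x: "x \<in> carrier F"
    show "\<exists>y\<in>carrier F. y \<oplus>\<^bsub>F\<^esub> x = \<zero>\<^bsub>F\<^esub>"
      using F_diff[OF F_0 x] by (intro bexI[of _ "- x"]) (simp_all add: F_simps)
  next
    fix x y assume "x \<in> carrier F" "y \<in> carrier F"
    then show "x \<oplus>\<^bsub>F\<^esub> y \<in> carrier F" using F_diff[of x "0 - y"] F_diff[OF F_0] by (simp add: F_simps(3))
  qed (simp_all add: F_simps(3-5) F_0 add_ac)
  show "Group.monoid F"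
    by (rule monoidI) (simp_all add: F_simps(2,5) fmul_closed fmul_assoc fmul_one F_of trivial_mod)
qed (simp_all add: F_simps(2,3) fmul_add)

sublocale Fr: ring F
  by (rule ring_F)

lemma a_inv_F: "x \<in> carrier F \<Longrightarrow> \<ominus>\<^bsub>F\<^esub> x = - x"
  using Fr.minus_equality[of "- x" x] F_diff[OF F_0, of x] by (simp add: F_simps(3,4))

section \<open>The direct sum relations form an ideal\<close>

lemma rel_carrier: "is_module H U \<Longrightarrow> is_module H V \<Longrightarrow> rel U V \<in> carrier F"
proof -
  assume m: "is_module H U" "is_module H V"
  then have "frag_of (cls U) + frag_of (cls V) \<in> carrier F"
    using Fr.a_closed[OF F_of F_of] by (simp add: F_simps(3))
  then show ?thesis using m by (simp add: rel_def F_diff F_of is_module_direct_sum)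
qed

lemma I_def': "I = generate (add_monoid F) {rel U V | U V. is_module H U \<and> is_module H V}"
  by (simp add: green_relations_def rel_def)

lemma additive_subgroup_I: "additive_subgroup I F"
  unfolding I_def' by (intro additive_subgroup.intro group.generate_is_subgroup Fr.a_group)
    (auto simp: rel_carrier)

lemma I_carrier: "x \<in> I \<Longrightarrow> x \<in> carrier F"
  using additive_subgroup.a_Hcarr[OF additive_subgroup_I] .

lemma I_diff: "x \<in> I \<Longrightarrow> y \<in> I \<Longrightarrow> x - y \<in> I"
  using additive_subgroup.a_closed[OF additive_subgroup_I, of x "- y"]
    abelian_group.a_inv_closed additive_subgroup.a_subgroup[OF additive_subgroup_I]
    group.subgroupE(3)[OF Fr.a_group additive_subgroup.a_subgroup[OF additive_subgroup_I], of y]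
    a_inv_F[OF I_carrier, of y]
  by (simp add: F_simps(3) a_inv_def)

lemma I_0: "0 \<in> I"
  using additive_subgroup.zero_closed[OF additive_subgroup_I] by (simp add: F_simps)

lemma I_add: "x \<in> I \<Longrightarrow> y \<in> I \<Longrightarrow> x + y \<in> I"
  using I_diff[of x "0 - y"] I_diff[OF I_0, of y] by simp

lemma I_rel: "is_module H U \<Longrightarrow> is_module H V \<Longrightarrow> rel U V \<in> I"
  unfolding I_def' by (rule generate.incl) blast

text \<open>Inverses and sums of the generated subgroup are both expressed by differences, so every
  additive property needs a single closure step.\<close>

lemma I_induct [consumes 1, case_names zero rel diff]:
  assumes x: "x \<in> I" and P0: "P 0" and Prel: "\<And>U V. is_module H U \<Longrightarrow> is_module H V \<Longrightarrow> P (rel U V)"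
    and Pdiff: "\<And>x y. P x \<Longrightarrow> P y \<Longrightarrow> P (x - y)"
  shows "P x"
  using x unfolding I_def'
proof (induction rule: generate.induct)
  case one
  then show ?case using P0 by (simp add: F_simps)
next
  case (incl h)
  then show ?case using Prel by blast
next
  case (inv h)
  then obtain U V where h: "h = rel U V" "is_module H U" "is_module H V" by blast
  have "inv\<^bsub>add_monoid F\<^esub> h = 0 - h"
    using a_inv_F[of h] h rel_carrier by (simp add: a_inv_def)
  then show ?case using Pdiff[OF P0 Prel[OF h(2,3)]] h by simp
next
  case (eng h1 h2)
  then show ?case using Pdiff[of h1 "0 - h2"] Pdiff[OF P0, of h2] by (simp add: F_simps)
qed

text \<open>Tensoring a direct sum relation with \<open>W\<close>, on either side, gives the direct
  sum relation of the tensor products; everything else is bilinearity.\<close>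

lemma ideal_I: "ideal I F"
proof (intro ideal.intro ideal_axioms.intro additive_subgroup_I ring_F)
  have rels: "fmul (frag_of (cls W)) (rel U V) = rel (tensor_module H W U) (tensor_module H W V)"
    "fmul (rel U V) (frag_of (cls W)) = rel (tensor_module H U W) (tensor_module H V W)"
    if m: "is_module H U" "is_module H V" "is_module H W" for U V W
  proof -
    note S = is_module_direct_sum[OF m(1,2)]
    note wf = is_module_wf[OF m(1)] is_module_wf[OF m(2)] is_module_wf[OF m(3)] is_module_wf[OF S]
    note bp = biproduct_tensor[OF wf(3,4,1,2) biproduct_direct_sum[OF wf(1,2)]]
    have "cls (tensor_module H W (direct_sum U V)) = cls (direct_sum (tensor_module H W U) (tensor_module H W V))"
      "cls (tensor_module H (direct_sum U V) W) = cls (direct_sum (tensor_module H U W) (tensor_module H V W))"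
      using biproduct_imp_iso[OF bp(2) rep_wf_tensor rep_wf_tensor rep_wf_tensor]
        biproduct_imp_iso[OF bp(1) rep_wf_tensor rep_wf_tensor rep_wf_tensor]
      by (simp_all add: iso_class_eq_iff tensor_mod is_module_direct_sum m)
    then show "fmul (frag_of (cls W)) (rel U V) = rel (tensor_module H W U) (tensor_module H W V)"
      "fmul (rel U V) (frag_of (cls W)) = rel (tensor_module H U W) (tensor_module H V W)"
      using m S by (simp_all add: rel_def fmul_diff fmul_add fmul_of)
  qed
  fix a x assume a: "a \<in> I" and x: "x \<in> carrier F"
  show "x \<otimes>\<^bsub>F\<^esub> a \<in> I" unfolding F_simps(2) using a
  proof (induction a rule: I_induct)
    case (rel U V)
    show ?case using x by (induction x rule: F_induct)
      (use rel in \<open>simp_all add: fmul_diff I_diff I_0 rels I_rel tensor_mod\<close>)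
  qed (simp_all add: fmul_diff I_diff I_0)
  show "a \<otimes>\<^bsub>F\<^esub> x \<in> I" unfolding F_simps(2) using a
  proof (induction a rule: I_induct)
    case (rel U V)
    show ?case using x by (induction x rule: F_induct)
      (use rel in \<open>simp_all add: fmul_diff I_diff I_0 rels I_rel tensor_mod\<close>)
  qed (simp_all add: fmul_diff I_diff I_0)
qed

section \<open>The quotient ring, spans of classes, and duality\<close>

lemma ring_R: "ring R"
  unfolding green_ring_def by (rule ideal.quotient_is_ring[OF ideal_I])

sublocale Rr: ring R
  by (rule ring_R)

lemma co_hom: "co \<in> Ring.ring_hom F R"
proof -
  have "co = (\<lambda>x. I +>\<^bsub>F\<^esub> x)" by (simp add: green_coset_def fun_eq_iff)
  then show ?thesis using ideal.rcos_ring_hom[OF ideal_I] by (simp add: green_ring_def)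
qed

lemma co_simps:
  "x \<in> carrier F \<Longrightarrow> co x \<in> carrier R"
  "x \<in> carrier F \<Longrightarrow> y \<in> carrier F \<Longrightarrow> co x \<otimes>\<^bsub>R\<^esub> co y = co (fmul x y)"
  "x \<in> carrier F \<Longrightarrow> y \<in> carrier F \<Longrightarrow> co x \<oplus>\<^bsub>R\<^esub> co y = co (x + y)"
  "\<one>\<^bsub>R\<^esub> = co (frag_of (cls (trivial_module H)))"
  using ring_hom_closed[OF co_hom] ring_hom_mult[OF co_hom] ring_hom_add[OF co_hom] ring_hom_one[OF co_hom]
  by (simp_all add: F_simps(2,3,5))

lemma co_0: "\<zero>\<^bsub>R\<^esub> = co 0"
proof -
  have "co 0 \<oplus>\<^bsub>R\<^esub> co 0 = co 0" by (simp add: co_simps F_0)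
  then show ?thesis using Rr.add.r_cancel_one[of "co 0" "co 0"] co_simps(1)[OF F_0] by simp
qed

lemma co_carrierE:
  assumes "y \<in> carrier R" obtains x where "x \<in> carrier F" "y = co x"
  using assms by (auto simp: green_ring_def FactRing_def A_RCOSETS_def' green_coset_def)

lemma co_set: "co x = {h + x | h. h \<in> I}"
  by (auto simp: green_coset_def a_r_coset_def' F_simps)

lemma co_eq_iff: "co x = co y \<longleftrightarrow> x - y \<in> I"
proof
  assume "co x = co y"
  moreover have "x \<in> co x" using I_0 by (force simp: co_set)
  ultimately show "x - y \<in> I" by (auto simp: co_set)
next
  assume xy: "x - y \<in> I"
  show "co x = co y"
  proof (intro equalityI subsetI)
    fix z assume "z \<in> co x"
    then obtain h where "h \<in> I" "z = h + x" by (auto simp: co_set)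
    then have "h + (x - y) \<in> I" "z = (h + (x - y)) + y" using I_add xy by auto
    then show "z \<in> co y" unfolding co_set by blast
  next
    fix z assume "z \<in> co y"
    then obtain h where "h \<in> I" "z = h + y" by (auto simp: co_set)
    then have "h - (x - y) \<in> I" "z = (h - (x - y)) + x" using I_diff xy by auto
    then show "z \<in> co x" unfolding co_set by blast
  qed
qed

lemma co_minus:
  assumes "x \<in> carrier F" "y \<in> carrier F"
  shows "co x \<ominus>\<^bsub>R\<^esub> co y = co (x - y)"
proof -
  have y: "- y \<in> carrier F" using F_diff[OF F_0 assms(2)] by simp
  have "co (- y) \<oplus>\<^bsub>R\<^esub> co y = \<zero>\<^bsub>R\<^esub>" using assms y by (simp add: co_simps co_0)
  then have "\<ominus>\<^bsub>R\<^esub> co y = co (- y)" using Rr.minus_equality co_simps(1) assms y by blast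
  then show ?thesis using assms y by (simp add: a_minus_def co_simps)
qed

lemma subset_carrier_F: "X \<subseteq> iso_classes H \<Longrightarrow> Poly_Mapping.keys a \<subseteq> X \<Longrightarrow> a \<in> carrier F"
  by (auto simp: F_simps)

text \<open>Replaces the generated subgroup by explicit combinations, so that membership becomes a
  condition on supports.\<close>

lemma green_span_eq:
  assumes X: "X \<subseteq> iso_classes H"
  shows "green_span H X = co ` {a. Poly_Mapping.keys a \<subseteq> X}" "additive_subgroup (green_span H X) R"
proof -
  let ?G = "(\<lambda>C. co (frag_of C)) ` X"
  have G: "?G \<subseteq> carrier (add_monoid R)"
    using X by (auto simp: keys_frag_of F_simps intro!: co_simps(1))
  have sub: "subgroup (green_span H X) (add_monoid R)"
    unfolding green_span_def by (rule group.generate_is_subgroup[OF Rr.a_group G])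
  then show as: "additive_subgroup (green_span H X) R" by (rule additive_subgroup.intro)
  show "green_span H X = co ` {a. Poly_Mapping.keys a \<subseteq> X}"
  proof (intro equalityI subsetI)
    fix y assume "y \<in> green_span H X"
    then show "y \<in> co ` {a. Poly_Mapping.keys a \<subseteq> X}"
      unfolding green_span_def
    proof (induction rule: generate.induct)
      case one
      then show ?case by (intro image_eqI[of _ _ 0]) (simp_all add: co_0)
    next
      case (incl h)
      then show ?case by (auto simp: keys_frag_of)
    next
      case (inv h)
      then obtain C where C: "C \<in> X" "h = co (frag_of C)" by auto
      then have c: "frag_of C \<in> carrier F" "- frag_of C \<in> carrier F"
        using X F_diff[OF F_0, of "frag_of C"] by (auto simp: F_simps)
      have "co (- frag_of C) \<oplus>\<^bsub>R\<^esub> h = \<zero>\<^bsub>R\<^esub>" using c C by (simp add: co_simps co_0)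
      then have "\<ominus>\<^bsub>R\<^esub> h = co (- frag_of C)" using Rr.minus_equality co_simps(1) c C by blast
      then show ?case using C by (auto simp: a_inv_def keys_frag_of)
    next
      case (eng h1 h2)
      then obtain a b where "Poly_Mapping.keys a \<subseteq> X" "Poly_Mapping.keys b \<subseteq> X" "h1 = co a" "h2 = co b" by auto
      moreover from this have "Poly_Mapping.keys (a + b) \<subseteq> X" using keys_add[of a b] by blast
      ultimately show ?case using subset_carrier_F[OF X] by (auto simp: co_simps)
    qed
  next
    fix y assume "y \<in> co ` {a. Poly_Mapping.keys a \<subseteq> X}"
    then obtain a where a: "Poly_Mapping.keys a \<subseteq> X" "y = co a" by auto
    have "Poly_Mapping.keys a \<subseteq> X \<and> co a \<in> green_span H X" using a(1)
    proof (induction a rule: frag_induction)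
      case zero
      then show ?case using additive_subgroup.zero_closed[OF as] by (simp add: co_0)
    next
      case (one C)
      then show ?case unfolding green_span_def by (auto simp: keys_frag_of intro: generate.incl)
    next
      case (diff a b)
      then have c: "a \<in> carrier F" "b \<in> carrier F" using subset_carrier_F[OF X] by auto
      have "co a \<ominus>\<^bsub>R\<^esub> co b \<in> green_span H X"
        using diff additive_subgroup.a_closed[OF as] group.subgroupE(3)[OF Rr.a_group sub]
        by (simp add: a_minus_def a_inv_def)
      then show ?case using diff keys_diff[of a b] by (auto simp: co_minus[OF c])
    qed
    then show "y \<in> green_span H X" using a by simp
  qed
qed

definition fdual :: "(('b, 'k) iso_cls \<Rightarrow>\<^sub>0 int) \<Rightarrow> (('b, 'k) iso_cls \<Rightarrow>\<^sub>0 int)" where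
  "fdual x = frag_extend (\<lambda>C. frag_of (cls (dual_module H (rep_of C)))) x"

lemma fdual_diff: "fdual (x - y) = fdual x - fdual y"
  by (simp add: fdual_def frag_extend_diff)

lemma fdual_of: "is_module H V \<Longrightarrow> fdual (frag_of (cls V)) = frag_of (cls (dual_module H V))"
proof -
  assume V: "is_module H V"
  note v = rep_of_iso_class[OF V]
  have "module_iso H (dual_module H V) (dual_module H (rep_of (cls V)))"
    using V v is_module_wf by (intro dual_iso) auto
  then show ?thesis unfolding fdual_def using iso_class_eq_iff dual_mod V v by (metis frag_extend_of)
qed

lemma fdual_I: "x \<in> I \<Longrightarrow> fdual x \<in> I"
proof (induction x rule: I_induct)
  case (rel U V)
  note S = is_module_direct_sum[OF rel]
  have "module_iso H (dual_module H (direct_sum U V)) (direct_sum (dual_module H U) (dual_module H V))"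
    using biproduct_imp_iso[OF biproduct_dual[OF _ _ _ biproduct_direct_sum]] is_module_wf rep_wf_dual rel S by blast
  then have "cls (dual_module H (direct_sum U V)) = cls (direct_sum (dual_module H U) (dual_module H V))"
    using iso_class_eq_iff dual_mod rel S is_module_direct_sum by metis
  moreover have "fdual (rel U V) = fdual (frag_of (cls (direct_sum U V))) - (fdual (frag_of (cls U)) + fdual (frag_of (cls V)))"
    by (simp add: rel_def fdual_def frag_extend_diff frag_extend_add)
  ultimately have "fdual (rel U V) = rel (dual_module H U) (dual_module H V)"
    using rel S by (simp add: fdual_of rel_def)
  then show ?case using I_rel rel dual_mod by simp
qed (simp_all add: I_0 I_diff fdual_diff, simp add: fdual_def I_0)

text \<open>Duality maps relations to relations by \<open>fdual_I\<close>, so all representatives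
  yield the same coset and the union in \<open>green_dual\<close> collapses to it.\<close>

lemma green_dual_co: "green_dual H (co x) = co (fdual x)"
proof -
  have "co (fdual a) = co (fdual x)" if "a \<in> co x" for a
  proof -
    from that obtain h where "h \<in> I" "a = h + x" by (auto simp: co_set)
    then have "a - x \<in> I" by simp
    then have "fdual a - fdual x \<in> I" using fdual_I by (simp flip: fdual_diff)
    then show ?thesis by (simp add: co_eq_iff)
  qed
  moreover have "x \<in> co x" using I_0 by (force simp: co_set)
  ultimately show ?thesis unfolding green_dual_def fdual_def by blast
qed

lemma green_class_mult:
  "is_module H U \<Longrightarrow> is_module H V \<Longrightarrow> green_class H U \<otimes>\<^bsub>R\<^esub> green_class H V = green_class H (tensor_module H U V)"
  by (simp add: green_class_def co_simps F_of fmul_of)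

end

section \<open>The Green ring of the Taft algebra\<close>

sublocale taft_param \<subseteq> green_hopf "taft n q"
  by unfold_locales (simp_all add: tensor_module_K trivial_module_K dual_module_K tensor_assoc_K tensor_unit_K)

context taft_param begin

definition clsM :: "nat \<times> int \<Rightarrow> (nat \<times> nat, 'k) iso_cls" where
  "clsM b = cls (M (fst b) (snd b))"

text \<open>The Krull-Schmidt decomposition of \<open>V\<close> as an element of the free group;
  being additive, it is a normal form for classes modulo the relations.\<close>

definition decomp :: "(nat \<times> nat, 'k) rep \<Rightarrow> ((nat \<times> nat, 'k) iso_cls \<Rightarrow>\<^sub>0 int)" where
  "decomp V = (\<Sum>b\<in>idx. frag_cmul (mult_M (fst b) (snd b) V) (frag_of (clsM b)))"

text \<open>The linear extension of \<open>decomp\<close>. It retracts the free group onto the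
  combinations of indecomposable classes, and on the carrier its kernel is the ideal of relations,
  by \<open>expand_I\<close> and \<open>expand_equiv\<close>.\<close>

definition expand :: "((nat \<times> nat, 'k) iso_cls \<Rightarrow>\<^sub>0 int) \<Rightarrow> ((nat \<times> nat, 'k) iso_cls \<Rightarrow>\<^sub>0 int)" where
  "expand x = (\<Sum>b\<in>idx. frag_cmul (fext (\<lambda>C. mult_M (fst b) (snd b) (rep_of C)) x) (frag_of (clsM b)))"

lemma idx_bounds: "b \<in> idx \<Longrightarrow> 1 \<le> fst b" "b \<in> idx \<Longrightarrow> fst b \<le> n"
  by (auto simp: idx_def)

lemma idx_mod_iff: "(l, s mod int n) \<in> idx \<longleftrightarrow> 1 \<le> l \<and> l \<le> n"
  using n2 by (auto simp: idx_def)

lemma module_clsM: "b \<in> idx \<Longrightarrow> is_module K (M (fst b) (snd b))"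
  by (simp add: module_M idx_bounds)

lemma cls_M: "cls (M l r) = clsM (l, r mod int n)"
  using M_cong[of r "r mod int n" l] by (simp add: clsM_def)

lemma indec_classes_K: "indec_classes K = clsM ` idx"
proof (intro equalityI subsetI)
  fix C assume "C \<in> indec_classes K"
  then obtain V where V: "indecomposable K V" "C = cls V" by (auto simp: indec_classes_def)
  then obtain l r where lr: "1 \<le> l" "l \<le> n" "module_iso K V (M l r)" by (auto elim: indecomposable_iso_M)
  then have "C = cls (M l r)"
    using V iso_class_eq_iff[of K V "M l r"] module_M(1) by (simp add: indecomposable_def)
  then show "C \<in> clsM ` idx" unfolding cls_M using lr idx_mod_iff by blast
next
  fix C assume "C \<in> clsM ` idx"
  then obtain b where "b \<in> idx" "C = clsM b" by blast
  then show "C \<in> indec_classes K"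
    using indecomposable_M idx_bounds by (auto simp: indec_classes_def clsM_def)
qed

lemma decomp_add_inv: "add_inv decomp"
  unfolding decomp_def
  by (intro add_inv_sum) (use add_inv_mult in \<open>auto simp: add_inv_def frag_cmul_distrib\<close>)

lemma decomp_M:
  assumes "1 \<le> l" "l \<le> n" shows "decomp (M l r) = frag_of (cls (M l r))"
proof -
  have "decomp (M l r) = (\<Sum>b\<in>idx. if b = (l, r mod int n) then frag_of (clsM b) else 0)"
    unfolding decomp_def
    by (rule sum.cong) (use assms in \<open>auto simp: idx_def mult_M_M split: if_splits\<close>)
  also have "\<dots> = frag_of (clsM (l, r mod int n))"
    using assms finite_idx idx_mod_iff by simp
  finally show ?thesis by (simp add: cls_M)
qed

lemma keys_decomp: "Poly_Mapping.keys (decomp V) \<subseteq> clsM ` {b \<in> idx. mult_M (fst b) (snd b) V \<noteq> 0}"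
proof
  fix C assume "C \<in> Poly_Mapping.keys (decomp V)"
  then have "(\<Sum>b\<in>idx. mult_M (fst b) (snd b) V * (if C = clsM b then 1 else 0)) \<noteq> 0"
    by (simp add: in_keys_iff decomp_def lookup_sum)
  then obtain b where "b \<in> idx" "mult_M (fst b) (snd b) V * (if C = clsM b then 1 else 0) \<noteq> 0"
    by (meson sum.neutral)
  then show "C \<in> clsM ` {b \<in> idx. mult_M (fst b) (snd b) V \<noteq> 0}" by (auto split: if_splits)
qed

lemma expand_diff: "expand (x - y) = expand x - expand y"
  unfolding expand_def fext_diff frag_cmul_diff_distrib by (simp add: sum_subtractf)

lemma expand_0 [simp]: "expand 0 = 0"
  by (simp add: expand_def)

lemma expand_of: "is_module K V \<Longrightarrow> expand (frag_of (cls V)) = decomp V"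
proof -
  assume V: "is_module K V"
  note v = rep_of_iso_class[OF V]
  have "mult_M l r (rep_of (cls V)) = mult_M l r V" for l r
    using add_invD(1)[OF add_inv_mult V v(1,2)] by simp
  then show ?thesis by (simp add: expand_def decomp_def)
qed

lemma expand_I: "x \<in> I \<Longrightarrow> expand x = 0"
proof (induction x rule: I_induct)
  case (rel U V)
  have "expand (rel U V) = expand (frag_of (cls (direct_sum U V)) - frag_of (cls U) - frag_of (cls V))"
    by (simp add: rel_def diff_diff_eq)
  then show ?case using rel add_invD(2)[OF decomp_add_inv rel]
    by (simp add: expand_diff expand_of is_module_direct_sum)
qed (simp_all add: expand_diff)

lemma decomp_equiv: "is_module K V \<Longrightarrow> frag_of (cls V) - decomp V \<in> I"
proof (induction rule: module_induct)
  case (zero V)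
  have "decomp V = 0" by (rule add_inv_zero[OF decomp_add_inv zero])
  \<comment> \<open>The class of the zero module is a nonzero generator of the free group. It is
    killed in the quotient because the relation of \<open>V\<close> with itself equals minus this
    generator.\<close>
  moreover have "cls (direct_sum V V) = cls V"
  proof -
    have "hom_mat K (direct_sum V V) V (0\<^sub>m 0 0)"
      using zero rep_wfD[OF is_module_wf[OF zero(1)]] rep_wfD[OF is_module_wf[OF is_module_direct_sum[OF zero(1,1)]]]
      by (auto simp: hom_mat_def intro!: eq_matI)
    then have "module_iso K (direct_sum V V) V"
      by (rule module_isoI[of _ _ _ _ "0\<^sub>m 0 0"]) (use zero in \<open>auto intro!: eq_matI\<close>)
    then show ?thesis using iso_class_eq_iff is_module_direct_sum zero(1) by blast
  qed
  then have "0 - rel V V = frag_of (cls V)" by (simp add: rel_def)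
  then have "frag_of (cls V) \<in> I" using I_diff[OF I_0 I_rel[OF zero(1,1)]] by simp
  ultimately show ?case by simp
next
  case (step V l r W)
  note Ml = module_M(1)[OF step(3), of r]
  have "cls V = cls (direct_sum (M l r) W)"
    using biproduct_imp_iso[OF step(5)] iso_class_eq_iff is_module_direct_sum Ml step is_module_wf by metis
  moreover have "decomp V = decomp (M l r) + decomp W"
    by (rule add_inv_biproduct[OF decomp_add_inv step(1) Ml step(4,5)])
  ultimately have "frag_of (cls V) - decomp V = rel (M l r) W + (frag_of (cls W) - decomp W)"
    using decomp_M[OF step(2,3)] by (simp add: rel_def)
  then show ?case using I_add[OF I_rel[OF Ml step(4)] step(6)] by simp
qed

lemma expand_equiv: "x \<in> carrier F \<Longrightarrow> x - expand x \<in> I"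
proof (induction x rule: F_induct)
  case (diff x y)
  have eq: "x - y - expand (x - y) = (x - expand x) - (y - expand y)" by (simp add: expand_diff)
  show ?case unfolding eq using I_diff diff by blast
qed (simp_all add: I_0 expand_of decomp_equiv)

lemma keys_expand: "Poly_Mapping.keys (expand x) \<subseteq> indec_classes K"
  unfolding expand_def indec_classes_K
  by (rule order_trans[OF keys_sum]) (auto simp: keys_frag_of)

lemma expand_indec: "Poly_Mapping.keys x \<subseteq> indec_classes K \<Longrightarrow> expand x = x"
proof (induction x rule: frag_induction)
  case (one C)
  then obtain b where "b \<in> idx" "C = clsM b" by (auto simp: indec_classes_K)
  then show ?case
    using expand_of[OF module_clsM] decomp_M[OF idx_bounds(1,2)] by (simp add: clsM_def)
qed (simp_all add: expand_diff)

lemma expand_co: "co x = co y \<Longrightarrow> expand x = expand y"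
  using expand_I[of "x - y"] by (simp add: co_eq_iff expand_diff)

text \<open>Makes the definite description in \<open>green_coeffs\<close> meaningful: existence is
  \<open>expand_equiv\<close>, and uniqueness holds since \<open>expand\<close> is constant on
  cosets and fixes combinations of indecomposables.\<close>

lemma green_coeffs_co:
  assumes "x \<in> carrier F" shows "green_coeffs K (co x) = expand x"
  unfolding green_coeffs_def
proof (rule the_equality)
  have "co (expand x) = co x"
  proof -
    have "0 - (x - expand x) \<in> I" by (rule I_diff[OF I_0 expand_equiv[OF assms]])
    then show ?thesis by (simp add: co_eq_iff)
  qed
  then show "Poly_Mapping.keys (expand x) \<subseteq> indec_classes K \<and> co (expand x) = co x"
    using keys_expand by simp
  fix a assume a: "Poly_Mapping.keys a \<subseteq> indec_classes K \<and> co a = co x"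
  then show "a = expand x" using expand_indec expand_co by metis
qed

lemma indec_carrier: "Poly_Mapping.keys a \<subseteq> indec_classes K \<Longrightarrow> a \<in> carrier F"
  using subset_carrier_F[OF indec_classes_subset] .

lemma co_in_span_iff:
  assumes Y: "Y \<subseteq> indec_classes K" and x: "x \<in> carrier F"
  shows "co x \<in> green_span K Y \<longleftrightarrow> Poly_Mapping.keys (expand x) \<subseteq> Y"
proof -
  note sp = green_span_eq(1)[OF order_trans[OF Y indec_classes_subset]]
  show ?thesis
  proof
    assume "co x \<in> green_span K Y"
    then obtain a where a: "Poly_Mapping.keys a \<subseteq> Y" "co x = co a" unfolding sp by blast
    then have "expand x = a" using expand_co expand_indec Y by (metis order_trans)
    then show "Poly_Mapping.keys (expand x) \<subseteq> Y" using a by simp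
  next
    assume "Poly_Mapping.keys (expand x) \<subseteq> Y"
    moreover have "co x = co (expand x)" using expand_equiv[OF x] by (simp add: co_eq_iff)
    ultimately show "co x \<in> green_span K Y" unfolding sp by blast
  qed
qed

section \<open>The maximal representation ideal\<close>

text \<open>The classes of length \<open>n\<close>, that is, of the indecomposable projective
  modules.\<close>

definition top_classes :: "(nat \<times> nat, 'k) iso_cls set" where
  "top_classes = clsM ` {b \<in> idx. fst b = n}"

lemma top_subset: "top_classes \<subseteq> indec_classes K"
  by (auto simp: top_classes_def indec_classes_K)

lemma keys_decomp_top: "is_module K V \<Longrightarrow> psi V = 0 \<Longrightarrow> Poly_Mapping.keys (decomp V) \<subseteq> top_classes"
proof -
  assume "is_module K V" "psi V = 0"
  then have "{b \<in> idx. mult_M (fst b) (snd b) V \<noteq> 0} \<subseteq> {b \<in> idx. fst b = n}"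
    using idx_bounds(2) by (fastforce simp: psi_zero_iff)
  then show ?thesis using keys_decomp unfolding top_classes_def by blast
qed

lemma rep_ideal_top: "rep_ideal_index K top_classes"
  unfolding rep_ideal_index_def
proof (intro conjI)
  note sp = green_span_eq[OF order_trans[OF top_subset indec_classes_subset]]
  have keys_d: "Poly_Mapping.keys (x - y) \<subseteq> Z" if "Poly_Mapping.keys x \<subseteq> Z" "Poly_Mapping.keys y \<subseteq> Z"
    for x y :: "(nat \<times> nat, 'k) iso_cls \<Rightarrow>\<^sub>0 int" and Z
    using keys_diff[of x y] that by blast
  have "clsM (1, 0) \<notin> top_classes"
  proof
    assume "clsM (1, 0) \<in> top_classes"
    then obtain s where "clsM (1, 0) = clsM (n, s)" "(n, s) \<in> idx" by (auto simp: top_classes_def)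
    then have "module_iso K (M 1 0) (M n s)"
      using iso_class_eq_iff[OF module_M(1)[of 1 0] module_M(1)[OF order_refl, of s]] n2 by (simp add: clsM_def)
    then show False using n2 by (auto dest: module_iso_dim)
  qed
  moreover have "clsM (1, 0) \<in> indec_classes K" using n2 by (auto simp: indec_classes_K idx_def)
  ultimately show "top_classes \<subset> indec_classes K" using top_subset by blast
  \<comment> \<open>Linearity in both arguments reduces this to classes of genuine modules. Only
    there does \<open>psi = 0\<close> force all summands to have length \<open>n\<close>; for
    virtual elements terms could cancel.\<close>
  have prod: "Poly_Mapping.keys (expand (fmul x a)) \<subseteq> top_classes \<and> Poly_Mapping.keys (expand (fmul a x)) \<subseteq> top_classes"
    if x: "x \<in> carrier F" and a: "Poly_Mapping.keys a \<subseteq> top_classes" for x a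
    using a
  proof (induction a rule: frag_induction)
    case (one C)
    then obtain b where b: "b \<in> idx" "fst b = n" "C = clsM b" by (auto simp: top_classes_def)
    have Mb: "is_module K (M (fst b) (snd b))" "psi (M (fst b) (snd b)) = 0"
      using b module_clsM[OF b(1)] psi_M[of n] by simp_all
    have C: "C = cls (M (fst b) (snd b))" using b by (simp add: clsM_def)
    show ?case using x
      by (induction x rule: F_induct)
        (simp_all add: C fmul_of Mb expand_of tensor_mod keys_decomp_top psi_tensor fmul_diff expand_diff keys_d)
  qed (simp_all add: fmul_diff expand_diff keys_d)
  have mult: "y \<otimes>\<^bsub>R\<^esub> z \<in> green_span K top_classes \<and> z \<otimes>\<^bsub>R\<^esub> y \<in> green_span K top_classes"
    if z: "z \<in> green_span K top_classes" and y: "y \<in> carrier R" for y z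
  proof -
    obtain a where a: "Poly_Mapping.keys a \<subseteq> top_classes" "z = co a" using z unfolding sp by blast
    obtain x where x: "x \<in> carrier F" "y = co x" using y by (rule co_carrierE)
    have ac: "a \<in> carrier F" using a top_subset indec_carrier by blast
    show ?thesis
      using prod[OF x(1) a(1)] a(2) x ac by (simp add: co_simps co_in_span_iff[OF top_subset] fmul_closed)
  qed
  show "ideal (green_span K top_classes) R"
    by (intro ideal.intro ideal_axioms.intro sp(2) ring_R) (use mult in blast)+
  show "\<forall>x\<in>green_span K top_classes. green_dual K x \<in> green_span K top_classes"
  proof
    fix z assume "z \<in> green_span K top_classes"
    then obtain a where a: "Poly_Mapping.keys a \<subseteq> top_classes" "z = co a" unfolding sp by blast
    have "fdual a \<in> carrier F \<and> Poly_Mapping.keys (expand (fdual a)) \<subseteq> top_classes" using a(1)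
    proof (induction a rule: frag_induction)
      case zero
      then show ?case by (simp add: fdual_def F_0)
    next
      case (one C)
      then obtain b where b: "b \<in> idx" "fst b = n" "C = cls (M n (snd b))" by (auto simp: top_classes_def clsM_def)
      have m: "is_module K (M n (snd b))" by (simp add: module_M)
      obtain r' where "module_iso K (dual_module K (M n (snd b))) (M n r')" using dual_M_top by blast
      then have "psi (dual_module K (M n (snd b))) = 0"
        using add_invD(1)[OF add_inv_psi dual_mod[OF m] module_M(1)[OF order_refl]] psi_M[of n] by simp
      then show ?case using b m by (simp add: fdual_of expand_of dual_mod keys_decomp_top F_of)
    qed (simp_all add: fdual_diff expand_diff keys_d F_diff)
    then show "green_dual K z \<in> green_span K top_classes"
      using a by (simp add: green_dual_co co_in_span_iff[OF top_subset])
  qed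
qed

text \<open>Multiplying by \<open>[M 2 0]\<close> splits off a shorter module, down to an invertible class \<open>[M 1 s]\<close>.\<close>

lemma rep_ideal_subset_top:
  assumes Y: "rep_ideal_index K Y"
  shows "Y \<subseteq> top_classes"
proof
  have Yi: "Y \<subseteq> indec_classes K" "Y \<noteq> indec_classes K" and id: "ideal (green_span K Y) R"
    using Y by (auto simp: rep_ideal_index_def)
  have mult: "Poly_Mapping.keys (decomp (tensor_module K U V)) \<subseteq> Y"
    if U: "is_module K U" and V: "is_module K V" and "Poly_Mapping.keys (decomp V) \<subseteq> Y" for U V
  proof -
    have "co (frag_of (cls V)) \<in> green_span K Y"
      using that by (simp add: co_in_span_iff[OF Yi(1)] F_of expand_of)
    then have "co (frag_of (cls U)) \<otimes>\<^bsub>R\<^esub> co (frag_of (cls V)) \<in> green_span K Y"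
      using U by (intro ideal.I_l_closed[OF id]) (simp_all add: co_simps F_of)
    then show ?thesis
      using U V by (simp add: co_simps F_of fmul_of co_in_span_iff[OF Yi(1)] expand_of tensor_mod)
  qed
  have down: "\<exists>s. cls (M 1 s) \<in> Y" if "1 \<le> l" "l < n" "cls (M l r) \<in> Y" for l r
    using that
  proof (induction l arbitrary: r rule: less_induct)
    case (less l)
    show ?case
    proof (cases "l = 1")
      case False
      then have l: "2 \<le> l" "l \<le> n" "l + 1 \<le> n" "l - 1 \<le> n" "1 \<le> l - 1" using less by auto
      note m = module_M(1)[OF n2, of 0] module_M(1)[OF l(2), of r] module_M(1)[OF l(3), of r] module_M(1)[OF l(4), of "r - 1"]
      have "Poly_Mapping.keys (decomp (M l r)) \<subseteq> Y" using less l by (simp add: decomp_M keys_frag_of)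
      then have "Poly_Mapping.keys (decomp (tensor_module K (M 2 0) (M l r))) \<subseteq> Y" by (rule mult[OF m(1,2)])
      also have "decomp (tensor_module K (M 2 0) (M l r)) = decomp (direct_sum (M (l + 1) r) (M (l - 1) (r - 1)))"
        using less m by (intro add_invD(1)[OF decomp_add_inv] tensor_mod is_module_direct_sum tensor_M2_lt) auto
      also have "\<dots> = frag_of (cls (M (l + 1) r)) + frag_of (cls (M (l - 1) (r - 1)))"
        using l add_invD(2)[OF decomp_add_inv m(3,4)] by (simp add: decomp_M)
      finally have "Poly_Mapping.keys (frag_of (cls (M (l + 1) r)) + frag_of (cls (M (l - 1) (r - 1)))) \<subseteq> Y" .
      \<comment> \<open>Both coefficients are positive, so neither class can cancel and each one
        lies in the support.\<close>
      then have "cls (M (l - 1) (r - 1)) \<in> Y"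
        by (auto simp: in_keys_iff lookup_add subset_iff)
      then show ?thesis using less(1)[of "l - 1" "r - 1"] l less by auto
    qed (use less in auto)
  qed
  fix C assume C: "C \<in> Y"
  then obtain l s where b: "(l, s) \<in> idx" "C = cls (M l s)" using Yi(1) by (auto simp: indec_classes_K clsM_def)
  show "C \<in> top_classes"
  proof (rule ccontr)
    assume "C \<notin> top_classes"
    then have "l \<noteq> n" using b by (auto simp: top_classes_def clsM_def intro!: image_eqI[of _ _ "(l, s)"])
    then obtain s where s: "cls (M 1 s) \<in> Y" using down[of l s] b C idx_bounds[OF b(1)] by auto
    have 1: "(1::nat) \<le> n" using n2 by simp
    note m1 = module_M(1)[OF 1]
    have triv: "module_iso K (trivial_module K) (M 1 0)"
    proof (rule module_iso_eqI)
      show "gact (trivial_module K) = gact (M 1 0)" "hact (trivial_module K) = hact (M 1 0)"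
        using module_M(2,3)[OF 1, of 0] by (auto simp: trivial_module_K taft_g_mat_def taft_h_mat_def intro!: eq_matI)
      show "rep_dim (trivial_module K) = rep_dim (M 1 0)" by (simp add: trivial_module_def)
    qed (rule trivial_mod m1)+
    have "Poly_Mapping.keys (decomp (M 1 s)) \<subseteq> Y" using s 1 by (simp add: decomp_M keys_frag_of)
    \<comment> \<open>Multiplying by the inverse character produces the unit, and an ideal
      containing the unit contains every class, against the properness of \<open>Y\<close>.\<close>
    then have "Poly_Mapping.keys (decomp (tensor_module K (M 1 (- s)) (M 1 s))) \<subseteq> Y" by (rule mult[OF m1 m1])
    also have "decomp (tensor_module K (M 1 (- s)) (M 1 s)) = decomp (M 1 0)"
      using tensor_M1[OF 1, of "- s" s] by (intro add_invD(1)[OF decomp_add_inv] tensor_mod m1) simp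
    also have "\<dots> = decomp (trivial_module K)"
      using triv by (intro add_invD(1)[OF decomp_add_inv, symmetric] trivial_mod m1)
    finally have t: "Poly_Mapping.keys (decomp (trivial_module K)) \<subseteq> Y" .
    have "clsM b \<in> Y" if b: "b \<in> idx" for b
    proof -
      let ?M = "M (fst b) (snd b)"
      note m = module_clsM[OF b]
      have "decomp (tensor_module K ?M (trivial_module K)) = decomp ?M"
        using tensor_unit_K(2)[OF m] by (intro add_invD(1)[OF decomp_add_inv] tensor_mod trivial_mod m)
      then have "Poly_Mapping.keys (decomp ?M) \<subseteq> Y" using mult[OF m trivial_mod t] by simp
      then show ?thesis using idx_bounds[OF b] by (simp add: decomp_M keys_frag_of clsM_def)
    qed
    then have "indec_classes K \<subseteq> Y" by (auto simp: indec_classes_K)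
    then show False using Yi by blast
  qed
qed

text \<open>Uniqueness in the definite description: a competing \<open>X\<close> has a span
  containing that of \<open>top_classes\<close>, and since the indecomposable classes are a basis,
  inclusion of spans is inclusion of index sets.\<close>

lemma max_index_K: "max_index K = top_classes"
  unfolding max_index_def
proof (rule the_equality)
  show "rep_ideal_index K top_classes \<and> (\<forall>Y. rep_ideal_index K Y \<longrightarrow> green_span K Y \<subseteq> green_span K top_classes)"
  proof (intro conjI allI impI rep_ideal_top)
    fix Y assume "rep_ideal_index K Y"
    then have Y: "Y \<subseteq> top_classes" by (rule rep_ideal_subset_top)
    have "Y \<subseteq> iso_classes K" "top_classes \<subseteq> iso_classes K"
      using Y top_subset indec_classes_subset by blast+
    then show "green_span K Y \<subseteq> green_span K top_classes"
      using Y by (auto simp: green_span_eq)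
  qed
  fix X assume X: "rep_ideal_index K X \<and> (\<forall>Y. rep_ideal_index K Y \<longrightarrow> green_span K Y \<subseteq> green_span K X)"
  have "top_classes \<subseteq> X"
  proof
    fix C assume C: "C \<in> top_classes"
    have Xi: "X \<subseteq> indec_classes K" using X by (auto simp: rep_ideal_index_def)
    have c: "frag_of C \<in> carrier F" "expand (frag_of C) = frag_of C"
      using C top_subset by (auto intro!: indec_carrier expand_indec simp: keys_frag_of)
    have "co (frag_of C) \<in> green_span K top_classes"
      using C c by (simp add: co_in_span_iff[OF top_subset] keys_frag_of)
    then have "co (frag_of C) \<in> green_span K X" using X rep_ideal_top by blast
    then show "C \<in> X" using c by (simp add: co_in_span_iff[OF Xi] keys_frag_of)
  qed
  then show "X = top_classes" using rep_ideal_subset_top X by blast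
qed

section \<open>The growth rate\<close>

lemma core_dim:
  assumes V: "is_module K V"
  shows "green_dim K (core_max K (green_class K V))
    = (\<Sum>b\<in>idx. mult_M (fst b) (snd b) V * (if fst b = n then 0 else int (fst b)))"
proof -
  let ?d = "\<lambda>C. int (rep_dim (rep_of C))"
  let ?c = "frag_extend (\<lambda>C. if C \<in> top_classes then 0 else frag_of C) (decomp V)"
  have cV: "green_coeffs K (green_class K V) = decomp V"
    unfolding green_class_def using V by (simp add: green_coeffs_co F_of expand_of)
  have kd: "Poly_Mapping.keys (decomp V) \<subseteq> indec_classes K"
    using keys_expand[of "frag_of (cls V)"] V by (simp add: expand_of)
  have kc: "Poly_Mapping.keys ?c \<subseteq> indec_classes K"
    by (rule order_trans[OF keys_frag_extend]) (use kd in \<open>auto simp: keys_frag_of split: if_splits\<close>)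
  have "core_max K (green_class K V) = co ?c" by (simp add: core_max_def cV max_index_K)
  then have "green_coeffs K (core_max K (green_class K V)) = ?c"
    using green_coeffs_co[OF indec_carrier[OF kc]] expand_indec[OF kc] by simp
  then have "green_dim K (core_max K (green_class K V)) = fext ?d ?c"
    by (simp add: green_dim_def fext_def)
  also have "\<dots> = fext (\<lambda>C. if C \<in> top_classes then 0 else ?d C) (decomp V)"
    unfolding fext_frag_extend by (simp add: if_distrib cong: if_cong)
  also have "\<dots> = (\<Sum>b\<in>idx. mult_M (fst b) (snd b) V * (if clsM b \<in> top_classes then 0 else ?d (clsM b)))"
    unfolding decomp_def by (simp add: fext_sum finite_idx fext_cmul)
  also have "\<dots> = (\<Sum>b\<in>idx. mult_M (fst b) (snd b) V * (if fst b = n then 0 else int (fst b)))"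
  proof (rule sum.cong)
    fix b assume b: "b \<in> idx"
    have d: "?d (clsM b) = int (fst b)"
      using module_iso_dim[OF rep_of_iso_class(2)[OF module_clsM[OF b]]] by (simp add: clsM_def)
    have "clsM b \<in> top_classes \<longleftrightarrow> fst b = n"
    proof
      assume "clsM b \<in> top_classes"
      then obtain b' where b': "b' \<in> idx" "fst b' = n" "clsM b = clsM b'" by (auto simp: top_classes_def)
      then have "module_iso K (M (fst b) (snd b)) (M (fst b') (snd b'))"
        using iso_class_eq_iff[OF module_clsM[OF b] module_clsM[OF b'(1)]] by (simp add: clsM_def)
      then show "fst b = n" using b'(2) by (auto dest: module_iso_dim)
    qed (use b in \<open>auto simp: top_classes_def\<close>)
    then show "mult_M (fst b) (snd b) V * (if clsM b \<in> top_classes then 0 else ?d (clsM b))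
      = mult_M (fst b) (snd b) V * (if fst b = n then 0 else int (fst b))" using d by simp
  qed simp
  finally show ?thesis .
qed

text \<open>Both bounds hold term by term, multiplicities being nonnegative. For
  \<open>l < n\<close> one has \<open>sin (pi / n) * sinr l <= 1 <= l\<close> and
  \<open>l <= n <= n * sinr l\<close>; for \<open>l = n\<close> the core drops the summand and
  \<open>sinr\<close> vanishes.\<close>

lemma core_dim_bounds:
  assumes V: "is_module K V"
  shows "sin (pi / real n) * psi V \<le> real_of_int (green_dim K (core_max K (green_class K V)))"
    and "real_of_int (green_dim K (core_max K (green_class K V))) \<le> real n * psi V"
proof -
  have D: "real_of_int (green_dim K (core_max K (green_class K V)))
      = (\<Sum>b\<in>idx. real_of_int (mult_M (fst b) (snd b) V) * (if fst b = n then 0 else real (fst b)))"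
    unfolding core_dim[OF V] of_int_sum by (rule sum.cong) auto
  have nn: "0 \<le> real_of_int (mult_M (fst b) (snd b) V)" if "b \<in> idx" for b
    using mult_M_nonneg[OF V] idx_bounds[OF that] by simp
  show "sin (pi / real n) * psi V \<le> real_of_int (green_dim K (core_max K (green_class K V)))"
    unfolding D psi_def sum_distrib_left
  proof (rule sum_mono)
    fix b assume b: "b \<in> idx"
    have "sin (pi / real n) * sinr (fst b) \<le> (if fst b = n then 0 else real (fst b))"
    proof (cases "fst b = n")
      case False
      have "sin (pi / real n) * sinr (fst b) \<le> 1"
        using sinr_le[of "fst b"] sin_pi_n_pos by (simp add: field_simps)
      also have "1 \<le> real (fst b)" using idx_bounds(1)[OF b] by simp
      finally show ?thesis using False by simp
    qed simp
    then show "sin (pi / real n) * (real_of_int (mult_M (fst b) (snd b) V) * sinr (fst b))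
      \<le> real_of_int (mult_M (fst b) (snd b) V) * (if fst b = n then 0 else real (fst b))"
      unfolding mult.left_commute[of _ "real_of_int (mult_M (fst b) (snd b) V)"] by (rule mult_left_mono) (rule nn[OF b])
  qed
  show "real_of_int (green_dim K (core_max K (green_class K V))) \<le> real n * psi V"
    unfolding D psi_def sum_distrib_left
  proof (rule sum_mono)
    fix b assume b: "b \<in> idx"
    have "(if fst b = n then 0 else real (fst b)) \<le> real n * sinr (fst b)"
    proof (cases "fst b = n")
      case False
      then have "1 \<le> sinr (fst b)" using idx_bounds[OF b] by (intro sinr_ge_1) auto
      then have "real n * 1 \<le> real n * sinr (fst b)" by (intro mult_left_mono) auto
      moreover have "real (fst b) \<le> real n" using idx_bounds[OF b] by simp
      ultimately have "real (fst b) \<le> real n * sinr (fst b)" by linarith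
      then show ?thesis using False by simp
    qed simp
    then show "real_of_int (mult_M (fst b) (snd b) V) * (if fst b = n then 0 else real (fst b))
      \<le> real n * (real_of_int (mult_M (fst b) (snd b) V) * sinr (fst b))"
      unfolding mult.left_commute[of _ "real_of_int (mult_M (fst b) (snd b) V)"] by (rule mult_left_mono) (rule nn[OF b])
  qed
qed

text \<open>Represents powers in the Green ring by actual modules, to which the bounds on the core
  apply.\<close>

primrec tensor_pow :: "(nat \<times> nat, 'k) rep \<Rightarrow> nat \<Rightarrow> (nat \<times> nat, 'k) rep" where
  "tensor_pow V 0 = trivial_module K"
| "tensor_pow V (Suc m) = tensor_module K (tensor_pow V m) V"

lemma tensor_pow_module: "is_module K V \<Longrightarrow> is_module K (tensor_pow V m)"
  by (induction m) (simp_all add: trivial_mod tensor_mod)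

lemma green_class_pow: "is_module K V \<Longrightarrow> green_class K V [^]\<^bsub>R\<^esub> m = green_class K (tensor_pow V m)"
proof (induction m)
  case 0
  show ?case by (simp add: green_class_def co_simps)
next
  case (Suc m)
  then show ?case by (simp add: green_class_mult tensor_pow_module)
qed

lemma psi_trivial: "psi (trivial_module K) = 1"
proof -
  have 1: "(1::nat) \<le> n" using n2 by simp
  note m = module_M(1)[OF 1, of 0]
  have "psi (tensor_module K (trivial_module K) (M 1 0)) = psi (M 1 0)"
    by (intro add_invD(1)[OF add_inv_psi] tensor_mod trivial_mod m tensor_unit_K)
  then show ?thesis using psi_tensor[OF trivial_mod m] psi_M[OF 1, of 0] by simp
qed

lemma psi_pow: "is_module K V \<Longrightarrow> psi (tensor_pow V m) = psi V ^ m"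
  by (induction m) (simp_all add: psi_trivial psi_tensor tensor_pow_module)

text \<open>The dimension of the core of the \<open>m\<close>-th power lies between constant
  multiples of \<open>sinr l ^ m\<close>, and \<open>m\<close>-th roots of positive constants tend
  to 1. The limit exists, so it equals the limes superior.\<close>

lemma gamma_max_M:
  assumes l: "1 \<le> l" "l \<le> n"
  shows "gamma_max K (green_class K (M l r)) = ereal (sinr l)"
proof -
  note V = module_M(1)[OF l(2), of r]
  define D where "D m = real_of_int (green_dim K (core_max K (green_class K (M l r) [^]\<^bsub>R\<^esub> m)))" for m :: nat
  have S0: "0 \<le> sinr l" using sinr_ge_1[of l] l by (cases "l = n") auto
  have b: "sin (pi / real n) * sinr l ^ m \<le> D m" "D m \<le> real n * sinr l ^ m" for m
    using core_dim_bounds[OF tensor_pow_module[OF V, of m]] psi_M[OF l(2), of r]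
    by (simp_all add: D_def green_class_pow[OF V] psi_pow[OF V])
  have lim: "(\<lambda>m. root m c * sinr l) \<longlonglongrightarrow> sinr l" if "0 < c" for c
    using tendsto_mult[OF LIMSEQ_root_const[OF that] tendsto_const[of "sinr l"]] by simp
  \<comment> \<open>Stated for \<open>m > 0\<close>, where the root undoes the power; the bounds are
    therefore compared only eventually.\<close>
  have rt: "root m (c * sinr l ^ m) = root m c * sinr l" if "0 < m" for m c
    using that S0 by (simp add: real_root_mult real_root_power_cancel)
  have "(\<lambda>m. root m (D m)) \<longlonglongrightarrow> sinr l"
  proof (rule tendsto_sandwich)
    show "(\<lambda>m. root m (sin (pi / real n)) * sinr l) \<longlonglongrightarrow> sinr l" "(\<lambda>m. root m (real n) * sinr l) \<longlonglongrightarrow> sinr l"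
      using lim sin_pi_n_pos n2 by simp_all
    show "\<forall>\<^sub>F m in sequentially. root m (sin (pi / real n)) * sinr l \<le> root m (D m)"
      using b(1) by (intro eventually_mono[OF eventually_gt_at_top[of 0]]) (simp flip: rt)
    show "\<forall>\<^sub>F m in sequentially. root m (D m) \<le> root m (real n) * sinr l"
      using b(2) by (intro eventually_mono[OF eventually_gt_at_top[of 0]]) (simp flip: rt)
  qed
  then have "(\<lambda>m. ereal (root m (D m))) \<longlonglongrightarrow> ereal (sinr l)" by simp
  then show ?thesis
    unfolding gamma_max_def D_def[symmetric] by (intro lim_imp_Limsup) simp_all
qed

end

theorem theorem4p6:
  fixes n l :: nat and r :: int and q :: "'k::alg_closed_field"
  assumes "n \<ge> 2"
    and "q ^ n = 1" and "\<And>k. 0 < k \<Longrightarrow> k < n \<Longrightarrow> q ^ k \<noteq> 1"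
    and "1 \<le> l" and "l \<le> n"
  shows "gamma_max (taft n q) (green_class (taft n q) (taft_module q l r))
           = ereal (sin (real l * pi / real n) / sin (pi / real n))"
proof -
  interpret taft_param n q by unfold_locales (use assms(1-3) in auto)
  show ?thesis using gamma_max_M[OF assms(4,5)] by (simp add: sinr_def)
qed

end
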